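(* For any integer $n\ge1$, set $Q=2n+2$, $$\mathcal C_n:=\frac{2^{n-3}\,n\,\Gamma(\frac n2)^2}{\pi^{n+1}},$$ $$\mathcal C_n':=Q^{\frac1Q}\left(\pi^n\,\frac{\Gamma(\frac{2Q-1}{2(Q-1)})}{\Gamma(\frac{2Q-1}{2(Q-1)}+\frac12)}\,\frac{\Gamma(\frac n2+\frac Q{4(Q-1)})}{\Gamma(\frac n2+\frac Q{4(Q-1)}+\frac12)}\,\frac{\Gamma(1+\frac Q{2(Q-1)})}{\Gamma(n+\frac Q{2(Q-1)})}\right)^{\frac{Q-1}Q}.$$ Then the isoperimetric constant of the Heisenberg group satisfies $$I(\mathbb H_n)\ge\mathcal C_n^{-1}\,(\mathcal C_n')^{-1}.$$
   Context: $\mathbb H_n$ is $\mathbb R^{2n+1}$ with coordinates $(x,y,z)$, $x,y\in\mathbb R^n$, $z\in\mathbb R$, Lebesgue measure $|\cdot|$, and the vector fields $X_j=\partial_{x_j}+2y_j\partial_z$, $Y_j=\partial_{y_j}-2x_j\partial_z$, $1\le j\le n$. The (horizontal) perimeter of a measurable set $E\subset\mathbb H_n$ is $\mathrm{Per}_{\mathbb H_n}(E)=\sup\{\int_E\sum_{j=1}^n(X_j\varphi_j+Y_j\varphi_{n+j})\,dx\,dy\,dz:\ \varphi\in C_c^1(\mathbb H_n,\mathbb R^{2n}),\ |\varphi|\le1\}$. $I(\mathbb H_n)$ is the largest constant such that $\mathrm{Per}_{\mathbb H_n}(E)\ge I(\mathbb H_n)|E|^{\frac{2n+1}{2n+2}}$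 for every measurable $E\subset\mathbb H_n$ of finite measure. *)

theory Defs
  imports "HOL-Analysis.Analysis"
begin

text \<open>Points of the Heisenberg group are triples \<open>(x, y, z)\<close>; the group dimension \<open>n \<ge> 1\<close> is \<open>CARD('n)\<close>.\<close>

type_synonym 'n heis = "(real ^ 'n) \<times> (real ^ 'n) \<times> real"

abbreviation dir_deriv :: "'a::euclidean_space \<Rightarrow> ('a \<Rightarrow> real) \<Rightarrow> 'a \<Rightarrow> real"
  where "dir_deriv v f p \<equiv> frechet_derivative f (at p) v"

definition X_field :: "'n::finite \<Rightarrow> ('n heis \<Rightarrow> real) \<Rightarrow> 'n heis \<Rightarrow> real"
  where "X_field j f = (\<lambda>(x, y, z).
    dir_deriv (axis j 1, 0, 0) f (x, y, z) + 2 * (y $ j) * dir_deriv (0, 0, 1) f (x, y, z))"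

definition Y_field :: "'n::finite \<Rightarrow> ('n heis \<Rightarrow> real) \<Rightarrow> 'n heis \<Rightarrow> real"
  where "Y_field j f = (\<lambda>(x, y, z).
    dir_deriv (0, axis j 1, 0) f (x, y, z) - 2 * (x $ j) * dir_deriv (0, 0, 1) f (x, y, z))"

definition C1_compact_support :: "('a::euclidean_space \<Rightarrow> 'b::euclidean_space) \<Rightarrow> bool"
  where "C1_compact_support \<phi> \<longleftrightarrow>
    (\<exists>\<phi>' :: 'a \<Rightarrow> 'a \<Rightarrow>\<^sub>L 'b.
      (\<forall>p. (\<phi> has_derivative blinfun_apply (\<phi>' p)) (at p)) \<and> continuous_on UNIV \<phi>') \<and>
    compact (closure {p. \<phi> p \<noteq> 0})"

text \<open>Horizontal fields take values in \<open>\<real>\<^sup>n \<times> \<real>\<^sup>n\<close>; the product norm is the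
  Euclidean norm of \<open>\<real>\<^sup>2\<^sup>n\<close>.\<close>

definition horizontal_div ::
    "('n::finite heis \<Rightarrow> (real ^ 'n) \<times> (real ^ 'n)) \<Rightarrow> 'n heis \<Rightarrow> real"
  where "horizontal_div \<phi> p =
    (\<Sum>j\<in>UNIV. X_field j (\<lambda>q. fst (\<phi> q) $ j) p + Y_field j (\<lambda>q. snd (\<phi> q) $ j) p)"

definition horizontal_perimeter :: "'n::finite heis set \<Rightarrow> ereal"
  where "horizontal_perimeter E =
    (SUP \<phi> \<in> {\<phi>. C1_compact_support \<phi> \<and> (\<forall>p. norm (\<phi> p) \<le> 1)}.
      ereal (LINT p:E|lebesgue. horizontal_div \<phi> p))"

definition isoperimetric_bound :: "'n::finite itself \<Rightarrow> ereal \<Rightarrow> bool"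
  where "isoperimetric_bound _ c \<longleftrightarrow>
    (\<forall>E :: 'n heis set. E \<in> lmeasurable \<longrightarrow>
      horizontal_perimeter E \<ge>
        c * ereal (measure lebesgue E powr ((2 * real CARD('n) + 1) / (2 * real CARD('n) + 2))))"

text \<open>Perimeters may be infinite, so constants range over the extended reals, where a largest
  one exists (\<open>isoperimetric_constant_greatest\<close> below).\<close>

definition isoperimetric_constant :: "'n::finite itself \<Rightarrow> ereal"
  where "isoperimetric_constant T = (GREATEST c. isoperimetric_bound T c)"

lemma horizontal_perimeter_nonneg: "0 \<le> horizontal_perimeter (E :: 'n::finite heis set)"
proof -
  let ?\<phi> = "\<lambda>_ :: 'n heis. 0 :: (real ^ 'n) \<times> (real ^ 'n)"
  have "C1_compact_support ?\<phi>"
    unfolding C1_compact_support_def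
    by (intro conjI exI[of _ "\<lambda>_. 0"]) (simp_all add: zero_blinfun.rep_eq)
  moreover have "horizontal_div ?\<phi> = (\<lambda>_. 0)"
    by (rule ext) (simp add: horizontal_div_def X_field_def Y_field_def split_beta)
  ultimately show ?thesis
    unfolding horizontal_perimeter_def
    by (intro SUP_upper2[of ?\<phi>]) (auto simp: set_lebesgue_integral_def zero_ereal_def)
qed

lemma isoperimetric_constant_greatest:
  fixes T :: "'n::finite itself"
  shows "isoperimetric_bound T (isoperimetric_constant T)"
    and "isoperimetric_bound T c \<Longrightarrow> c \<le> isoperimetric_constant T"
proof -
  let ?S = "Sup {c. isoperimetric_bound T c}"
  have S: "isoperimetric_bound T ?S"
  proof (rule isoperimetric_bound_def[THEN iffD2], intro allI impI)
    fix E :: "'n heis set" assume E: "E \<in> lmeasurable"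
    define m where
      "m = measure lebesgue E powr ((2 * real CARD('n) + 1) / (2 * real CARD('n) + 2))"
    have "?S * ereal m \<le> horizontal_perimeter E"
    proof (cases "m = 0")
      case True
      then show ?thesis using horizontal_perimeter_nonneg[of E] by (simp add: zero_ereal_def[symmetric])
    next
      case False
      then have m: "0 < m" by (simp add: m_def)
      have "c \<le> horizontal_perimeter E / ereal m" if "isoperimetric_bound T c" for c
      proof -
        have "c * ereal m \<le> horizontal_perimeter E"
          using that E unfolding isoperimetric_bound_def m_def by blast
        then show ?thesis using m by (simp add: ereal_le_divide_pos mult.commute)
      qed
      then have "?S \<le> horizontal_perimeter E / ereal m"
        by (intro Sup_least) auto
      then show ?thesis using m by (simp add: ereal_le_divide_pos mult.commute)
    qed
    then show "?S * ereal (measure lebesgue E powr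
        ((2 * real CARD('n) + 1) / (2 * real CARD('n) + 2))) \<le> horizontal_perimeter E"
      by (simp add: m_def)
  qed
  have eq: "isoperimetric_constant T = ?S"
    unfolding isoperimetric_constant_def
    by (rule Greatest_equality) (use S in \<open>auto intro: Sup_upper\<close>)
  show "isoperimetric_bound T (isoperimetric_constant T)"
    using S eq by simp
  show "c \<le> isoperimetric_constant T" if "isoperimetric_bound T c"
    using that eq by (simp add: Sup_upper)
qed

definition hom_dim :: "nat \<Rightarrow> real"
  where "hom_dim n = 2 * real n + 2"

definition C_const :: "nat \<Rightarrow> real"
  where "C_const n = 2 powr (real n - 3) * real n * (Gamma (real n / 2))\<^sup>2 / pi ^ (n + 1)"

definition C'_const :: "nat \<Rightarrow> real"
  where "C'_const n = (let Q = hom_dim n in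
    Q powr (1 / Q) *
    (pi ^ n
      * (Gamma ((2 * Q - 1) / (2 * (Q - 1))) / Gamma ((2 * Q - 1) / (2 * (Q - 1)) + 1 / 2))
      * (Gamma (real n / 2 + Q / (4 * (Q - 1))) / Gamma (real n / 2 + Q / (4 * (Q - 1)) + 1 / 2))
      * (Gamma (1 + Q / (2 * (Q - 1))) / Gamma (real n + Q / (2 * (Q - 1)))))
    powr ((Q - 1) / Q))"

end

theory Submission imports Defs begin

text \<open>The horizontal gradient \<open>G\<close> of the (regularised) Folland fundamental solution gives, for
  a bump function \<open>f \<approx> 1\<^sub>E\<close>, a test field
  \<open>\<phi>(\<eta>) = \<integral> f(\<xi>) G(\<xi>\<inverse>\<eta>) d\<xi>\<close> whose horizontal divergence is a mollification of
  \<open>f\<close>, so that \<open>|E| \<approx> \<integral>\<^sub>E div \<phi> \<le> sup |\<phi>| Per(E)\<close>. For a unit vector \<open>e\<close> the bathtub principle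
  bounds \<open>e \<bullet> \<phi>\<close> through the distribution function of \<open>e \<bullet> G\<close>. Rotating \<open>\<zeta> = (x, y)\<close> by an angle
  that depends on \<open>|\<zeta>|\<close> and \<open>z\<close> only, this function becomes that of
  \<open>(e \<bullet> \<zeta>) / N\<^sup>Q\<close> with \<open>N\<^sup>4 = |\<zeta>|\<^sup>4 + z\<^sup>2\<close>, which is homogeneous of degree \<open>1 - Q\<close>; its
  spherical moment of order \<open>Q / (Q - 1)\<close> is the product of Gamma quotients in \<open>C'_const\<close>.\<close>

section \<open>Gaussian integrals and isometries\<close>

text \<open>The perimeter is a supremum over fields, so one good field bounds it from below for
  every set of finite volume, without any regularity of E. The constants arise as follows. The
  divergence of the kernel \<open>fs_kernel \<epsilon>\<close> has total mass
  \<open>1 / C_const\<close>, whatever \<epsilon> is, so multiplying the field by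
  \<open>C_const\<close> makes its divergence an average of f. The bathtub bound sees f only through
  its integral v, and homogeneity of degree 1 - Q turns it into \<open>C'_const\<close> times
  v^(1/Q); with v close to |E| this gives |E| <= C C' |E|^(1/Q) Per(E), hence the exponent 1 - 1/Q.
  The kernel is not e-component times radial function: its direction twists with z. The
  point-dependent rotation undoes the twist, and only afterwards can the regularised kernel be
  compared with the singular one, with a bound uniform in \<epsilon>. The remaining obstacles are
  that the field has no compact support and that E may be unbounded and merely measurable. Integrals
  are evaluated as nonnegative extended integrals, so that Fubini and substitutions need no
  integrability in advance.\<close>

lemma ennreal_mult_left_eqD:
  assumes "ennreal c * I = ennreal b" "c > 0"
  shows "I = ennreal (b / c)"
proof -
  have "ennreal (inverse c) * (ennreal c * I) = I"
    using assms(2) unfolding mult.assoc[symmetric]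
    by (subst ennreal_mult[symmetric]) (auto)
  moreover have "ennreal (inverse c) * ennreal b = ennreal (b / c)"
    using assms(2) by (subst ennreal_mult'[symmetric]) (auto simp: divide_inverse mult.commute)
  ultimately show ?thesis using assms(1) by simp
qed

section \<open>Translations, scalings and linear isometries\<close>

lemma nn_integral_lborel_translate:
  fixes f :: "'a::euclidean_space \<Rightarrow> ennreal"
  assumes [measurable]: "f \<in> borel_measurable borel"
  shows "(\<integral>\<^sup>+x. f (c + x) \<partial>lborel) = (\<integral>\<^sup>+x. f x \<partial>lborel)"
proof -
  have "(\<integral>\<^sup>+x. f x \<partial>lborel) = (\<integral>\<^sup>+x. f x \<partial>distr lborel borel ((+) c))"
    by (simp add: lborel_distr_plus)
  also have "\<dots> = (\<integral>\<^sup>+x. f (c + x) \<partial>lborel)"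
    by (rule nn_integral_distr) auto
  finally show ?thesis ..
qed

lemma nn_integral_lborel_scaleR:
  fixes f :: "'a::euclidean_space \<Rightarrow> ennreal"
  assumes [measurable]: "f \<in> borel_measurable borel" and c: "c \<noteq> 0"
  shows "(\<integral>\<^sup>+x. f x \<partial>lborel) = ennreal (\<bar>c\<bar> ^ DIM('a)) * (\<integral>\<^sup>+x. f (c *\<^sub>R x) \<partial>lborel)"
  by (subst lborel_affine[OF c, of 0])
     (simp add: nn_integral_density nn_integral_distr nn_integral_cmult)

lemma nn_integral_lborel_uminus:
  fixes f :: "'a::euclidean_space \<Rightarrow> ennreal"
  assumes [measurable]: "f \<in> borel_measurable borel"
  shows "(\<integral>\<^sup>+x. f (- x) \<partial>lborel) = (\<integral>\<^sup>+x. f x \<partial>lborel)"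
  using nn_integral_lborel_scaleR[OF assms, of "-1"] by simp

text \<open>Uniqueness of Haar measure by Fubini: pairing \<open>f\<close> with the unit ball pins down the constant.\<close>

lemma nn_integral_lborel_isometry:
  fixes f :: "'a::euclidean_space \<Rightarrow> ennreal" and U :: "'a \<Rightarrow> 'a"
  assumes f[measurable]: "f \<in> borel_measurable borel"
    and U: "linear U" "\<And>x. norm (U x) = norm x"
  shows "(\<integral>\<^sup>+x. f (U x) \<partial>lborel) = (\<integral>\<^sup>+x. f x \<partial>lborel)"
proof -
  have "inj U"
    using U by (metis linear_injective_0 norm_eq_zero)
  then have "surj U"
    using U(1) linear_injective_imp_surjective by blast
  have [measurable]: "U \<in> borel_measurable borel"
    using U(1) by (intro borel_measurable_continuous_onI linear_continuous_on linear_conv_bounded_linear[THEN iffD1])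
  \<comment> \<open>Surjectivity of \<open>U\<close> turns a shift of \<open>U x\<close> into a
    shift of \<open>x\<close>, so the image measure under \<open>U\<close> is translation invariant
    as well.\<close>
  have trans: "(\<integral>\<^sup>+x. h (U x + y) \<partial>lborel) = (\<integral>\<^sup>+x. h (U x) \<partial>lborel)"
    if [measurable]: "h \<in> borel_measurable borel" for h :: "'a \<Rightarrow> ennreal" and y
  proof -
    obtain z where "y = U z" using \<open>surj U\<close> by blast
    then have "(\<integral>\<^sup>+x. h (U x + y) \<partial>lborel) = (\<integral>\<^sup>+x. h (U (z + x)) \<partial>lborel)"
      using U(1) by (simp add: linear_add add.commute)
    also have "\<dots> = (\<integral>\<^sup>+x. h (U x) \<partial>lborel)"
      by (rule nn_integral_lborel_translate[of "\<lambda>x. h (U x)"]) auto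
    finally show ?thesis .
  qed
  define g :: "'a \<Rightarrow> ennreal" where "g = indicator (ball 0 1)"
  have g[measurable]: "g \<in> borel_measurable borel" by (auto simp: g_def intro!: borel_measurable_indicator)
  have "g (U x) = g x" for x by (simp add: g_def indicator_def U)
  then have gU: "(\<integral>\<^sup>+x. g (U x) \<partial>lborel) = (\<integral>\<^sup>+x. g x \<partial>lborel)" by simp
  have g1: "(\<integral>\<^sup>+x. g x \<partial>lborel) = emeasure lborel (ball 0 1 :: 'a set)"
    by (simp add: g_def)
  have "(\<integral>\<^sup>+x. f (U x) \<partial>lborel) * (\<integral>\<^sup>+x. g x \<partial>lborel)
      = (\<integral>\<^sup>+x. f (U x) * (\<integral>\<^sup>+y. g (U x + y) \<partial>lborel) \<partial>lborel)"
    by (simp add: nn_integral_lborel_translate nn_integral_multc)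
  also have "\<dots> = (\<integral>\<^sup>+x. (\<integral>\<^sup>+y. f (U x) * g (U x + y) \<partial>lborel) \<partial>lborel)"
    by (intro nn_integral_cong nn_integral_cmult[symmetric]) simp
  also have "\<dots> = (\<integral>\<^sup>+y. (\<integral>\<^sup>+x. f (U x) * g (U x + y) \<partial>lborel) \<partial>lborel)"
    by (rule lborel_pair.Fubini') simp
  also have "\<dots> = (\<integral>\<^sup>+y. (\<integral>\<^sup>+x. f (U x - y) * g (U x) \<partial>lborel) \<partial>lborel)"
  proof (rule nn_integral_cong)
    fix y
    show "(\<integral>\<^sup>+x. f (U x) * g (U x + y) \<partial>lborel) = (\<integral>\<^sup>+x. f (U x - y) * g (U x) \<partial>lborel)"
      using trans[of "\<lambda>u. f u * g (u + y)" "-y"] by simp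
  qed
  also have "\<dots> = (\<integral>\<^sup>+x. (\<integral>\<^sup>+y. f (U x - y) * g (U x) \<partial>lborel) \<partial>lborel)"
    by (rule lborel_pair.Fubini') simp
  also have "\<dots> = (\<integral>\<^sup>+x. (\<integral>\<^sup>+y. f y \<partial>lborel) * g (U x) \<partial>lborel)"
  proof (rule nn_integral_cong)
    fix x
    have "(\<integral>\<^sup>+y. f (U x - y) \<partial>lborel) = (\<integral>\<^sup>+y. f (U x + y) \<partial>lborel)"
      using nn_integral_lborel_uminus[of "\<lambda>y. f (U x + y)"] by simp
    then show "(\<integral>\<^sup>+y. f (U x - y) * g (U x) \<partial>lborel) = (\<integral>\<^sup>+y. f y \<partial>lborel) * g (U x)"
      by (simp add: nn_integral_multc nn_integral_lborel_translate)
  qed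
  also have "\<dots> = (\<integral>\<^sup>+x. f x \<partial>lborel) * (\<integral>\<^sup>+x. g x \<partial>lborel)"
    by (simp add: nn_integral_cmult gU)
  finally have "(\<integral>\<^sup>+x. f (U x) \<partial>lborel) * emeasure lborel (ball 0 1 :: 'a set)
    = (\<integral>\<^sup>+x. f x \<partial>lborel) * emeasure lborel (ball 0 1 :: 'a set)"
    by (simp add: g1)
  moreover have "emeasure lborel (ball 0 1 :: 'a set) \<noteq> \<infinity>"
    using emeasure_bounded_finite[of "ball 0 1 :: 'a set"] by auto
  moreover have "emeasure lborel (ball 0 1 :: 'a set) \<noteq> 0"
    using content_ball_pos[of 1 "0::'a"] by (auto simp: measure_def)
  ultimately show ?thesis
    by (simp add: mult.commute[of _ "emeasure lborel (ball 0 1)"] ennreal_mult_cancel_left)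
qed

section \<open>Gamma and Gaussian integrals\<close>

lemma nn_integral_power2_subst:
  fixes f :: "real \<Rightarrow> real"
  assumes [measurable]: "f \<in> borel_measurable borel" and nn: "\<And>x. 0 \<le> f x"
  shows "(\<integral>\<^sup>+x. ennreal (f x) * indicator {0..} x \<partial>lborel)
    = (\<integral>\<^sup>+x. ennreal (f (x\<^sup>2) * (2 * x)) * indicator {0..} x \<partial>lborel)"
proof -
  \<comment> \<open>Substitution is done on compact intervals, followed by monotone convergence. The
    exponent \<open>k\<close> serves both sides: \<open>{0..n^2}\<close> on the left corresponds
    under the square to \<open>{0..n^1}\<close> on the right.\<close>
  have un: "(\<lambda>n::nat. \<integral>\<^sup>+x. h x * indicator {0..(real n)^k} x \<partial>lborel)
      \<longlonglongrightarrow> (\<integral>\<^sup>+x. h x * indicator {0..} x \<partial>lborel)"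
    if [measurable]: "h \<in> borel_measurable borel" and k: "k > 0" for h :: "real \<Rightarrow> ennreal" and k
  proof (rule nn_integral_LIMSEQ)
    show "incseq (\<lambda>n x. h x * indicator {0..real n ^ k} x)"
    proof (intro incseq_SucI le_funI mult_left_mono)
      fix n and x :: real
      have "real n ^ k \<le> real (Suc n) ^ k" by (intro power_mono) auto
      then show "indicator {0..real n ^ k} x \<le> (indicator {0..real (Suc n) ^ k} x :: ennreal)"
        by (auto simp: indicator_def)
    qed simp
    show "(\<lambda>n. h x * indicator {0..real n ^ k} x) \<longlonglongrightarrow> h x * indicator {0..} x" for x
    proof -
      have "eventually (\<lambda>n. x \<le> real n ^ k) sequentially"
      proof -
        obtain N :: nat where N: "x \<le> N" using real_arch_simple by blast
        show ?thesis
          using eventually_ge_at_top[of "max 1 N"]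
        proof eventually_elim
          case (elim n)
          have "x \<le> real n ^ 1" using N elim by simp
          also have "\<dots> \<le> real n ^ k" using elim k by (intro power_increasing) auto
          finally show ?case .
        qed
      qed
      then show ?thesis
        by (rule tendsto_eventually[OF eventually_mono]) (auto simp: indicator_def)
    qed
  qed auto
  have "(\<integral>\<^sup>+x. ennreal (f x) * indicator {0..(real n)^2} x \<partial>lborel)
      = (\<integral>\<^sup>+x. ennreal (f (x\<^sup>2) * (2 * x)) * indicator {0..(real n)^1} x \<partial>lborel)" for n :: nat
  proof -
    have "(\<integral>\<^sup>+x. ennreal (f x) * indicator {0..(real n)^2} x \<partial>lborel)
      = (\<integral>\<^sup>+x. ennreal (f x * indicator {0\<^sup>2..(real n)\<^sup>2} x) \<partial>lborel)"
      by (intro nn_integral_cong) (auto simp: indicator_def)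
    also have "\<dots> = (\<integral>\<^sup>+x. ennreal (f (x\<^sup>2) * (2 * x) * indicator {0..real n} x) \<partial>lborel)"
      using nn_integral_substitution[where a=0 and b="real n" and g="\<lambda>x. x\<^sup>2" and f=f and g'="\<lambda>x. 2 * x"]
      by (simp add: set_borel_measurable_def) (force intro!: derivative_eq_intros continuous_intros)
    also have "\<dots> = (\<integral>\<^sup>+x. ennreal (f (x\<^sup>2) * (2 * x)) * indicator {0..(real n)^1} x \<partial>lborel)"
      by (intro nn_integral_cong) (auto simp: indicator_def)
    finally show ?thesis .
  qed
  with un[of "\<lambda>x. ennreal (f x)" 2] un[of "\<lambda>x. ennreal (f (x\<^sup>2) * (2 * x))" 1]
  show ?thesis
    by (auto intro: LIMSEQ_unique)
qed

lemma nn_integral_Gamma_scaled: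
  assumes "a > 0" "q > (0::real)"
  shows "(\<integral>\<^sup>+t. ennreal (t powr (q - 1) * exp (- a * t)) * indicator {0..} t \<partial>lborel)
    = ennreal (Gamma q * a powr (- q))"
proof -
  let ?I = "\<integral>\<^sup>+t. ennreal (t powr (q - 1) * exp (- a * t)) * indicator {0..} t \<partial>lborel"
  have "ennreal (Gamma q) = (\<integral>\<^sup>+t. ennreal (indicator {0..} t * t powr (q - 1) / exp t) \<partial>lborel)"
    using Gamma_conv_nn_integral_real[OF assms(2)] by simp
  also have "\<dots> = ennreal \<bar>a\<bar> *
      (\<integral>\<^sup>+t. ennreal (indicator {0..} (0 + a * t) * (0 + a * t) powr (q - 1) / exp (0 + a * t)) \<partial>lborel)"
    using assms by (intro nn_integral_real_affine) auto
  also have "\<dots> = ennreal a *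
      (\<integral>\<^sup>+t. ennreal (a powr (q - 1)) * (ennreal (t powr (q - 1) * exp (- a * t)) * indicator {0..} t) \<partial>lborel)"
    using assms by (auto simp: indicator_def zero_le_mult_iff powr_mult exp_minus field_simps
        ennreal_mult[symmetric] intro!: arg_cong2[where f="(*)"] nn_integral_cong)
  also have "\<dots> = ennreal a * (ennreal (a powr (q - 1)) * ?I)"
    by (subst nn_integral_cmult) auto
  also have "\<dots> = ennreal (a powr q) * ?I"
    using assms by (simp add: mult.assoc[symmetric] ennreal_mult[symmetric] powr_diff)
  finally have "?I = ennreal (Gamma q / a powr q)"
    using assms by (intro ennreal_mult_left_eqD) auto
  then show ?thesis
    by (simp add: powr_minus divide_inverse)
qed

lemma nn_integral_Gamma_square:
  assumes "a > 0" "q > (0::real)"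
  shows "(\<integral>\<^sup>+t. ennreal (t powr (q - 1) * exp (- a * t\<^sup>2)) * indicator {0..} t \<partial>lborel)
    = ennreal (Gamma (q / 2) / 2 * a powr (- q / 2))"
proof -
  have "ennreal (Gamma (q / 2) * a powr (- (q / 2)))
      = (\<integral>\<^sup>+t. ennreal (t powr (q / 2 - 1) * exp (- a * t)) * indicator {0..} t \<partial>lborel)"
    using assms by (intro nn_integral_Gamma_scaled[symmetric]) auto
  also have "\<dots> = (\<integral>\<^sup>+t. ennreal ((t\<^sup>2) powr (q / 2 - 1) * exp (- a * t\<^sup>2) * (2 * t)) * indicator {0..} t \<partial>lborel)"
    by (intro nn_integral_power2_subst) auto
  also have "\<dots> = (\<integral>\<^sup>+t. ennreal 2 * (ennreal (t powr (q - 1) * exp (- a * t\<^sup>2)) * indicator {0..} t) \<partial>lborel)"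
  proof (rule nn_integral_cong)
    fix t :: real
    have "(t\<^sup>2) powr (q / 2 - 1) * t = t powr (q - 1)" if "t > 0"
    proof -
      have "(t\<^sup>2) powr (q / 2 - 1) = t powr (q - 2)"
        using that by (simp add: powr_powr algebra_simps flip: powr_numeral)
      then show ?thesis
        using that powr_mult_base[of t "q - 2"] by (simp add: mult.commute)
    qed
    then show "ennreal ((t\<^sup>2) powr (q / 2 - 1) * exp (- a * t\<^sup>2) * (2 * t)) * indicator {0..} t
      = ennreal 2 * (ennreal (t powr (q - 1) * exp (- a * t\<^sup>2)) * indicator {0..} t)"
      by (cases "t > 0"; cases "t = 0")
         (simp_all add: indicator_def ennreal_mult[symmetric] mult.commute mult.left_commute del: ennreal_numeral)
  qed
  also have "\<dots> = ennreal 2 * (\<integral>\<^sup>+t. ennreal (t powr (q - 1) * exp (- a * t\<^sup>2)) * indicator {0..} t \<partial>lborel)"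
    by (rule nn_integral_cmult) auto
  finally show ?thesis
    using ennreal_mult_left_eqD[OF sym, of "Gamma (q / 2) * a powr (- (q / 2))" 2] by simp
qed

lemma nn_integral_gaussian_real:
  assumes "a > (0::real)"
  shows "(\<integral>\<^sup>+t. ennreal (exp (- a * t\<^sup>2)) \<partial>lborel) = ennreal (sqrt (pi / a))"
proof -
  have half: "(\<integral>\<^sup>+t. ennreal (exp (- a * t\<^sup>2)) * indicator {0..} t \<partial>lborel) = ennreal (sqrt (pi / a) / 2)"
  proof -
    \<comment> \<open>\<open>0 powr 0 = 0\<close>, so the integrands differ at the origin and agree
      only almost everywhere.\<close>
    have "(\<integral>\<^sup>+t. ennreal (exp (- a * t\<^sup>2)) * indicator {0..} t \<partial>lborel)
        = (\<integral>\<^sup>+t. ennreal (t powr (1 - 1) * exp (- a * t\<^sup>2)) * indicator {0..} t \<partial>lborel)"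
      by (rule nn_integral_cong_AE, rule AE_mp[OF AE_lborel_singleton[of 0]], rule AE_I2) simp
    then show ?thesis
      using nn_integral_Gamma_square[OF assms, of 1] assms
      by (simp add: Gamma_one_half_real real_sqrt_divide powr_minus powr_half_sqrt field_simps)
  qed
  \<comment> \<open>Both half lines contain 0, where the sum counts the integrand twice; this is a
    null set.\<close>
  have "(\<integral>\<^sup>+t. ennreal (exp (- a * t\<^sup>2)) \<partial>lborel)
      = (\<integral>\<^sup>+t. ennreal (exp (- a * t\<^sup>2)) * indicator {0..} t + ennreal (exp (- a * t\<^sup>2)) * indicator {0..} (-t) \<partial>lborel)"
    by (rule nn_integral_cong_AE, rule AE_mp[OF AE_lborel_singleton[of 0]], rule AE_I2) (auto simp: indicator_def)
  also have "\<dots> = (\<integral>\<^sup>+t. ennreal (exp (- a * t\<^sup>2)) * indicator {0..} t \<partial>lborel)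
     + (\<integral>\<^sup>+t. ennreal (exp (- a * t\<^sup>2)) * indicator {0..} (-t) \<partial>lborel)"
    by (rule nn_integral_add) auto
  also have "(\<integral>\<^sup>+t. ennreal (exp (- a * t\<^sup>2)) * indicator {0..} (-t) \<partial>lborel)
     = (\<integral>\<^sup>+t. ennreal (exp (- a * t\<^sup>2)) * indicator {0..} t \<partial>lborel)"
    using nn_integral_lborel_uminus[of "\<lambda>t::real. ennreal (exp (- a * t\<^sup>2)) * indicator {0..} t"] by simp
  finally show ?thesis
    using assms by (simp only: half, subst ennreal_plus[symmetric]) auto
qed

lemma exp_norm_square_prod:
  fixes x :: "'a::euclidean_space"
  shows "exp (- a * (norm x)\<^sup>2) = (\<Prod>b\<in>Basis. exp (- a * (x \<bullet> b)\<^sup>2))"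
proof -
  have "(norm x)\<^sup>2 = (\<Sum>b\<in>Basis. (x \<bullet> b)\<^sup>2)"
    by (simp add: norm_eq_sqrt_inner euclidean_inner[of x x] power2_eq_square sum_nonneg)
  then show ?thesis
    by (simp add: exp_sum[symmetric] sum_distrib_left)
qed

lemma nn_integral_gaussian:
  assumes "a > 0"
  shows "(\<integral>\<^sup>+x. ennreal (exp (- a * (norm (x::'a::euclidean_space))\<^sup>2)) \<partial>lborel)
    = ennreal ((pi / a) powr (DIM('a) / 2))"
proof -
  have "(\<integral>\<^sup>+x. ennreal (exp (- a * (norm (x::'a))\<^sup>2)) \<partial>lborel)
     = (\<integral>\<^sup>+x. (\<Prod>b\<in>Basis. ennreal (exp (- a * ((x::'a) \<bullet> b)\<^sup>2))) \<partial>lborel)"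
    unfolding exp_norm_square_prod by (simp add: prod_ennreal)
  also have "\<dots> = (\<Prod>b\<in>(Basis::'a set). \<integral>\<^sup>+t. ennreal (exp (- a * t\<^sup>2)) \<partial>lborel)"
    by (intro nn_integral_lborel_prod) auto
  also have "\<dots> = ennreal (sqrt (pi / a) ^ DIM('a))"
    by (simp only: nn_integral_gaussian_real[OF assms] prod_constant) (simp add: ennreal_power assms less_imp_le)
  also have "sqrt (pi / a) ^ DIM('a) = (pi / a) powr (DIM('a) / 2)"
    using assms by (simp add: powr_half_sqrt[symmetric] powr_powr flip: powr_realpow)
  finally show ?thesis .
qed

text \<open>A Gamma integral writes the negative power as a mixture of Gaussians in
  \<open>x\<close>, which can be integrated under the mixture by Tonelli. It is applied to the
  one-dimensional centre and to the 2n-dimensional horizontal plane.\<close>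

lemma nn_integral_bessel_kernel:
  assumes a: "a > 0" and q: "q > DIM('a) / 2"
  shows "(\<integral>\<^sup>+x. ennreal ((a + (norm (x::'a::euclidean_space))\<^sup>2) powr (- q)) \<partial>lborel)
    = ennreal (pi powr (DIM('a) / 2) * Gamma (q - DIM('a) / 2) / Gamma q * a powr (DIM('a) / 2 - q))"
proof -
  let ?m = "real DIM('a) / 2"
  have q0: "q > 0" using q by (meson divide_nonneg_nonneg le_less_trans of_nat_0_le_iff zero_le_numeral)
  have G: "Gamma q > 0" using q0 by (rule Gamma_real_pos)
  have "ennreal (Gamma q) * (\<integral>\<^sup>+x. ennreal ((a + (norm (x::'a))\<^sup>2) powr (- q)) \<partial>lborel)
      = (\<integral>\<^sup>+x. ennreal (Gamma q * (a + (norm (x::'a))\<^sup>2) powr (- q)) \<partial>lborel)"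
    using G by (subst nn_integral_cmult[symmetric]) (auto simp: ennreal_mult)
  also have "\<dots> = (\<integral>\<^sup>+x. (\<integral>\<^sup>+t. ennreal (t powr (q - 1) * exp (- (a + (norm (x::'a))\<^sup>2) * t)) * indicator {0..} t \<partial>lborel) \<partial>lborel)"
    using a q0 by (intro nn_integral_cong nn_integral_Gamma_scaled[symmetric]) (auto intro: add_pos_nonneg)
  also have "\<dots> = (\<integral>\<^sup>+t. (\<integral>\<^sup>+x. ennreal (t powr (q - 1) * exp (- (a + (norm (x::'a))\<^sup>2) * t)) * indicator {0..} t \<partial>lborel) \<partial>lborel)"
    by (rule lborel_pair.Fubini') measurable
  also have "\<dots> = (\<integral>\<^sup>+t. ennreal (pi powr ?m) * (ennreal (t powr (q - ?m - 1) * exp (- a * t)) * indicator {0..} t) \<partial>lborel)"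
  proof (rule nn_integral_cong_AE, rule AE_mp[OF AE_lborel_singleton[of 0]], rule AE_I2, rule impI)
    fix t :: real assume t0: "t \<noteq> 0"
    show "(\<integral>\<^sup>+x. ennreal (t powr (q - 1) * exp (- (a + (norm (x::'a))\<^sup>2) * t)) * indicator {0..} t \<partial>lborel)
      = ennreal (pi powr ?m) * (ennreal (t powr (q - ?m - 1) * exp (- a * t)) * indicator {0..} t)"
    proof (cases "t > 0")
      case True
      have "(\<integral>\<^sup>+x. ennreal (t powr (q - 1) * exp (- (a + (norm (x::'a))\<^sup>2) * t)) * indicator {0..} t \<partial>lborel)
        = (\<integral>\<^sup>+x. ennreal (t powr (q - 1) * exp (- a * t)) * ennreal (exp (- t * (norm (x::'a))\<^sup>2)) \<partial>lborel)"
      proof (rule nn_integral_cong)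
        fix x :: 'a
        have "exp (- (a + (norm x)\<^sup>2) * t) = exp (- a * t) * exp (- t * (norm x)\<^sup>2)"
          by (simp add: mult_exp_exp ring_distribs mult.commute)
        then show "ennreal (t powr (q - 1) * exp (- (a + (norm x)\<^sup>2) * t)) * indicator {0..} t
            = ennreal (t powr (q - 1) * exp (- a * t)) * ennreal (exp (- t * (norm x)\<^sup>2))"
          using True by (simp add: ennreal_mult mult.assoc)
      qed
      also have "\<dots> = ennreal (t powr (q - 1) * exp (- a * t)) * ennreal ((pi / t) powr ?m)"
        using True by (subst nn_integral_cmult) (simp_all only: nn_integral_gaussian, measurable)
      also have "\<dots> = ennreal (pi powr ?m * (t powr (q - ?m - 1) * exp (- a * t)))"
        using True by (simp add: ennreal_mult[symmetric] powr_divide powr_diff mult_ac)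
      finally show ?thesis using True by (simp add: ennreal_mult)
    qed (use t0 in simp)
  qed
  also have "\<dots> = ennreal (pi powr ?m) * ennreal (Gamma (q - ?m) * a powr (- (q - ?m)))"
    using a q by (subst nn_integral_cmult) (simp_all only: nn_integral_Gamma_scaled diff_gt_0_iff_gt, measurable)
  also have "\<dots> = ennreal (pi powr ?m * Gamma (q - ?m) * a powr (?m - q))"
    using a q by (simp add: ennreal_mult[symmetric] Gamma_real_pos less_imp_le mult.assoc)
  finally show ?thesis
    using ennreal_mult_left_eqD G by (metis (no_types, lifting) times_divide_eq_left)
qed

text \<open>By isotropy of the Gaussian the direction \<open>e\<close> can be rotated to a basis
  vector \<open>b\<close>; then the integrand is a product over coordinates, with the power attached
  to the coordinate \<open>b\<close> only.\<close>

lemma nn_integral_gaussian_moment: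
  fixes e :: "'a::euclidean_space"
  assumes e: "norm e = 1" and q: "q > -1"
  shows "(\<integral>\<^sup>+x. ennreal (max 0 (e \<bullet> x) powr q * exp (- (norm x)\<^sup>2)) \<partial>lborel)
    = ennreal (pi powr ((DIM('a) - 1) / 2) * Gamma ((q + 1) / 2) / 2)"
proof -
  obtain b :: 'a where b: "b \<in> Basis" using nonempty_Basis by blast
  define w where "w = e - b"
  \<comment> \<open>The reflection that exchanges the unit vectors \<open>e\<close> and
    \<open>b\<close>; if \<open>e = b\<close> then \<open>w = 0\<close> and it is the
    identity.\<close>
  define U where "U x = x - (2 * (x \<bullet> w) / (w \<bullet> w)) *\<^sub>R w" for x
  have lin: "linear U"
    unfolding U_def by (rule linearI) (auto simp: algebra_simps add_divide_distrib)
  have nU: "norm (U x) = norm x" for x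
  proof (cases "w = 0")
    case False
    then have "U x \<bullet> U x = x \<bullet> x"
      unfolding U_def by (simp add: inner_diff inner_commute field_simps)
    then show ?thesis by (simp add: norm_eq)
  qed (simp add: U_def)
  have eU: "e \<bullet> U x = b \<bullet> x" for x
  proof (cases "w = 0")
    case True
    then show ?thesis by (simp add: U_def w_def)
  next
    case False
    have ww: "w \<bullet> w = 2 * (e \<bullet> w)"
      using e b by (simp add: w_def inner_diff inner_commute norm_eq_1)
    then have "e \<bullet> w \<noteq> 0" using False by auto
    then show ?thesis
      unfolding U_def by (simp add: inner_diff ww) (simp add: w_def inner_diff inner_commute)
  qed
  have m[measurable]: "(\<lambda>x. ennreal (max 0 (e \<bullet> x) powr q * exp (- (norm x)\<^sup>2))) \<in> borel_measurable borel"
    by measurable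
  define F where "F c t = (if c = b then ennreal (max 0 t powr q * exp (- t\<^sup>2)) else ennreal (exp (- 1 * t\<^sup>2)))" for c :: 'a and t
  have [measurable]: "F c \<in> borel_measurable borel" for c
    unfolding F_def by (cases "c = b") simp_all
  have "(\<integral>\<^sup>+x. ennreal (max 0 (e \<bullet> x) powr q * exp (- (norm x)\<^sup>2)) \<partial>lborel)
      = (\<integral>\<^sup>+x. ennreal (max 0 (e \<bullet> U x) powr q * exp (- (norm (U x))\<^sup>2)) \<partial>lborel)"
    by (rule nn_integral_lborel_isometry[OF m lin nU, symmetric])
  also have "\<dots> = (\<integral>\<^sup>+x. (\<Prod>c\<in>Basis. F c (x \<bullet> c)) \<partial>lborel)"
  proof (rule nn_integral_cong)
    fix x :: 'a
    have "(\<Prod>c\<in>Basis. F c (x \<bullet> c)) = F b (x \<bullet> b) * (\<Prod>c\<in>Basis-{b}. F c (x \<bullet> c))"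
      using b by (rule prod.remove[OF finite_Basis])
    also have "(\<Prod>c\<in>Basis-{b}. F c (x \<bullet> c)) = ennreal (\<Prod>c\<in>Basis-{b}. exp (- 1 * (x \<bullet> c)\<^sup>2))"
      unfolding F_def by (subst prod_ennreal[symmetric]) (auto intro!: prod.cong)
    also have "F b (x \<bullet> b) * \<dots> = ennreal (max 0 (b \<bullet> x) powr q * (exp (- 1 * (x \<bullet> b)\<^sup>2) * (\<Prod>c\<in>Basis-{b}. exp (- 1 * (x \<bullet> c)\<^sup>2))))"
      unfolding F_def by (simp add: ennreal_mult[symmetric] prod_nonneg inner_commute mult.assoc)
    also have "exp (- 1 * (x \<bullet> b)\<^sup>2) * (\<Prod>c\<in>Basis-{b}. exp (- 1 * (x \<bullet> c)\<^sup>2)) = exp (- 1 * (norm x)\<^sup>2)"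
      unfolding exp_norm_square_prod using b by (rule prod.remove[OF finite_Basis, symmetric])
    finally show "ennreal (max 0 (e \<bullet> U x) powr q * exp (- (norm (U x))\<^sup>2)) = (\<Prod>c\<in>Basis. F c (x \<bullet> c))"
      by (simp add: eU nU)
  qed
  also have "\<dots> = (\<Prod>c\<in>Basis. \<integral>\<^sup>+t. F c t \<partial>lborel)"
    by (intro nn_integral_lborel_prod) auto
  also have "\<dots> = (\<integral>\<^sup>+t. F b t \<partial>lborel) * (\<Prod>c\<in>Basis-{b}. \<integral>\<^sup>+t. F c t \<partial>lborel)"
    using b by (rule prod.remove[OF finite_Basis])
  also have "(\<Prod>c\<in>Basis-{b}. \<integral>\<^sup>+t. F c t \<partial>lborel) = (\<Prod>c\<in>Basis-{b}. ennreal (sqrt pi))"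
  proof (rule prod.cong)
    fix c assume "c \<in> Basis - {b}"
    then have "(\<integral>\<^sup>+t. F c t \<partial>lborel) = (\<integral>\<^sup>+t. ennreal (exp (- 1 * t\<^sup>2)) \<partial>lborel)"
      by (simp add: F_def)
    also have "\<dots> = ennreal (sqrt pi)"
      using nn_integral_gaussian_real[of 1] by simp
    finally show "(\<integral>\<^sup>+t. F c t \<partial>lborel) = ennreal (sqrt pi)" .
  qed simp
  also have "\<dots> = ennreal (pi powr ((DIM('a) - 1) / 2))"
    using b by (simp add: ennreal_power powr_half_sqrt[symmetric] powr_powr flip: powr_realpow)
  also have "(\<integral>\<^sup>+t. F b t \<partial>lborel) = (\<integral>\<^sup>+t. ennreal (t powr ((q + 1) - 1) * exp (- 1 * t\<^sup>2)) * indicator {0..} t \<partial>lborel)"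
    by (intro nn_integral_cong) (auto simp: F_def indicator_def max_def)
  also have "\<dots> = ennreal (Gamma ((q + 1) / 2) / 2)"
    using q by (subst nn_integral_Gamma_square) auto
  finally show ?thesis
    using q by (simp add: ennreal_mult[symmetric] Gamma_real_pos less_imp_le mult.commute)
qed

lemma nn_integral_periodic:
  fixes f :: "real \<Rightarrow> ennreal"
  assumes [measurable]: "f \<in> borel_measurable borel"
    and per: "\<And>x. f (T + x) = f x" and a: "0 \<le> a" "a \<le> T"
  shows "(\<integral>\<^sup>+x. f (a + x) * indicator {0..<T} x \<partial>lborel) = (\<integral>\<^sup>+x. f x * indicator {0..<T} x \<partial>lborel)"
proof -
  have "(\<integral>\<^sup>+x. f (a + x) * indicator {0..<T} x \<partial>lborel)
      = (\<integral>\<^sup>+x. f (a + x) * indicator {a..<a+T} (a + x) \<partial>lborel)"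
    by (intro nn_integral_cong) (auto simp: indicator_def)
  also have "\<dots> = (\<integral>\<^sup>+x. f x * indicator {a..<a+T} x \<partial>lborel)"
    by (rule nn_integral_lborel_translate[of "\<lambda>x. f x * indicator {a..<a+T} x"]) simp
  also have "\<dots> = (\<integral>\<^sup>+x. f x * indicator {a..<T} x + f x * indicator {T..<T+a} x \<partial>lborel)"
    using a by (intro nn_integral_cong) (auto simp: indicator_def)
  also have "\<dots> = (\<integral>\<^sup>+x. f x * indicator {a..<T} x \<partial>lborel) + (\<integral>\<^sup>+x. f x * indicator {T..<T+a} x \<partial>lborel)"
    by (rule nn_integral_add) auto
  also have "(\<integral>\<^sup>+x. f x * indicator {T..<T+a} x \<partial>lborel) = (\<integral>\<^sup>+x. f (T + x) * indicator {T..<T+a} (T + x) \<partial>lborel)"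
    by (rule nn_integral_lborel_translate[of "\<lambda>x. f x * indicator {T..<T+a} x", symmetric]) simp
  also have "\<dots> = (\<integral>\<^sup>+x. f x * indicator {0..<a} x \<partial>lborel)"
    by (intro nn_integral_cong) (auto simp: indicator_def per)
  also have "(\<integral>\<^sup>+x. f x * indicator {a..<T} x \<partial>lborel) + (\<integral>\<^sup>+x. f x * indicator {0..<a} x \<partial>lborel)
      = (\<integral>\<^sup>+x. f x * indicator {a..<T} x + f x * indicator {0..<a} x \<partial>lborel)"
    by (rule nn_integral_add[symmetric]) auto
  also have "\<dots> = (\<integral>\<^sup>+x. f x * indicator {0..<T} x \<partial>lborel)"
    using a by (intro nn_integral_cong) (auto simp: indicator_def)
  finally show ?thesis .
qed

section \<open>Invariances of Lebesgue measure on the Heisenberg group\<close>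

abbreviation heis_z :: "'n heis \<Rightarrow> real" where "heis_z p \<equiv> snd (snd p)"

definition heis_horiz :: "'n::finite heis \<Rightarrow> (real^'n) \<times> (real^'n)"
  where "heis_horiz p = (fst p, fst (snd p))"

lemma heis_horiz_simp [simp]: "heis_horiz (x, y, z) = (x, y)"
  by (simp add: heis_horiz_def)

lemma continuous_on_heis_horiz [continuous_intros]: "continuous_on S heis_horiz"
  unfolding heis_horiz_def by (intro continuous_intros)

lemma measurable_heis_horiz [measurable]: "heis_horiz \<in> borel_measurable borel"
  by (intro borel_measurable_continuous_onI continuous_intros)

lemma measurable_heis_fibre [measurable (raw)]:
  fixes f :: "'n::finite heis \<Rightarrow> ennreal"
  assumes f: "f \<in> borel_measurable borel"
  shows "(\<lambda>\<zeta>. \<integral>\<^sup>+z. f (fst \<zeta>, snd \<zeta>, z) \<partial>lborel) \<in> borel_measurable borel"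
proof -
  have "(\<lambda>p. (fst (fst p), snd (fst p), snd p) :: 'n heis) \<in> borel_measurable borel"
    by (intro borel_measurable_continuous_onI continuous_intros)
  then have "(\<lambda>p. f (fst (fst p), snd (fst p), snd p)) \<in> borel_measurable borel"
    using f by (rule measurable_compose)
  then have "(\<lambda>(\<zeta>, z). f (fst \<zeta>, snd \<zeta>, z)) \<in> borel_measurable (borel \<Otimes>\<^sub>M lborel)"
    by (simp add: split_beta borel_prod[symmetric] cong: measurable_cong_sets sets_pair_measure_cong)
  then show ?thesis
    by (rule lborel.borel_measurable_nn_integral)
qed

text \<open>The type nests coordinates as x, (y, z). Regrouping them as (x, y), z makes the
  horizontal plane one Euclidean space and isolates the centre, which scales and shifts
  differently.\<close>

lemma nn_integral_heis:
  fixes f :: "'n::finite heis \<Rightarrow> ennreal"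
  assumes [measurable]: "f \<in> borel_measurable borel"
  shows "(\<integral>\<^sup>+p. f p \<partial>lborel) = (\<integral>\<^sup>+\<zeta>. (\<integral>\<^sup>+z. f (fst \<zeta>, snd \<zeta>, z) \<partial>lborel) \<partial>lborel)"
proof -
  have "(\<integral>\<^sup>+\<zeta>. (\<integral>\<^sup>+z. f (fst \<zeta>, snd \<zeta>, z) \<partial>lborel) \<partial>lborel)
      = (\<integral>\<^sup>+\<zeta>. (\<integral>\<^sup>+z. f (fst \<zeta>, snd \<zeta>, z) \<partial>lborel) \<partial>(lborel \<Otimes>\<^sub>M lborel))"
    by (simp add: lborel_prod)
  also have "\<dots> = (\<integral>\<^sup>+x. (\<integral>\<^sup>+y. (\<integral>\<^sup>+z. f (x, y, z) \<partial>lborel) \<partial>lborel) \<partial>lborel)"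
    by (subst lborel.nn_integral_fst[symmetric]) (simp_all add: borel_prod lborel.borel_measurable_nn_integral)
  also have "\<dots> = (\<integral>\<^sup>+x. (\<integral>\<^sup>+v. f (x, v) \<partial>lborel) \<partial>lborel)"
  proof (rule nn_integral_cong)
    fix x :: "real^'n"
    have "(\<integral>\<^sup>+y. (\<integral>\<^sup>+z. f (x, y, z) \<partial>lborel) \<partial>lborel) = (\<integral>\<^sup>+v. f (x, v) \<partial>(lborel \<Otimes>\<^sub>M lborel))"
      by (rule lborel.nn_integral_fst) (simp add: lborel_prod)
    then show "(\<integral>\<^sup>+y. (\<integral>\<^sup>+z. f (x, y, z) \<partial>lborel) \<partial>lborel) = (\<integral>\<^sup>+v. f (x, v) \<partial>lborel)"
      by (simp add: lborel_prod)
  qed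
  also have "\<dots> = (\<integral>\<^sup>+p. f p \<partial>(lborel \<Otimes>\<^sub>M lborel))"
    by (rule lborel.nn_integral_fst) (simp add: lborel_prod)
  finally show ?thesis by (simp add: lborel_prod)
qed

text \<open>\<open>heis_diff \<xi> \<eta> = \<xi>\<inverse> \<eta>\<close> for the group law
  \<open>(x, y, z) (x', y', z') = (x + x', y + y', z + z' + 2 (y \<bullet> x' - x \<bullet> y'))\<close>,
  under which the fields \<open>X_field\<close> and \<open>Y_field\<close> are left invariant;
  \<open>heis_shift \<eta> q = \<eta> q\<inverse>\<close>.\<close>

definition heis_diff :: "'n::finite heis \<Rightarrow> 'n heis \<Rightarrow> 'n heis" where
  "heis_diff p q = (fst q - fst p, fst (snd q) - fst (snd p),
     heis_z q - heis_z p + 2 * (fst p \<bullet> fst (snd q) - fst (snd p) \<bullet> fst q))"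

definition heis_shift :: "'n::finite heis \<Rightarrow> 'n heis \<Rightarrow> 'n heis" where
  "heis_shift p q = (fst p - fst q, fst (snd p) - fst (snd q),
     heis_z p - heis_z q - 2 * (fst (snd p) \<bullet> fst q - fst p \<bullet> fst (snd q)))"

lemma continuous_on_heis_diff [continuous_intros]:
  "continuous_on S f \<Longrightarrow> continuous_on S g \<Longrightarrow> continuous_on S (\<lambda>x. heis_diff (f x) (g x))"
  unfolding heis_diff_def by (intro continuous_intros)

lemma continuous_on_heis_shift [continuous_intros]:
  "continuous_on S f \<Longrightarrow> continuous_on S g \<Longrightarrow> continuous_on S (\<lambda>x. heis_shift (f x) (g x))"
  unfolding heis_shift_def by (intro continuous_intros)

lemma heis_shift_diff [simp]: "heis_shift q (heis_diff p q) = p"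
  by (cases p, cases q) (simp add: heis_shift_def heis_diff_def inner_diff inner_commute)

text \<open>Lebesgue measure is a Haar measure of the group and is invariant under inversion: for
  fixed horizontal part the central coordinate is only reflected and shifted, by an amount that
  depends on the horizontal part, and then the horizontal part itself is reflected and
  translated.\<close>

lemma nn_integral_heis_diff:
  fixes f :: "'n::finite heis \<Rightarrow> ennreal"
  assumes [measurable]: "f \<in> borel_measurable borel"
  shows "(\<integral>\<^sup>+p. f (heis_diff p q) \<partial>lborel) = (\<integral>\<^sup>+p. f p \<partial>lborel)"
proof -
  have [measurable]: "(\<lambda>p. heis_diff p q) \<in> borel_measurable borel"
    by (intro borel_measurable_continuous_onI continuous_intros)
  define w where "w = heis_horiz q"
  define g where "g \<zeta> = (\<integral>\<^sup>+z. f (fst \<zeta>, snd \<zeta>, z) \<partial>lborel)" for \<zeta>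
  have [measurable]: "g \<in> borel_measurable borel"
    unfolding g_def by (rule measurable_heis_fibre) simp
  have "(\<integral>\<^sup>+p. f (heis_diff p q) \<partial>lborel)
      = (\<integral>\<^sup>+\<zeta>. (\<integral>\<^sup>+z. f (heis_diff (fst \<zeta>, snd \<zeta>, z) q) \<partial>lborel) \<partial>lborel)"
    by (rule nn_integral_heis) simp
  also have "\<dots> = (\<integral>\<^sup>+\<zeta>. g (w + - \<zeta>) \<partial>lborel)"
  proof (rule nn_integral_cong)
    fix \<zeta> :: "(real^'n) \<times> (real^'n)"
    define c where "c = heis_z q + 2 * (fst \<zeta> \<bullet> fst (snd q) - snd \<zeta> \<bullet> fst q)"
    define h where "h z = f (fst (w - \<zeta>), snd (w - \<zeta>), z)" for z
    have [measurable]: "h \<in> borel_measurable borel" unfolding h_def by simp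
    have "(\<integral>\<^sup>+z. f (heis_diff (fst \<zeta>, snd \<zeta>, z) q) \<partial>lborel) = (\<integral>\<^sup>+z. h (c + - z) \<partial>lborel)"
      by (intro nn_integral_cong) (simp add: h_def c_def w_def heis_diff_def heis_horiz_def algebra_simps)
    also have "\<dots> = (\<integral>\<^sup>+z. h (c + z) \<partial>lborel)"
      by (rule nn_integral_lborel_uminus[of "\<lambda>z. h (c + z)"]) simp
    also have "\<dots> = (\<integral>\<^sup>+z. h z \<partial>lborel)"
      by (rule nn_integral_lborel_translate) simp
    finally show "(\<integral>\<^sup>+z. f (heis_diff (fst \<zeta>, snd \<zeta>, z) q) \<partial>lborel) = g (w + - \<zeta>)"
      by (simp add: g_def h_def)
  qed
  also have "\<dots> = (\<integral>\<^sup>+\<zeta>. g (w + \<zeta>) \<partial>lborel)"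
    by (rule nn_integral_lborel_uminus[of "\<lambda>z. g (w + z)"]) simp
  also have "\<dots> = (\<integral>\<^sup>+\<zeta>. g \<zeta> \<partial>lborel)"
    by (rule nn_integral_lborel_translate) simp
  also have "\<dots> = (\<integral>\<^sup>+p. f p \<partial>lborel)"
    unfolding g_def by (rule nn_integral_heis[symmetric]) simp
  finally show ?thesis .
qed

lemma distr_heis_diff: "distr lborel borel (\<lambda>p. heis_diff p q) = lborel"
proof (rule measure_eqI)
  fix A assume "A \<in> sets (distr lborel borel (\<lambda>p. heis_diff p q))"
  then have A[measurable]: "A \<in> sets borel" by simp
  have m[measurable]: "(\<lambda>p. heis_diff p q) \<in> borel_measurable borel"
    by (intro borel_measurable_continuous_onI continuous_intros)
  have "emeasure (distr lborel borel (\<lambda>p. heis_diff p q)) A = (\<integral>\<^sup>+p. indicator A p \<partial>distr lborel borel (\<lambda>p. heis_diff p q))"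
    by simp
  also have "\<dots> = (\<integral>\<^sup>+p. indicator A (heis_diff p q) \<partial>lborel)"
    by (rule nn_integral_distr) auto
  also have "\<dots> = emeasure lborel A"
    by (subst nn_integral_heis_diff) auto
  finally show "emeasure (distr lborel borel (\<lambda>p. heis_diff p q)) A = emeasure lborel A" .
qed simp

lemma integral_heis_diff:
  fixes f :: "'n::finite heis \<Rightarrow> real"
  assumes "f \<in> borel_measurable borel"
  shows "integrable lborel (\<lambda>p. f (heis_diff p q)) \<longleftrightarrow> integrable lborel f"
    and "(\<integral>p. f (heis_diff p q) \<partial>lborel) = (\<integral>p. f p \<partial>lborel)"
proof -
  have m: "(\<lambda>p. heis_diff p q) \<in> measurable lborel borel"
    by (simp, intro borel_measurable_continuous_onI continuous_intros)
  show "integrable lborel (\<lambda>p. f (heis_diff p q)) \<longleftrightarrow> integrable lborel f"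
    using integrable_distr_eq[OF m assms] by (simp add: distr_heis_diff)
  show "(\<integral>p. f (heis_diff p q) \<partial>lborel) = (\<integral>p. f p \<partial>lborel)"
    using integral_distr[OF m assms] by (simp add: distr_heis_diff)
qed

section \<open>Anisotropic dilations\<close>

definition heis_dil :: "real \<Rightarrow> 'n::finite heis \<Rightarrow> 'n heis" where
  "heis_dil r p = (r *\<^sub>R fst p, r *\<^sub>R fst (snd p), r\<^sup>2 * heis_z p)"

lemma continuous_on_heis_dil [continuous_intros]:
  "continuous_on S f \<Longrightarrow> continuous_on S g \<Longrightarrow> continuous_on S (\<lambda>x. heis_dil (f x) (g x))"
  unfolding heis_dil_def by (intro continuous_intros)

lemma measurable_heis_dil [measurable (raw)]:
  assumes "f \<in> borel_measurable M" "g \<in> borel_measurable M"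
  shows "(\<lambda>x. heis_dil (f x) (g x)) \<in> borel_measurable M"
  by (rule borel_measurable_continuous_Pair[OF assms]) (intro continuous_intros)

text \<open>The plane contributes r^(2n) to the Jacobian and the centre r^2, which together give the
  homogeneous dimension.\<close>

lemma nn_integral_heis_dil:
  fixes f :: "'n::finite heis \<Rightarrow> ennreal"
  assumes [measurable]: "f \<in> borel_measurable borel" and r: "r > 0"
  shows "(\<integral>\<^sup>+p. f p \<partial>lborel) = ennreal (r ^ (2 * CARD('n) + 2)) * (\<integral>\<^sup>+p. f (heis_dil r p) \<partial>lborel)"
proof -
  define g where "g \<zeta> = (\<integral>\<^sup>+z. f (fst \<zeta>, snd \<zeta>, z) \<partial>lborel)" for \<zeta>
  have [measurable]: "g \<in> borel_measurable borel"
    unfolding g_def by (rule measurable_heis_fibre) simp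
  have "(\<integral>\<^sup>+p. f p \<partial>lborel) = (\<integral>\<^sup>+\<zeta>. g \<zeta> \<partial>lborel)"
    unfolding g_def by (rule nn_integral_heis) simp
  also have "\<dots> = ennreal (r ^ (2 * CARD('n))) * (\<integral>\<^sup>+\<zeta>. g (r *\<^sub>R \<zeta>) \<partial>lborel)"
    using r by (subst nn_integral_lborel_scaleR[where c=r]) (auto simp: mult_2)
  also have "(\<integral>\<^sup>+\<zeta>. g (r *\<^sub>R \<zeta>) \<partial>lborel)
     = (\<integral>\<^sup>+\<zeta>. ennreal (r\<^sup>2) * (\<integral>\<^sup>+z. f (heis_dil r (fst \<zeta>, snd \<zeta>, z)) \<partial>lborel) \<partial>lborel)"
  proof (rule nn_integral_cong)
    fix \<zeta> :: "(real^'n) \<times> (real^'n)"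
    show "g (r *\<^sub>R \<zeta>) = ennreal (r\<^sup>2) * (\<integral>\<^sup>+z. f (heis_dil r (fst \<zeta>, snd \<zeta>, z)) \<partial>lborel)"
      unfolding g_def using r
      by (subst nn_integral_real_affine[where c="r\<^sup>2" and t=0]) (auto simp: heis_dil_def)
  qed
  also have "\<dots> = ennreal (r\<^sup>2) * (\<integral>\<^sup>+\<zeta>. (\<integral>\<^sup>+z. f (heis_dil r (fst \<zeta>, snd \<zeta>, z)) \<partial>lborel) \<partial>lborel)"
    by (rule nn_integral_cmult) (simp add: lborel.borel_measurable_nn_integral)
  also have "(\<integral>\<^sup>+\<zeta>. (\<integral>\<^sup>+z. f (heis_dil r (fst \<zeta>, snd \<zeta>, z)) \<partial>lborel) \<partial>lborel) = (\<integral>\<^sup>+p. f (heis_dil r p) \<partial>lborel)"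
    by (rule nn_integral_heis[symmetric]) simp
  finally show ?thesis
    using r by (simp add: mult.assoc[symmetric] ennreal_mult[symmetric] power_add[symmetric])
qed

text \<open>Averaging over dilations with respect to the invariant measure \<open>dr / r\<close> replaces polar
  coordinates.\<close>

lemma nn_integral_dilation_average:
  fixes F G :: "'n::finite heis \<Rightarrow> ennreal"
  assumes [measurable]: "F \<in> borel_measurable borel" "G \<in> borel_measurable borel"
  shows "(\<integral>\<^sup>+p. F p * (\<integral>\<^sup>+r. G (heis_dil r p) * ennreal (1 / r) * indicator {0<..} r \<partial>lborel) \<partial>lborel)
    = (\<integral>\<^sup>+p. G p * (\<integral>\<^sup>+r. F (heis_dil (1 / r) p) * ennreal (r powr (- (hom_dim CARD('n)) - 1))
         * indicator {0<..} r \<partial>lborel) \<partial>lborel)"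
proof -
  have "(\<integral>\<^sup>+p. F p * (\<integral>\<^sup>+r. G (heis_dil r p) * ennreal (1 / r) * indicator {0<..} r \<partial>lborel) \<partial>lborel)
     = (\<integral>\<^sup>+p. (\<integral>\<^sup>+r. F p * (G (heis_dil r p) * ennreal (1 / r) * indicator {0<..} r) \<partial>lborel) \<partial>lborel)"
    by (intro nn_integral_cong nn_integral_cmult[symmetric]) simp
  also have "\<dots> = (\<integral>\<^sup>+r. (\<integral>\<^sup>+p. F p * (G (heis_dil r p) * ennreal (1 / r) * indicator {0<..} r) \<partial>lborel) \<partial>lborel)"
    by (rule lborel_pair.Fubini') simp
  also have "\<dots> = (\<integral>\<^sup>+r. (\<integral>\<^sup>+p. G p * (F (heis_dil (1 / r) p) * ennreal (r powr (- (hom_dim CARD('n)) - 1))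
         * indicator {0<..} r) \<partial>lborel) \<partial>lborel)"
  proof (rule nn_integral_cong)
    fix r :: real
    show "(\<integral>\<^sup>+p. F p * (G (heis_dil r p) * ennreal (1 / r) * indicator {0<..} r) \<partial>lborel)
      = (\<integral>\<^sup>+p. G p * (F (heis_dil (1 / r) p) * ennreal (r powr (- (hom_dim CARD('n)) - 1)) * indicator {0<..} r) \<partial>lborel)"
    proof (cases "r > 0")
      case True
      \<comment> \<open>Jacobian of the dilation by 1/r times the density of dr / r.\<close>
      have pw: "(1 / r) ^ (2 * CARD('n) + 2) * (1 / r) = r powr (- (hom_dim CARD('n)) - 1)"
      proof -
        have "r powr hom_dim CARD('n) = r ^ (2 * CARD('n) + 2)"
          using True powr_realpow[of r "2 * CARD('n) + 2"] by (simp add: hom_dim_def add.commute)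
        then show ?thesis
          using True by (simp add: powr_diff powr_minus divide_inverse power_inverse)
      qed
      have dd: "heis_dil r (heis_dil (1 / r) p) = p" for p :: "'n heis"
        using True by (cases p) (simp add: heis_dil_def power_divide)
      have "(\<integral>\<^sup>+p. F p * (G (heis_dil r p) * ennreal (1 / r) * indicator {0<..} r) \<partial>lborel)
        = ennreal ((1 / r) ^ (2 * CARD('n) + 2)) * (\<integral>\<^sup>+p. F (heis_dil (1 / r) p) * (G p * ennreal (1 / r)) \<partial>lborel)"
        using True by (subst nn_integral_heis_dil[where r="1 / r"]) (auto simp: dd)
      also have "\<dots> = (\<integral>\<^sup>+p. ennreal ((1 / r) ^ (2 * CARD('n) + 2)) * (F (heis_dil (1 / r) p) * (G p * ennreal (1 / r))) \<partial>lborel)"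
        by (rule nn_integral_cmult[symmetric]) simp
      also have "\<dots> = (\<integral>\<^sup>+p. G p * (F (heis_dil (1 / r) p) * ennreal (r powr (- (hom_dim CARD('n)) - 1)) * indicator {0<..} r) \<partial>lborel)"
      proof (rule nn_integral_cong)
        fix p
        have "ennreal ((1 / r) ^ (2 * CARD('n) + 2)) * (F (heis_dil (1 / r) p) * (G p * ennreal (1 / r)))
          = G p * (F (heis_dil (1 / r) p) * (ennreal ((1 / r) ^ (2 * CARD('n) + 2)) * ennreal (1 / r)))"
          by (simp only: mult_ac)
        also have "ennreal ((1 / r) ^ (2 * CARD('n) + 2)) * ennreal (1 / r) = ennreal (r powr (- (hom_dim CARD('n)) - 1))"
          using True by (subst ennreal_mult[symmetric]) (simp_all only: pw, simp_all)
        finally show "ennreal ((1 / r) ^ (2 * CARD('n) + 2)) * (F (heis_dil (1 / r) p) * (G p * ennreal (1 / r)))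
          = G p * (F (heis_dil (1 / r) p) * ennreal (r powr (- (hom_dim CARD('n)) - 1)) * indicator {0<..} r)"
          using True by simp
      qed
      finally show ?thesis .
    qed simp
  qed
  also have "\<dots> = (\<integral>\<^sup>+p. (\<integral>\<^sup>+r. G p * (F (heis_dil (1 / r) p) * ennreal (r powr (- (hom_dim CARD('n)) - 1))
         * indicator {0<..} r) \<partial>lborel) \<partial>lborel)"
    by (rule lborel_pair.Fubini') simp
  also have "\<dots> = (\<integral>\<^sup>+p. G p * (\<integral>\<^sup>+r. F (heis_dil (1 / r) p) * ennreal (r powr (- (hom_dim CARD('n)) - 1))
         * indicator {0<..} r \<partial>lborel) \<partial>lborel)"
    by (intro nn_integral_cong nn_integral_cmult) simp
  finally show ?thesis .
qed

section \<open>Rotations of the horizontal plane, in complex notation x + i y multiplied by exp(- i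
  t)\<close>

definition heis_rot :: "real \<Rightarrow> 'n::finite heis \<Rightarrow> 'n heis" where
  "heis_rot t p = (cos t *\<^sub>R fst p + sin t *\<^sub>R fst (snd p), cos t *\<^sub>R fst (snd p) - sin t *\<^sub>R fst p, heis_z p)"

lemma measurable_heis_rot [measurable (raw)]:
  assumes "f \<in> borel_measurable M" "g \<in> borel_measurable M"
  shows "(\<lambda>x. heis_rot (f x) (g x)) \<in> borel_measurable M"
  by (rule borel_measurable_continuous_Pair[OF assms]) (unfold heis_rot_def, intro continuous_intros)

lemma heis_rot_add: "heis_rot s (heis_rot t p) = heis_rot (s + t) p"
  by (cases p) (simp add: heis_rot_def cos_add sin_add algebra_simps)

lemma heis_rot_2pi: "heis_rot (2 * pi + t) p = heis_rot t p"
  by (simp add: heis_rot_def sin_add cos_add)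

lemma norm_heis_rot: "norm (heis_horiz (heis_rot t p)) = norm (heis_horiz p)"
proof -
  obtain x y z where p: "p = (x, y, z)" by (metis prod_cases3)
  have "(c *\<^sub>R x + s *\<^sub>R y) \<bullet> (c *\<^sub>R x + s *\<^sub>R y) + (c *\<^sub>R y - s *\<^sub>R x) \<bullet> (c *\<^sub>R y - s *\<^sub>R x)
      = (c\<^sup>2 + s\<^sup>2) * (x \<bullet> x + y \<bullet> y)" for c s :: real
    by (simp add: inner_add_left inner_add_right inner_diff inner_commute)
       (simp add: power2_eq_square algebra_simps)
  from this[of "cos t" "sin t"]
  have "(norm (heis_horiz (heis_rot t p)))\<^sup>2 = (norm (heis_horiz p))\<^sup>2"
    by (simp add: p heis_rot_def power2_norm_eq_inner)
  then show ?thesis by simp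
qed

text \<open>The rotation angle may depend on the point as long as it is constant on orbits: compare
  with the average over all constant angles.\<close>

lemma nn_integral_twisted_rotation:
  fixes f :: "'n::finite heis \<Rightarrow> ennreal"
  assumes [measurable]: "f \<in> borel_measurable borel" "\<alpha> \<in> borel_measurable borel"
    and inv: "\<And>t p. \<alpha> (heis_rot t p) = \<alpha> p" and rng: "\<And>p. \<bar>\<alpha> p\<bar> \<le> 2 * pi"
  shows "(\<integral>\<^sup>+p. f (heis_rot (\<alpha> p) p) \<partial>lborel) = (\<integral>\<^sup>+p. f p \<partial>lborel)"
proof -
  have const: "(\<integral>\<^sup>+p. h (heis_rot t p) \<partial>lborel) = (\<integral>\<^sup>+p. h p \<partial>lborel)"
    if [measurable]: "h \<in> borel_measurable borel" for h :: "'n heis \<Rightarrow> ennreal" and t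
  proof (rule nn_integral_lborel_isometry)
    show "linear (heis_rot t)"
      by (rule linearI) (auto simp: heis_rot_def algebra_simps)
    show "norm (heis_rot t p) = norm p" for p :: "'n heis"
    proof -
      have "norm q = sqrt ((norm (heis_horiz q))\<^sup>2 + (heis_z q)\<^sup>2)" for q :: "'n heis"
        by (cases q) (simp add: norm_Pair)
      then show ?thesis
        by (simp only: norm_heis_rot) (simp add: heis_rot_def)
    qed
  qed simp
  let ?T = "2 * pi"
  let ?I = "\<integral>\<^sup>+p. f (heis_rot (\<alpha> p) p) \<partial>lborel"
  have T: "(\<integral>\<^sup>+t. c * indicator {0..<?T} t \<partial>lborel) = c * ennreal ?T" for c
    by (subst nn_integral_cmult) auto
  have "?I * ennreal ?T = (\<integral>\<^sup>+t. ?I * indicator {0..<?T} t \<partial>lborel)"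
    by (simp only: T)
  \<comment> \<open>Rotating the variable by \<open>t\<close> does not change
    \<open>\<alpha>\<close>, so the integral with angle \<open>\<alpha> p + t\<close> is the same
    for all \<open>t\<close>. Once the orders of integration are exchanged,
    \<open>\<alpha> p\<close> is a constant shift of \<open>t\<close> and is absorbed by
    periodicity.\<close>
  also have "\<dots> = (\<integral>\<^sup>+t. (\<integral>\<^sup>+p. f (heis_rot (\<alpha> p + t) p) * indicator {0..<?T} t \<partial>lborel) \<partial>lborel)"
  proof (rule nn_integral_cong)
    fix t :: real
    have "?I = (\<integral>\<^sup>+p. f (heis_rot (\<alpha> (heis_rot t p)) (heis_rot t p)) \<partial>lborel)"
      by (rule const[symmetric]) simp
    also have "\<dots> = (\<integral>\<^sup>+p. f (heis_rot (\<alpha> p + t) p) \<partial>lborel)"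
      by (simp add: inv heis_rot_add)
    finally show "?I * indicator {0..<?T} t = (\<integral>\<^sup>+p. f (heis_rot (\<alpha> p + t) p) * indicator {0..<?T} t \<partial>lborel)"
      by (simp add: nn_integral_multc)
  qed
  also have "\<dots> = (\<integral>\<^sup>+p. (\<integral>\<^sup>+t. f (heis_rot (\<alpha> p + t) p) * indicator {0..<?T} t \<partial>lborel) \<partial>lborel)"
    by (rule lborel_pair.Fubini') simp
  also have "\<dots> = (\<integral>\<^sup>+p. (\<integral>\<^sup>+t. f (heis_rot t p) * indicator {0..<?T} t \<partial>lborel) \<partial>lborel)"
  proof (rule nn_integral_cong)
    fix p
    define h where "h t = f (heis_rot t p)" for t
    have [measurable]: "h \<in> borel_measurable borel" unfolding h_def by simp
    have per: "h (?T + t) = h t" for t by (simp add: h_def heis_rot_2pi)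
    show "(\<integral>\<^sup>+t. f (heis_rot (\<alpha> p + t) p) * indicator {0..<?T} t \<partial>lborel)
        = (\<integral>\<^sup>+t. f (heis_rot t p) * indicator {0..<?T} t \<partial>lborel)"
    proof (cases "\<alpha> p \<ge> 0")
      case True
      then show ?thesis
        using nn_integral_periodic[of h ?T "\<alpha> p"] per rng[of p] by (simp add: h_def)
    next
      case False
      \<comment> \<open>A negative angle is raised by one period to bring the shift into
        \<open>{0..?T}\<close>.\<close>
      have "h ((?T + \<alpha> p) + t) = h (\<alpha> p + t)" for t
        using per[of "\<alpha> p + t"] by (simp add: add.assoc)
      then show ?thesis
        using False nn_integral_periodic[of h ?T "?T + \<alpha> p"] per rng[of p]
        by (simp add: h_def)
    qed
  qed
  also have "\<dots> = (\<integral>\<^sup>+t. (\<integral>\<^sup>+p. f (heis_rot t p) * indicator {0..<?T} t \<partial>lborel) \<partial>lborel)"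
    by (rule lborel_pair.Fubini') simp
  also have "\<dots> = (\<integral>\<^sup>+t. (\<integral>\<^sup>+p. f p \<partial>lborel) * indicator {0..<?T} t \<partial>lborel)"
    by (intro nn_integral_cong) (simp add: nn_integral_multc const)
  also have "\<dots> = (\<integral>\<^sup>+p. f p \<partial>lborel) * ennreal ?T"
    by (simp only: T)
  finally have "ennreal ?T * ?I = ennreal ?T * (\<integral>\<^sup>+p. f p \<partial>lborel)"
    by (simp only: mult.commute)
  then show ?thesis
    by (subst (asm) ennreal_mult_cancel_left) auto
qed

section \<open>The truncated homogeneous kernel\<close>

definition hom_kernel :: "(real^'n::finite) \<times> (real^'n) \<Rightarrow> 'n heis \<Rightarrow> real" where
  "hom_kernel e p = (e \<bullet> heis_horiz p) * (norm (heis_horiz p) ^ 4 + (heis_z p)\<^sup>2) powr (- (hom_dim CARD('n) / 4))"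

text \<open>The bracket in \<open>C'_const\<close>, a moment of order Q/(Q-1) of the homogeneous
  kernel. The superlevel set of \<open>hom_kernel e\<close> at height s has volume
  \<open>C'_base n / Q\<close> times s^(-Q/(Q-1)).\<close>

definition C'_base :: "nat \<Rightarrow> real" where
  "C'_base n = (let Q = hom_dim n in
    pi ^ n
      * (Gamma ((2 * Q - 1) / (2 * (Q - 1))) / Gamma ((2 * Q - 1) / (2 * (Q - 1)) + 1 / 2))
      * (Gamma (real n / 2 + Q / (4 * (Q - 1))) / Gamma (real n / 2 + Q / (4 * (Q - 1)) + 1 / 2))
      * (Gamma (1 + Q / (2 * (Q - 1))) / Gamma (real n + Q / (2 * (Q - 1)))))"

lemma C'_const_eq: "C'_const n = hom_dim n powr (1 / hom_dim n) * C'_base n powr ((hom_dim n - 1) / hom_dim n)"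
  by (simp add: C'_const_def C'_base_def Let_def)

lemma hom_dim_gt: "hom_dim n \<ge> 2"
  by (simp add: hom_dim_def)

text \<open>In terms of \<open>p\<close> and \<open>w\<close>, two of the six Gamma values have the
  common argument 1 + p/2 and cancel. The other four are those that the integrals below
  produce.\<close>

lemma C'_base_eq:
  assumes Q: "Q = hom_dim n" and p: "p = Q / (Q - 1)" and w: "w = real n / 2 + p / 4"
  shows "C'_base n = pi ^ n * Gamma ((p + 1) / 2) * Gamma w / (Gamma (w + 1 / 2) * Gamma (2 * w))"
proof -
  have Q2: "Q \<ge> 2" using hom_dim_gt Q by simp
  have 1: "(2 * Q - 1) / (2 * (Q - 1)) = (p + 1) / 2"
    using Q2 by (simp add: p field_simps)
  have 2: "real n / 2 + Q / (4 * (Q - 1)) = w"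
    using Q2 by (simp add: w p)
  have 3: "1 + Q / (2 * (Q - 1)) = (p + 1) / 2 + 1 / 2"
    using Q2 by (simp add: p field_simps)
  have 4: "real n + Q / (2 * (Q - 1)) = 2 * w"
    using Q2 by (simp add: w p field_simps)
  have "p > 0" using Q2 by (simp add: p)
  then have "Gamma ((p + 1) / 2 + 1 / 2) > 0" by (intro Gamma_real_pos add_pos_pos) auto
  then show ?thesis
    unfolding C'_base_def Let_def Q[symmetric] 1 2 3 4 by (simp add: field_simps)
qed

lemma C'_base_pos: "C'_base n > 0"
proof -
  define p where "p = hom_dim n / (hom_dim n - 1)"
  have "p > 0" using hom_dim_gt[of n] by (simp add: p_def)
  then show ?thesis
    unfolding C'_base_eq[OF refl p_def refl]
    by (intro divide_pos_pos mult_pos_pos Gamma_real_pos zero_less_power pi_gt_zero) auto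
qed

lemma C'_const_pos: "C'_const n > 0"
  unfolding C'_const_eq using C'_base_pos[of n] hom_dim_gt[of n] by (intro mult_pos_pos) auto

text \<open>The integral along one dilation orbit: scaling the point by 1/r multiplies the kernel
  value \<open>h\<close> by r^(Q-1), so only radii beyond the threshold \<open>r0\<close>, where
  r^(Q-1) h = s, contribute.\<close>

lemma nn_integral_truncated_power:
  assumes h: "h > 0" and s: "s > 0" and Q: "Q > (1::real)"
  shows "(\<integral>\<^sup>+r. ennreal (max 0 (r powr (Q - 1) * h - s)) * ennreal (r powr (- Q - 1)) * indicator {0<..} r \<partial>lborel)
    = ennreal ((1 - 1 / Q) * s powr (- (1 / (Q - 1))) * h powr (Q / (Q - 1)))"
proof -
  define r0 where "r0 = (s / h) powr (1 / (Q - 1))"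
  have r0: "r0 > 0" using h s by (simp add: r0_def)
  have r0Q: "r0 powr (Q - 1) = s / h"
    using h s Q by (simp add: r0_def powr_powr)
  \<comment> \<open>Antiderivative that vanishes at infinity, so that the integral from
    \<open>r0\<close> on is \<open>- F r0\<close>.\<close>
  define F where "F r = - h * r powr (-1) + s / Q * r powr (- Q)" for r
  define f where "f r = h * r powr (-2) - s * r powr (- Q - 1)" for r
  have feq: "(r powr (Q - 1) * h - s) * r powr (- Q - 1) = f r" if "r > 0" for r
    using that by (simp add: f_def algebra_simps powr_add[symmetric])
  have le: "r0 \<le> r \<longleftrightarrow> 0 \<le> r powr (Q - 1) * h - s" if "r > 0" for r
  proof -
    have "r0 \<le> r \<longleftrightarrow> r0 powr (Q - 1) \<le> r powr (Q - 1)"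
      using that r0 Q powr_mono2[of "Q - 1" r0 r] powr_less_mono2[of "Q - 1" r r0] by fastforce
    also have "\<dots> \<longleftrightarrow> 0 \<le> r powr (Q - 1) * h - s"
      using h by (simp add: r0Q field_simps)
    finally show ?thesis .
  qed
  have "(\<integral>\<^sup>+r. ennreal (max 0 (r powr (Q - 1) * h - s)) * ennreal (r powr (- Q - 1)) * indicator {0<..} r \<partial>lborel)
      = (\<integral>\<^sup>+r. ennreal (f r) * indicator {r0..} r \<partial>lborel)"
  proof (rule nn_integral_cong)
    fix r :: real
    show "ennreal (max 0 (r powr (Q - 1) * h - s)) * ennreal (r powr (- Q - 1)) * indicator {0<..} r
      = ennreal (f r) * indicator {r0..} r"
    proof (cases "r > 0")
      case True
      then show ?thesis
        using le[OF True] feq[OF True] by (auto simp: indicator_def ennreal_mult[symmetric] max_def)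
    qed (use r0 in auto)
  qed
  also have "\<dots> = ennreal (0 - F r0)"
  proof (rule nn_integral_FTC_atLeast)
    show "f \<in> borel_measurable borel" unfolding f_def by measurable
    show "DERIV F r :> f r" if "r0 \<le> r" for r
    proof -
      have "DERIV (\<lambda>r. r powr a) r :> a * r powr (a - 1)" for a
        using r0 that by (intro has_real_derivative_powr) simp
      then have "DERIV F r :> - h * (-1 * r powr (-1 - 1)) + s / Q * (- Q * r powr (- Q - 1))"
        unfolding F_def by (intro DERIV_add DERIV_cmult)
      then show ?thesis using Q by (simp add: f_def)
    qed
    show "0 \<le> f r" if "r0 \<le> r" for r
    proof -
      have "r > 0" using r0 that by simp
      then show ?thesis
        using le[of r] feq[of r] that by (metis mult_nonneg_nonneg powr_ge_zero)
    qed
    have "(F \<longlongrightarrow> - h * 0 + s / Q * 0) at_top"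
      unfolding F_def using Q by (intro tendsto_intros tendsto_neg_powr filterlim_ident) auto
    then show "(F \<longlongrightarrow> 0) at_top" by simp
  qed
  also have "0 - F r0 = (1 - 1 / Q) * s powr (- (1 / (Q - 1))) * h powr (Q / (Q - 1))"
  proof -
    have "r0 powr (- Q) = r0 powr (-1) * (r0 powr (Q - 1)) powr (-1)"
      unfolding powr_powr powr_add[symmetric] by simp
    also have "\<dots> = r0 powr (-1) * (h / s)"
      using h s by (simp add: r0Q powr_minus)
    finally have "0 - F r0 = (1 - 1 / Q) * (h * r0 powr (-1))"
      using s by (simp add: F_def algebra_simps)
    also have "r0 powr (-1) = s powr (- (1 / (Q - 1))) * h powr (1 / (Q - 1))"
    proof -
      have "r0 powr (-1) = (s / h) powr (- (1 / (Q - 1)))" unfolding r0_def powr_powr by simp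
      also have "\<dots> = s powr (- (1 / (Q - 1))) / h powr (- (1 / (Q - 1)))"
        by (rule powr_divide)
      finally show ?thesis by (simp add: powr_minus divide_inverse)
    qed
    also have "h * (s powr (- (1 / (Q - 1))) * h powr (1 / (Q - 1))) = s powr (- (1 / (Q - 1))) * h powr (Q / (Q - 1))"
    proof -
      have "Q / (Q - 1) = 1 + 1 / (Q - 1)" using Q by (simp add: field_simps)
      then show ?thesis using h by (simp add: powr_add)
    qed
    finally show ?thesis by (simp only: mult.assoc)
  qed
  finally show ?thesis .
qed

lemma measurable_heis_z [measurable]: "(\<lambda>p::'n::finite heis. heis_z p) \<in> borel_measurable borel"
  by (intro borel_measurable_continuous_onI continuous_intros)

lemma measurable_hom_kernel [measurable]: "hom_kernel e \<in> borel_measurable borel"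
  unfolding hom_kernel_def by measurable

lemma hom_kernel_dil:
  fixes p :: "'n::finite heis"
  assumes r: "r > 0"
  shows "hom_kernel e (heis_dil (1 / r) p) = r powr (hom_dim CARD('n) - 1) * hom_kernel e p"
proof -
  let ?Q = "hom_dim CARD('n)"
  have h: "heis_horiz (heis_dil (1 / r) p) = (1 / r) *\<^sub>R heis_horiz p"
    by (simp add: heis_horiz_def heis_dil_def)
  have "norm (heis_horiz (heis_dil (1 / r) p)) ^ 4 + (heis_z (heis_dil (1 / r) p))\<^sup>2
     = r powr (-4) * (norm (heis_horiz p) ^ 4 + (heis_z p)\<^sup>2)"
    using r unfolding h by (simp add: heis_dil_def powr_minus field_simps)
  then have "hom_kernel e (heis_dil (1 / r) p)
     = (1 / r * (e \<bullet> heis_horiz p)) * (r powr (-4) * (norm (heis_horiz p) ^ 4 + (heis_z p)\<^sup>2)) powr (- (?Q / 4))"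
    unfolding hom_kernel_def by (simp only: h inner_scaleR_right)
  also have "\<dots> = (r powr (-1) * (r powr (-4)) powr (- (?Q / 4))) * hom_kernel e p"
  proof -
    have "1 / r = r powr (-1)" using r by (simp add: powr_minus_divide)
    then show ?thesis unfolding hom_kernel_def by (simp only: powr_mult mult_ac)
  qed
  also have "r powr (-1) * (r powr (-4)) powr (- (?Q / 4)) = r powr (?Q - 1)"
    unfolding powr_powr powr_add[symmetric] by simp
  finally show ?thesis .
qed

text \<open>Integration over the centre yields a multiple of
  \<open>norm \<zeta> powr (- (4 * w))\<close>. The power in the weight is chosen to cancel this
  factor, which leaves a Gaussian moment of order \<open>p\<close> in 2n dimensions.\<close>

lemma nn_integral_hom_kernel_weighted:
  fixes e :: "(real^'n::finite) \<times> (real^'n)"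
  assumes e: "norm e = 1" and p: "p = hom_dim CARD('n) / (hom_dim CARD('n) - 1)"
    and w: "w = real CARD('n) / 2 + p / 4"
  shows "(\<integral>\<^sup>+u. ennreal (norm (heis_horiz u) powr (4 * w) * exp (- (norm (heis_horiz u))\<^sup>2))
      * ennreal (max 0 (hom_kernel e u) powr p) \<partial>lborel)
    = ennreal (pi ^ CARD('n) * Gamma w / Gamma (w + 1 / 2) * Gamma ((p + 1) / 2) / 2)"
proof -
  let ?Q = "hom_dim CARD('n)"
  have Q2: "?Q \<ge> 2" by (rule hom_dim_gt)
  have p0: "p > 0" using Q2 by (simp add: p)
  have w0: "w > 0" using p0 by (simp add: w add_nonneg_pos)
  \<comment> \<open>From p (Q - 1) = Q follows p Q / 4 = Q/4 + p/4 = n/2 + 1/2 + p/4.\<close>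
  have Qp: "?Q / 4 * p = w + 1 / 2"
    using Q2 by (simp add: w p hom_dim_def field_simps)
  let ?c = "sqrt pi * Gamma w / Gamma (w + 1 / 2)"
  have c: "?c \<ge> 0" using w0 by (intro divide_nonneg_nonneg mult_nonneg_nonneg) (auto intro!: less_imp_le Gamma_real_pos)
  have "(\<integral>\<^sup>+u. ennreal (norm (heis_horiz u) powr (4 * w) * exp (- (norm (heis_horiz u))\<^sup>2))
      * ennreal (max 0 (hom_kernel e u) powr p) \<partial>lborel)
    = (\<integral>\<^sup>+\<zeta>. (\<integral>\<^sup>+z. ennreal (norm \<zeta> powr (4 * w) * exp (- (norm \<zeta>)\<^sup>2))
      * ennreal (max 0 (hom_kernel e (fst \<zeta>, snd \<zeta>, z)) powr p) \<partial>lborel) \<partial>lborel)"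
    by (subst nn_integral_heis) simp_all
  also have "\<dots> = (\<integral>\<^sup>+\<zeta>. ennreal ?c * ennreal (max 0 (e \<bullet> \<zeta>) powr p * exp (- (norm \<zeta>)\<^sup>2)) \<partial>lborel)"
  proof (rule nn_integral_cong)
    fix \<zeta> :: "(real^'n) \<times> (real^'n)"
    show "(\<integral>\<^sup>+z. ennreal (norm \<zeta> powr (4 * w) * exp (- (norm \<zeta>)\<^sup>2))
      * ennreal (max 0 (hom_kernel e (fst \<zeta>, snd \<zeta>, z)) powr p) \<partial>lborel)
      = ennreal ?c * ennreal (max 0 (e \<bullet> \<zeta>) powr p * exp (- (norm \<zeta>)\<^sup>2))"
    proof (cases "e \<bullet> \<zeta> > 0")
      case True
      then have n0: "norm \<zeta> > 0" by auto
      then have a: "norm \<zeta> ^ 4 > 0" by simp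
      let ?b = "norm \<zeta> powr (4 * w) * exp (- (norm \<zeta>)\<^sup>2) * max 0 (e \<bullet> \<zeta>) powr p"
      have "(\<integral>\<^sup>+z. ennreal (norm \<zeta> powr (4 * w) * exp (- (norm \<zeta>)\<^sup>2))
          * ennreal (max 0 (hom_kernel e (fst \<zeta>, snd \<zeta>, z)) powr p) \<partial>lborel)
        = (\<integral>\<^sup>+z. ennreal ?b * ennreal ((norm \<zeta> ^ 4 + (norm (z::real))\<^sup>2) powr (- (w + 1 / 2))) \<partial>lborel)"
      proof (rule nn_integral_cong)
        fix z :: real
        have "max 0 (hom_kernel e (fst \<zeta>, snd \<zeta>, z)) powr p
           = max 0 (e \<bullet> \<zeta>) powr p * (norm \<zeta> ^ 4 + (norm z)\<^sup>2) powr (- (w + 1 / 2))"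
          using True p0 unfolding hom_kernel_def Qp[symmetric] by (simp add: powr_mult powr_powr)
        then show "ennreal (norm \<zeta> powr (4 * w) * exp (- (norm \<zeta>)\<^sup>2))
            * ennreal (max 0 (hom_kernel e (fst \<zeta>, snd \<zeta>, z)) powr p)
          = ennreal ?b * ennreal ((norm \<zeta> ^ 4 + (norm z)\<^sup>2) powr (- (w + 1 / 2)))"
          by (simp add: ennreal_mult mult.assoc)
      qed
      also have "\<dots> = ennreal ?b * (\<integral>\<^sup>+z. ennreal ((norm \<zeta> ^ 4 + (norm (z::real))\<^sup>2) powr (- (w + 1 / 2))) \<partial>lborel)"
        by (rule nn_integral_cmult) simp
      also have "(\<integral>\<^sup>+z. ennreal ((norm \<zeta> ^ 4 + (norm (z::real))\<^sup>2) powr (- (w + 1 / 2))) \<partial>lborel)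
          = ennreal (?c * (norm \<zeta> ^ 4) powr (- w))"
        using nn_integral_bessel_kernel[OF a, of "w + 1 / 2", where 'a=real] w0 by (simp add: powr_half_sqrt)
      also have "(norm \<zeta> ^ 4) powr (- w) = norm \<zeta> powr (- (4 * w))"
        using n0 by (simp add: powr_powr flip: powr_numeral)
      also have "ennreal ?b * ennreal (?c * norm \<zeta> powr (- (4 * w)))
         = ennreal (?c * (max 0 (e \<bullet> \<zeta>) powr p * exp (- (norm \<zeta>)\<^sup>2)) * (norm \<zeta> powr (4 * w) * norm \<zeta> powr (- (4 * w))))"
        using mult_nonneg_nonneg[OF c, of "norm \<zeta> powr (- (4 * w))"]
        by (subst ennreal_mult[symmetric]) (simp_all only: powr_ge_zero mult_ac, auto)
      also have "norm \<zeta> powr (4 * w) * norm \<zeta> powr (- (4 * w)) = 1"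
        using n0 by (simp add: powr_add[symmetric])
      finally show ?thesis
        by (simp only: ennreal_mult'[OF c] mult_1_right)
    next
      case False
      then have "max 0 (hom_kernel e (fst \<zeta>, snd \<zeta>, z)) = 0" for z
        by (simp add: hom_kernel_def mult_nonpos_nonneg)
      then show ?thesis using False p0 by simp
    qed
  qed
  also have "\<dots> = ennreal ?c * ennreal (pi powr (real (2 * CARD('n) - 1) / 2) * Gamma ((p + 1) / 2) / 2)"
    using nn_integral_gaussian_moment[OF e, of p] p0
    by (subst nn_integral_cmult) (auto simp: mult_2)
  also have "\<dots> = ennreal (?c * (pi powr (real (2 * CARD('n) - 1) / 2) * Gamma ((p + 1) / 2) / 2))"
    using c by (rule ennreal_mult[symmetric]) (use p0 in \<open>auto intro!: less_imp_le Gamma_real_pos\<close>)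
  also have "?c * (pi powr (real (2 * CARD('n) - 1) / 2) * Gamma ((p + 1) / 2) / 2)
     = (sqrt pi * pi powr (real (2 * CARD('n) - 1) / 2)) * Gamma w / Gamma (w + 1 / 2) * Gamma ((p + 1) / 2) / 2"
    by simp
  also have "sqrt pi * pi powr (real (2 * CARD('n) - 1) / 2) = pi powr (1 / 2 + real (2 * CARD('n) - 1) / 2)"
    by (simp only: powr_add powr_half_sqrt pi_ge_zero)
  also have "1 / 2 + real (2 * CARD('n) - 1) / 2 = real CARD('n)"
    by (simp add: of_nat_diff Suc_leI field_simps)
  finally show ?thesis by (simp add: powr_realpow)
qed

text \<open>Against dr / r the weight \<open>G\<close> has the same integral Gamma(2w)/2 along every
  dilation orbit off the centre, so it can stand in for a unit sphere. Moving the dilation from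
  \<open>G\<close> to the truncated kernel \<open>F\<close> makes the orbit integral explicit: it is
  a power of s times the power p of the kernel.\<close>

lemma nn_integral_hom_kernel:
  fixes e :: "(real^'n::finite) \<times> (real^'n)"
  assumes e: "norm e = 1" and s: "s > 0" and Q: "Q = hom_dim CARD('n)"
  shows "(\<integral>\<^sup>+u. ennreal (max 0 (hom_kernel e u - s)) \<partial>lborel)
    = ennreal ((1 - 1 / Q) * s powr (- (1 / (Q - 1))) * C'_base CARD('n))"
proof -
  define p where "p = Q / (Q - 1)"
  define w where "w = real CARD('n) / 2 + p / 4"
  have Q2: "Q \<ge> 2" using hom_dim_gt Q by simp
  have p0: "p > 0" using Q2 by (simp add: p_def)
  have w0: "w > 0" using p0 by (simp add: w_def add_nonneg_pos)
  define G where "G u = ennreal (norm (heis_horiz u) powr (4 * w) * exp (- (norm (heis_horiz u))\<^sup>2))" for u :: "'n heis"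
  have [measurable]: "G \<in> borel_measurable borel" unfolding G_def by measurable
  define F where "F u = ennreal (max 0 (hom_kernel e u - s))" for u
  have [measurable]: "F \<in> borel_measurable borel" unfolding F_def by measurable
  let ?k = "(1 - 1 / Q) * s powr (- (1 / (Q - 1)))"
  have k: "?k \<ge> 0" using Q2 by simp
  have "ennreal (Gamma (2 * w) / 2) * (\<integral>\<^sup>+u. F u \<partial>lborel) = (\<integral>\<^sup>+u. F u * ennreal (Gamma (2 * w) / 2) \<partial>lborel)"
    by (simp add: nn_integral_multc mult.commute)
  also have "\<dots> = (\<integral>\<^sup>+u. F u * (\<integral>\<^sup>+r. G (heis_dil r u) * ennreal (1 / r) * indicator {0<..} r \<partial>lborel) \<partial>lborel)"
  proof (rule nn_integral_cong)
    fix u :: "'n heis"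
    show "F u * ennreal (Gamma (2 * w) / 2) = F u * (\<integral>\<^sup>+r. G (heis_dil r u) * ennreal (1 / r) * indicator {0<..} r \<partial>lborel)"
    proof (cases "heis_horiz u = 0")
      case True
      \<comment> \<open>On the centre \<open>G\<close> vanishes and the orbit integral is not
        Gamma(2w)/2, but there the kernel is 0 < s.\<close>
      then have "F u = 0" using s by (simp add: F_def hom_kernel_def)
      then show ?thesis by simp
    next
      case False
      let ?\<nu> = "norm (heis_horiz u)"
      have \<nu>: "?\<nu> > 0" using False by simp
      have "(\<integral>\<^sup>+r. G (heis_dil r u) * ennreal (1 / r) * indicator {0<..} r \<partial>lborel)
        = (\<integral>\<^sup>+r. ennreal (?\<nu> powr (4 * w)) * (ennreal (r powr (4 * w - 1) * exp (- (?\<nu>\<^sup>2) * r\<^sup>2)) * indicator {0..} r) \<partial>lborel)"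
      proof (rule nn_integral_cong)
        fix r :: real
        show "G (heis_dil r u) * ennreal (1 / r) * indicator {0<..} r
          = ennreal (?\<nu> powr (4 * w)) * (ennreal (r powr (4 * w - 1) * exp (- (?\<nu>\<^sup>2) * r\<^sup>2)) * indicator {0..} r)"
        proof (cases "r > 0")
          case True
          have "heis_horiz (heis_dil r u) = r *\<^sub>R heis_horiz u"
            by (simp add: heis_horiz_def heis_dil_def)
          then have "G (heis_dil r u) = ennreal ((r powr (4 * w) * ?\<nu> powr (4 * w)) * exp (- (?\<nu>\<^sup>2) * r\<^sup>2))"
            unfolding G_def using True by (simp add: powr_mult power_mult_distrib mult.commute)
          then show ?thesis
            using True by (simp add: ennreal_mult[symmetric] powr_diff mult_ac)
        qed (auto simp: indicator_def)
      qed
      also have "\<dots> = ennreal (?\<nu> powr (4 * w)) * (\<integral>\<^sup>+r. ennreal (r powr (4 * w - 1) * exp (- (?\<nu>\<^sup>2) * r\<^sup>2)) * indicator {0..} r \<partial>lborel)"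
        by (rule nn_integral_cmult) simp
      also have "\<dots> = ennreal (?\<nu> powr (4 * w) * (Gamma (4 * w / 2) / 2 * (?\<nu>\<^sup>2) powr (- (4 * w) / 2)))"
        using \<nu> w0 by (subst nn_integral_Gamma_square) (simp_all add: ennreal_mult[symmetric] Gamma_real_pos less_imp_le)
      also have "?\<nu> powr (4 * w) * (Gamma (4 * w / 2) / 2 * (?\<nu>\<^sup>2) powr (- (4 * w) / 2)) = Gamma (2 * w) / 2"
      proof -
        have "(?\<nu>\<^sup>2) powr (- (4 * w) / 2) = ?\<nu> powr (- (4 * w))"
          using \<nu> by (simp add: powr_powr flip: powr_numeral)
        then show ?thesis using \<nu> by (simp add: powr_minus)
      qed
      finally show ?thesis by simp
    qed
  qed
  also have "\<dots> = (\<integral>\<^sup>+u. G u * (\<integral>\<^sup>+r. F (heis_dil (1 / r) u) * ennreal (r powr (- (hom_dim CARD('n)) - 1))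
         * indicator {0<..} r \<partial>lborel) \<partial>lborel)"
    by (rule nn_integral_dilation_average) auto
  also have "\<dots> = (\<integral>\<^sup>+u. ennreal ?k * (G u * ennreal (max 0 (hom_kernel e u) powr p)) \<partial>lborel)"
  proof (rule nn_integral_cong)
    fix u :: "'n heis"
    have "(\<integral>\<^sup>+r. F (heis_dil (1 / r) u) * ennreal (r powr (- (hom_dim CARD('n)) - 1)) * indicator {0<..} r \<partial>lborel)
      = (\<integral>\<^sup>+r. ennreal (max 0 (r powr (Q - 1) * hom_kernel e u - s)) * ennreal (r powr (- Q - 1)) * indicator {0<..} r \<partial>lborel)"
      by (intro nn_integral_cong) (auto simp: F_def hom_kernel_dil Q indicator_def)
    also have "\<dots> = ennreal (?k * max 0 (hom_kernel e u) powr p)"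
    proof (cases "hom_kernel e u > 0")
      case True
      then show ?thesis
        using nn_integral_truncated_power[OF True s, of Q] Q2 by (simp add: p_def)
    next
      case False
      then have "max 0 (r powr (Q - 1) * hom_kernel e u - s) = 0" for r
        using s by (simp add: max_def) (metis less_imp_le mult_nonneg_nonpos not_le order_trans powr_ge_zero)
      then show ?thesis using False p0 by (simp add: max_def)
    qed
    also have "\<dots> = ennreal ?k * ennreal (max 0 (hom_kernel e u) powr p)"
      by (rule ennreal_mult'[OF k])
    finally show "G u * (\<integral>\<^sup>+r. F (heis_dil (1 / r) u) * ennreal (r powr (- (hom_dim CARD('n)) - 1)) * indicator {0<..} r \<partial>lborel)
      = ennreal ?k * (G u * ennreal (max 0 (hom_kernel e u) powr p))"
      by (simp only: mult_ac)
  qed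
  also have "\<dots> = ennreal ?k * (\<integral>\<^sup>+u. G u * ennreal (max 0 (hom_kernel e u) powr p) \<partial>lborel)"
    by (rule nn_integral_cmult) simp
  also have "(\<integral>\<^sup>+u. G u * ennreal (max 0 (hom_kernel e u) powr p) \<partial>lborel)
     = ennreal (pi ^ CARD('n) * Gamma w / Gamma (w + 1 / 2) * Gamma ((p + 1) / 2) / 2)"
    unfolding G_def by (rule nn_integral_hom_kernel_weighted[OF e]) (simp_all add: p_def w_def Q)
  also have "\<dots> = ennreal (Gamma (2 * w) / 2 * C'_base CARD('n))"
  proof -
    have "Gamma (2 * w) > 0" using w0 by (intro Gamma_real_pos) simp
    then show ?thesis
      by (intro arg_cong[where f=ennreal]) (simp add: C'_base_eq[OF Q p_def w_def] mult_ac)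
  qed
  also have "ennreal ?k * \<dots> = ennreal (?k * (Gamma (2 * w) / 2 * C'_base CARD('n)))"
    using k w0 C'_base_pos[of "CARD('n)"] by (intro ennreal_mult[symmetric]) (auto intro!: mult_nonneg_nonneg less_imp_le Gamma_real_pos)
  finally have "(\<integral>\<^sup>+u. F u \<partial>lborel) = ennreal (?k * (Gamma (2 * w) / 2 * C'_base CARD('n)) / (Gamma (2 * w) / 2))"
    using w0 by (intro ennreal_mult_left_eqD) (auto intro!: Gamma_real_pos)
  also have "?k * (Gamma (2 * w) / 2 * C'_base CARD('n)) / (Gamma (2 * w) / 2) = ?k * C'_base CARD('n)"
    using w0 less_imp_neq[OF Gamma_real_pos[of "2 * w"]] by simp
  finally show ?thesis by (simp add: F_def)
qed

section \<open>The regularised kernel\<close>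

text \<open>Up to a constant, \<open>fs_kernel \<epsilon>\<close> is the horizontal gradient of Folland's regularised
  fundamental solution \<open>((|\<zeta>|\<^sup>2 + \<epsilon>\<^sup>2)\<^sup>2 + z\<^sup>2) powr (- n / 2)\<close>.\<close>

definition fs_a :: "real \<Rightarrow> 'n::finite heis \<Rightarrow> real" where
  "fs_a \<epsilon> p = fst p \<bullet> fst p + fst (snd p) \<bullet> fst (snd p) + \<epsilon>\<^sup>2"

definition fs_d :: "real \<Rightarrow> 'n::finite heis \<Rightarrow> real" where
  "fs_d \<epsilon> p = (fs_a \<epsilon> p)\<^sup>2 + (heis_z p)\<^sup>2"

definition fs_kernel :: "real \<Rightarrow> 'n::finite heis \<Rightarrow> (real^'n) \<times> (real^'n)" where
  "fs_kernel \<epsilon> p = fs_d \<epsilon> p powr (- (real CARD('n) / 2 + 1)) *\<^sub>R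
     (fs_a \<epsilon> p *\<^sub>R fst p + heis_z p *\<^sub>R fst (snd p), fs_a \<epsilon> p *\<^sub>R fst (snd p) - heis_z p *\<^sub>R fst p)"

lemma fs_a_eq: "fs_a \<epsilon> p = \<epsilon>\<^sup>2 + (norm (heis_horiz p))\<^sup>2"
  by (simp add: fs_a_def heis_horiz_def norm_Pair power2_norm_eq_inner)

lemma fs_a_pos: "\<epsilon> > 0 \<Longrightarrow> fs_a \<epsilon> p > 0"
  by (simp add: fs_a_eq add_pos_nonneg)

lemma fs_d_pos: "\<epsilon> > 0 \<Longrightarrow> fs_d \<epsilon> p > 0"
  using fs_a_pos[of \<epsilon> p] by (simp add: fs_d_def add_pos_nonneg)

lemma continuous_on_fs_a [continuous_intros]: "continuous_on S f \<Longrightarrow> continuous_on S (\<lambda>x. fs_a \<epsilon> (f x))"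
  unfolding fs_a_def by (intro continuous_intros)

lemma continuous_on_fs_d [continuous_intros]: "continuous_on S f \<Longrightarrow> continuous_on S (\<lambda>x. fs_d \<epsilon> (f x))"
  unfolding fs_d_def by (intro continuous_intros)

lemma continuous_on_fs_d_powr [continuous_intros]:
  assumes "\<epsilon> > 0" "continuous_on S f"
  shows "continuous_on S (\<lambda>x. fs_d \<epsilon> (f x) powr c)"
proof -
  have "fs_d \<epsilon> (f x) \<noteq> 0" for x
    using fs_d_pos[OF assms(1)] by (rule less_imp_neq[symmetric])
  with assms(2) show ?thesis by (intro continuous_intros) auto
qed

lemma continuous_on_fs_kernel [continuous_intros]:
  "\<epsilon> > 0 \<Longrightarrow> continuous_on S f \<Longrightarrow> continuous_on S (\<lambda>x. fs_kernel \<epsilon> (f x))"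
  unfolding fs_kernel_def by (intro continuous_intros)

text \<open>(a, z) / sqrt d is the unit vector of angle arctan(z / a), with a > 0 because \<epsilon>
  > 0. Pulling out sqrt d changes the exponent from -(n/2 + 1) to -(n/2 + 1/2) = -Q/4.\<close>

lemma fs_kernel_rotation:
  fixes p :: "'n::finite heis"
  assumes \<epsilon>: "\<epsilon> > 0"
  shows "e \<bullet> fs_kernel \<epsilon> p = fs_d \<epsilon> p powr (- (hom_dim CARD('n) / 4))
    * (e \<bullet> heis_horiz (heis_rot (arctan (heis_z p / fs_a \<epsilon> p)) p))"
proof -
  let ?a = "fs_a \<epsilon> p" and ?d = "fs_d \<epsilon> p"
  have a: "?a > 0" and d: "?d > 0" using \<epsilon> by (simp_all only: fs_a_pos fs_d_pos)
  have sq: "sqrt (1 + (heis_z p / ?a)\<^sup>2) = sqrt ?d / ?a"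
    using a by (simp add: real_sqrt_eq_iff fs_d_def power_divide field_simps real_sqrt_divide[symmetric] flip: real_sqrt_abs2)
       (simp add: real_sqrt_divide field_simps)
  have c: "cos (arctan (heis_z p / ?a)) = ?a / sqrt ?d"
    by (simp add: cos_arctan sq)
  have s: "sin (arctan (heis_z p / ?a)) = heis_z p / sqrt ?d"
    using a by (simp add: sin_arctan sq)
  have h: "heis_horiz (heis_rot (arctan (heis_z p / ?a)) p) = (1 / sqrt ?d) *\<^sub>R
     (?a *\<^sub>R fst p + heis_z p *\<^sub>R fst (snd p), ?a *\<^sub>R fst (snd p) - heis_z p *\<^sub>R fst p)"
    by (simp add: heis_horiz_def heis_rot_def c s scaleR_add_right scaleR_diff_right)
  have "?d powr (- (hom_dim CARD('n) / 4)) * (1 / sqrt ?d) = ?d powr (- (hom_dim CARD('n) / 4)) * ?d powr (- (1 / 2))"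
    using d by (simp add: powr_minus_divide powr_half_sqrt)
  also have "\<dots> = ?d powr (- (real CARD('n) / 2 + 1))"
    unfolding powr_add[symmetric] by (rule arg_cong[where f="\<lambda>x. ?d powr x"]) (simp add: hom_dim_def field_simps)
  finally show ?thesis
    unfolding h fs_kernel_def inner_scaleR_right mult.assoc[symmetric] by simp
qed

text \<open>Regularising only increases \<open>fs_d\<close>, whose power is negative. After the
  untwisting rotation the kernel is therefore dominated by \<open>hom_kernel e\<close> where it is
  positive, and the truncation discards the rest. This makes the bound independent of
  \<epsilon>.\<close>

lemma nn_integral_fs_kernel_le:
  fixes e :: "(real^'n::finite) \<times> (real^'n)"
  assumes \<epsilon>: "\<epsilon> > 0" and e: "norm e = 1" and s: "s > 0" and Q: "Q = hom_dim CARD('n)"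
  shows "(\<integral>\<^sup>+u. ennreal (max 0 (e \<bullet> fs_kernel \<epsilon> u - s)) \<partial>lborel)
    \<le> ennreal ((1 - 1 / Q) * s powr (- (1 / (Q - 1))) * C'_base CARD('n))"
proof -
  define f where "f u = ennreal (max 0 (fs_d \<epsilon> u powr (- (Q / 4)) * (e \<bullet> heis_horiz u) - s))" for u
  define \<alpha> where "\<alpha> u = arctan (heis_z u / fs_a \<epsilon> u)" for u :: "'n heis"
  have [measurable]: "f \<in> borel_measurable borel"
    unfolding f_def using \<epsilon>
    by (intro measurable_compose[OF _ measurable_ennreal] borel_measurable_continuous_onI continuous_intros)
  have "fs_a \<epsilon> u \<noteq> 0" for u :: "'n heis"
    using fs_a_pos[OF \<epsilon>] by (rule less_imp_neq[symmetric])
  then have [measurable]: "\<alpha> \<in> borel_measurable borel"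
    unfolding \<alpha>_def by (intro borel_measurable_continuous_onI continuous_intros) auto
  have ar: "fs_a \<epsilon> (heis_rot t u) = fs_a \<epsilon> u" for t u
    by (simp add: fs_a_eq norm_heis_rot)
  have zr: "heis_z (heis_rot t u) = heis_z u" for t u
    by (simp add: heis_rot_def)
  have dr: "fs_d \<epsilon> (heis_rot t u) = fs_d \<epsilon> u" for t u
    by (simp add: fs_d_def ar zr)
  have \<alpha>r: "\<alpha> (heis_rot t u) = \<alpha> u" for t u
    by (simp add: \<alpha>_def ar zr)
  have "(\<integral>\<^sup>+u. ennreal (max 0 (e \<bullet> fs_kernel \<epsilon> u - s)) \<partial>lborel) = (\<integral>\<^sup>+u. f (heis_rot (\<alpha> u) u) \<partial>lborel)"
    by (simp add: f_def \<alpha>_def dr fs_kernel_rotation[OF \<epsilon>] Q)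
  also have "\<dots> = (\<integral>\<^sup>+u. f u \<partial>lborel)"
  proof (rule nn_integral_twisted_rotation)
    show "\<bar>\<alpha> u\<bar> \<le> 2 * pi" for u
      using arctan_lbound[of "heis_z u / fs_a \<epsilon> u"] arctan_ubound[of "heis_z u / fs_a \<epsilon> u"]
      unfolding \<alpha>_def by linarith
  qed (simp_all add: \<alpha>r)
  also have "\<dots> \<le> (\<integral>\<^sup>+u. ennreal (max 0 (hom_kernel e u - s)) \<partial>lborel)"
  proof (intro nn_integral_mono)
    fix u :: "'n heis"
    show "f u \<le> ennreal (max 0 (hom_kernel e u - s))"
    proof (cases "e \<bullet> heis_horiz u > 0")
      case True
      then have "norm (heis_horiz u) > 0" by auto
      then have 1: "norm (heis_horiz u) ^ 4 + (heis_z u)\<^sup>2 > 0" by (simp add: add_pos_nonneg)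
      have "((norm (heis_horiz u))\<^sup>2)\<^sup>2 \<le> (fs_a \<epsilon> u)\<^sup>2"
        unfolding fs_a_eq by (intro power_mono) auto
      then have "norm (heis_horiz u) ^ 4 + (heis_z u)\<^sup>2 \<le> fs_d \<epsilon> u"
        by (simp add: fs_d_def)
      then have "fs_d \<epsilon> u powr (- (Q / 4)) \<le> (norm (heis_horiz u) ^ 4 + (heis_z u)\<^sup>2) powr (- (Q / 4))"
        using 1 hom_dim_gt[of "CARD('n)"] by (intro powr_mono2') (auto simp: Q)
      then have "fs_d \<epsilon> u powr (- (Q / 4)) * (e \<bullet> heis_horiz u) \<le> hom_kernel e u"
        unfolding hom_kernel_def Q using True by (simp add: mult.commute)
      then show ?thesis unfolding f_def by (intro ennreal_leI) auto
    next
      case False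
      then have "fs_d \<epsilon> u powr (- (Q / 4)) * (e \<bullet> heis_horiz u) \<le> 0"
        by (simp add: mult_nonneg_nonpos)
      then show ?thesis using s by (simp add: f_def)
    qed
  qed
  also have "\<dots> = ennreal ((1 - 1 / Q) * s powr (- (1 / (Q - 1))) * C'_base CARD('n))"
    by (rule nn_integral_hom_kernel[OF e s Q])
  finally show ?thesis .
qed

text \<open>The bathtub principle: \<open>s\<close> is the level at which the superlevel set of the kernel has volume \<open>v\<close>.\<close>

lemma integral_fs_kernel_le:
  fixes e :: "(real^'n::finite) \<times> (real^'n)"
  assumes \<epsilon>: "\<epsilon> > 0" and e: "norm e = 1"
    and f: "integrable lborel f" "\<And>u. 0 \<le> f u" "\<And>u. f u \<le> 1"
    and v: "v = (\<integral>u. f u \<partial>lborel)" "v > 0"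
    and int: "integrable lborel (\<lambda>u. f u * (e \<bullet> fs_kernel \<epsilon> (heis_diff u q)))"
  shows "(\<integral>u. f u * (e \<bullet> fs_kernel \<epsilon> (heis_diff u q)) \<partial>lborel)
    \<le> C'_const CARD('n) * v powr (1 / hom_dim CARD('n))"
proof -
  define Q where "Q = hom_dim CARD('n)"
  define T where "T = C'_base CARD('n)"
  define s where "s = (T / (Q * v)) powr ((Q - 1) / Q)"
  have Q2: "Q \<ge> 2" using hom_dim_gt by (simp add: Q_def)
  have T0: "T > 0" by (simp add: T_def C'_base_pos)
  have Tv: "T / (Q * v) > 0" using T0 Q2 v by simp
  then have s0: "s > 0" unfolding s_def powr_gt_zero by (rule less_imp_neq[symmetric])
  define h where "h u = max 0 (e \<bullet> fs_kernel \<epsilon> u - s)" for u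
  have [measurable]: "h \<in> borel_measurable borel"
    unfolding h_def using \<epsilon> by (intro borel_measurable_continuous_onI continuous_intros)
  let ?B = "(1 - 1 / Q) * s powr (- (1 / (Q - 1))) * T"
  have B0: "?B \<ge> 0" using Q2 T0 by simp
  have hB: "(\<integral>\<^sup>+u. ennreal (h u) \<partial>lborel) \<le> ennreal ?B"
    unfolding h_def T_def by (rule nn_integral_fs_kernel_le[OF \<epsilon> e s0 Q_def])
  have h_int: "integrable lborel h"
    using hB by (intro integrableI_nonneg) (auto simp: h_def intro: le_less_trans)
  have h_le: "(\<integral>u. h u \<partial>lborel) \<le> ?B"
    using hB B0 by (subst integral_eq_nn_integral) (auto simp: h_def enn2real_leI)
  have "(\<integral>u. f u * (e \<bullet> fs_kernel \<epsilon> (heis_diff u q)) \<partial>lborel)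
     \<le> (\<integral>u. s * f u + h (heis_diff u q) \<partial>lborel)"
  proof (rule integral_mono[OF int])
    show "integrable lborel (\<lambda>u. s * f u + h (heis_diff u q))"
      using f(1) h_int by (intro Bochner_Integration.integrable_add) (simp_all add: integral_heis_diff)
    fix u
    let ?g = "e \<bullet> fs_kernel \<epsilon> (heis_diff u q)"
    \<comment> \<open>Bathtub estimate: f (g - s) is at most the positive part of g - s for 0 <= f
      <= 1, with equality for the indicator of {g > s}.\<close>
    have "f u * (?g - s) \<le> f u * h (heis_diff u q)"
      using f(2)[of u] by (intro mult_left_mono) (auto simp: h_def)
    also have "\<dots> \<le> 1 * h (heis_diff u q)"
      using f(3)[of u] by (intro mult_right_mono) (auto simp: h_def)
    finally show "f u * ?g \<le> s * f u + h (heis_diff u q)" by (simp add: algebra_simps)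
  qed
  also have "\<dots> = s * v + (\<integral>u. h u \<partial>lborel)"
    using f(1) h_int v by (subst Bochner_Integration.integral_add) (simp_all add: integral_heis_diff)
  also have "\<dots> \<le> s * v + ?B" using h_le by simp
  also have "\<dots> = Q powr (1 / Q) * T powr ((Q - 1) / Q) * v powr (1 / Q)"
  proof -
    \<comment> \<open>This \<open>s\<close> minimises the right-hand side: there the second term
      equals (Q - 1) s v, and the two terms add up to Q v s.\<close>
    have sp: "s powr (- (1 / (Q - 1))) = s * (Q * v / T)"
    proof -
      have "s powr (- (1 / (Q - 1))) = (T / (Q * v)) powr (- (1 / Q))"
        using Q2 by (simp add: s_def powr_powr)
      also have "- (1 / Q) = (Q - 1) / Q + (-1)" using Q2 by (simp add: field_simps)
      also have "(T / (Q * v)) powr ((Q - 1) / Q + (-1)) = s * (T / (Q * v)) powr (-1)"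
        unfolding s_def by (rule powr_add)
      also have "(T / (Q * v)) powr (-1) = 1 / (T / (Q * v))"
        using powr_minus_divide[of "T / (Q * v)" 1] powr_one[of "T / (Q * v)"] less_imp_le[OF Tv] by metis
      finally show ?thesis by simp
    qed
    have sB: "s * v + ?B = Q * v * s"
      unfolding sp using T0 Q2 by (simp add: field_simps)
    have s_eq: "s = T powr ((Q - 1) / Q) / (Q powr ((Q - 1) / Q) * v powr ((Q - 1) / Q))"
      unfolding s_def using T0 Q2 v by (simp add: powr_divide powr_mult)
    have "Q * v * s = (Q / Q powr ((Q - 1) / Q)) * T powr ((Q - 1) / Q) * (v / v powr ((Q - 1) / Q))"
      unfolding s_eq by simp
    moreover have "x / x powr ((Q - 1) / Q) = x powr (1 / Q)" if "x > 0" for x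
    proof -
      have "1 / Q = 1 - (Q - 1) / Q" using Q2 by (simp add: field_simps)
      then have "x powr (1 / Q) = x powr (1 - (Q - 1) / Q)" by simp
      also have "\<dots> = x / x powr ((Q - 1) / Q)" using that by (subst powr_diff) simp
      finally show ?thesis ..
    qed
    ultimately show ?thesis
      unfolding sB using Q2 v(2) by simp
  qed
  finally show ?thesis
    by (simp add: C'_const_eq Q_def T_def)
qed

section \<open>Total mass of the divergence kernel\<close>

lemma Gamma_real_duplication:
  assumes "x > (0::real)"
  shows "Gamma x * Gamma (x + 1 / 2) = 2 powr (1 - 2 * x) * sqrt pi * Gamma (2 * x)"
proof -
  have "complex_of_real (Gamma x * Gamma (x + 1 / 2)) = Gamma (complex_of_real x) * Gamma (complex_of_real x + 1 / 2)"
    using Gamma_complex_of_real[of x] Gamma_complex_of_real[of "x + 1 / 2"] by simp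
  also have "\<dots> = exp ((1 - 2 * complex_of_real x) * of_real (ln 2)) * of_real (sqrt pi) * Gamma (2 * complex_of_real x)"
  proof (rule Gamma_legendre_duplication)
    have "complex_of_real y \<notin> \<int>\<^sub>\<le>\<^sub>0" if "y > 0" for y
      using that by (auto simp: nonpos_Ints_def dest!: arg_cong[where f=Re])
    from this[of x] this[of "x + 1 / 2"] show "complex_of_real x \<notin> \<int>\<^sub>\<le>\<^sub>0" "complex_of_real x + 1 / 2 \<notin> \<int>\<^sub>\<le>\<^sub>0"
      using assms by simp_all
  qed
  also have "\<dots> = complex_of_real (exp ((1 - 2 * x) * ln 2) * sqrt pi * Gamma (2 * x))"
    using Gamma_complex_of_real[of "2 * x"] by (simp add: exp_of_real[symmetric])
  finally have "Gamma x * Gamma (x + 1 / 2) = exp ((1 - 2 * x) * ln 2) * sqrt pi * Gamma (2 * x)"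
    by (simp only: of_real_eq_iff)
  then show ?thesis by (simp add: powr_def)
qed

lemma C_const_pos: "n > 0 \<Longrightarrow> C_const n > 0"
  unfolding C_const_def by (intro divide_pos_pos mult_pos_pos zero_less_power Gamma_real_pos) auto

text \<open>The origin of \<open>C_const\<close>: multiplied by the factor from
  \<open>hdiv_lin_fs_kernel\<close>, this is the total divergence \<open>1 / C_const\<close> of the
  kernel, for every \<epsilon>. It is computed by one Bessel integral along the centre and one over
  the horizontal plane.\<close>

lemma nn_integral_fs_d:
  assumes \<epsilon>: "\<epsilon> > 0"
  shows "(\<integral>\<^sup>+u. ennreal (fs_d \<epsilon> (u :: 'n::finite heis) powr (- (real CARD('n) / 2 + 1))) \<partial>lborel)
    = ennreal (1 / (C_const CARD('n) * (2 * real CARD('n) * \<epsilon>\<^sup>2)))"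
proof -
  define n where "n = real CARD('n)"
  have n0: "n > 0" by (simp add: n_def)
  let ?c = "sqrt pi * Gamma (n / 2 + 1 / 2) / Gamma (n / 2 + 1)"
  have c: "?c \<ge> 0" using n0 by (intro divide_nonneg_nonneg mult_nonneg_nonneg less_imp_le[OF Gamma_real_pos]) auto
  have meas: "(\<lambda>u::'n heis. ennreal (fs_d \<epsilon> u powr (- (n / 2 + 1)))) \<in> borel_measurable borel"
    using \<epsilon> by (intro measurable_compose[OF _ measurable_ennreal] borel_measurable_continuous_onI continuous_intros)
  have "(\<integral>\<^sup>+u. ennreal (fs_d \<epsilon> (u :: 'n heis) powr (- (n / 2 + 1))) \<partial>lborel)
      = (\<integral>\<^sup>+\<zeta>. (\<integral>\<^sup>+z. ennreal (fs_d \<epsilon> (fst \<zeta>, snd \<zeta>, z) powr (- (n / 2 + 1))) \<partial>lborel) \<partial>(lborel :: ((real^'n) \<times> (real^'n)) measure))"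
    by (rule nn_integral_heis[OF meas])
  also have "\<dots> = (\<integral>\<^sup>+\<zeta>. ennreal ?c * ennreal ((\<epsilon>\<^sup>2 + (norm \<zeta>)\<^sup>2) powr (- (n + 1))) \<partial>(lborel :: ((real^'n) \<times> (real^'n)) measure))"
  proof (rule nn_integral_cong)
    fix \<zeta> :: "(real^'n) \<times> (real^'n)"
    let ?A = "\<epsilon>\<^sup>2 + (norm \<zeta>)\<^sup>2"
    have A: "?A > 0" using \<epsilon> by (simp add: add_pos_nonneg)
    have "(\<integral>\<^sup>+z. ennreal (fs_d \<epsilon> (fst \<zeta>, snd \<zeta>, z) powr (- (n / 2 + 1))) \<partial>lborel)
       = (\<integral>\<^sup>+z. ennreal ((?A\<^sup>2 + (norm (z::real))\<^sup>2) powr (- (n / 2 + 1))) \<partial>lborel)"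
      by (simp add: fs_d_def fs_a_eq)
    also have "\<dots> = ennreal (?c * (?A\<^sup>2) powr (1 / 2 - (n / 2 + 1)))"
      using nn_integral_bessel_kernel[OF zero_less_power[OF A, of 2], of "n / 2 + 1", where 'a=real] n0
      by (simp add: powr_half_sqrt add.commute)
    also have "(?A\<^sup>2) powr (1 / 2 - (n / 2 + 1)) = ?A powr (2 * (1 / 2 - (n / 2 + 1)))"
      using A by (simp add: powr_powr flip: powr_numeral)
    also have "2 * (1 / 2 - (n / 2 + 1)) = - (n + 1)" by simp
    finally show "(\<integral>\<^sup>+z. ennreal (fs_d \<epsilon> (fst \<zeta>, snd \<zeta>, z) powr (- (n / 2 + 1))) \<partial>lborel)
       = ennreal ?c * ennreal (?A powr (- (n + 1)))"
      by (simp only: ennreal_mult'[OF c])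
  qed
  also have "\<dots> = ennreal ?c * (\<integral>\<^sup>+\<zeta>. ennreal ((\<epsilon>\<^sup>2 + (norm \<zeta>)\<^sup>2) powr (- (n + 1))) \<partial>(lborel :: ((real^'n) \<times> (real^'n)) measure))"
    by (rule nn_integral_cmult) simp
  also have "(\<integral>\<^sup>+\<zeta>. ennreal ((\<epsilon>\<^sup>2 + (norm \<zeta>)\<^sup>2) powr (- (n + 1))) \<partial>(lborel :: ((real^'n) \<times> (real^'n)) measure))
     = ennreal (pi powr n * Gamma 1 / Gamma (n + 1) * (\<epsilon>\<^sup>2) powr (-1))"
    using nn_integral_bessel_kernel[of "\<epsilon>\<^sup>2" "n + 1", where 'a="(real^'n) \<times> (real^'n)"] \<epsilon>
    by (simp add: n_def mult_2[symmetric])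
  also have "ennreal ?c * \<dots> = ennreal (?c * (pi powr n * Gamma 1 / Gamma (n + 1) * (\<epsilon>\<^sup>2) powr (-1)))"
    by (rule ennreal_mult'[OF c, symmetric])
  also have "?c * (pi powr n * Gamma 1 / Gamma (n + 1) * (\<epsilon>\<^sup>2) powr (-1)) = 1 / (C_const CARD('n) * (2 * n * \<epsilon>\<^sup>2))"
  proof -
    have g: "Gamma (n / 2) > 0" "Gamma n > 0" using n0 by (auto intro!: Gamma_real_pos)
    have G1: "Gamma (n + 1) = n * Gamma n" "Gamma (n / 2 + 1) = n / 2 * Gamma (n / 2)"
      using n0 Gamma_plus1[of n] Gamma_plus1[of "n / 2"] by (auto simp: nonpos_Ints_def)
    \<comment> \<open>The central integral produces Gamma((n+1)/2), whereas \<open>C_const\<close>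
      is expressed by Gamma(n/2); duplication converts one into the other and brings in the power of
      2.\<close>
    have "Gamma (n / 2) * Gamma (n / 2 + 1 / 2) = 2 powr (1 - n) * sqrt pi * Gamma n"
      using Gamma_real_duplication[of "n / 2"] n0 by simp
    then have G2: "Gamma (n / 2 + 1 / 2) = 2 powr (1 - n) * sqrt pi * Gamma n / Gamma (n / 2)"
      using g by (simp add: field_simps)
    have p2: "2 powr (1 - n) = 1 / (4 * 2 powr (n - 3))"
    proof -
      have "(2::real) powr (1 - n) * 2 powr (n - 3) = 2 powr (-2)"
        unfolding powr_add[symmetric] by simp
      also have "\<dots> = 1 / 4" by (simp add: powr_minus)
      finally show ?thesis by (simp add: field_simps)
    qed
    have pin: "pi powr n = pi ^ CARD('n)" by (simp add: n_def powr_realpow)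
    have e: "(\<epsilon>\<^sup>2) powr (-1) = 1 / \<epsilon>\<^sup>2" using \<epsilon> by (simp add: powr_minus divide_inverse)
    show ?thesis
      unfolding C_const_def n_def[symmetric] G1 G2 p2 pin e
      using g[THEN less_imp_neq] n0 \<epsilon> by (simp add: field_simps power2_eq_square)
  qed
  finally show ?thesis by (simp add: n_def)
qed

section \<open>Horizontal divergence of the test field\<close>

definition X_vec :: "'n::finite \<Rightarrow> 'n heis \<Rightarrow> 'n heis" where
  "X_vec j p = (axis j 1, 0, 2 * (fst (snd p) $ j))"

definition Y_vec :: "'n::finite \<Rightarrow> 'n heis \<Rightarrow> 'n heis" where
  "Y_vec j p = (0, axis j 1, - 2 * (fst p $ j))"

text \<open>With the derivative \<open>L\<close> as an argument, the divergence at \<open>p\<close>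
  is a bounded linear functional of \<open>L\<close> and can be exchanged with an integral of
  derivatives.\<close>

definition hdiv_lin :: "'n::finite heis \<Rightarrow> ('n heis \<Rightarrow> (real^'n) \<times> (real^'n)) \<Rightarrow> real" where
  "hdiv_lin p L = (\<Sum>j\<in>UNIV. fst (L (X_vec j p)) $ j + snd (L (Y_vec j p)) $ j)"

lemma horizontal_div_eq:
  fixes \<phi> :: "'n::finite heis \<Rightarrow> (real^'n) \<times> (real^'n)"
  assumes d: "(\<phi> has_derivative L) (at p)"
  shows "horizontal_div \<phi> p = hdiv_lin p L"
proof -
  interpret L: bounded_linear L using d by (rule has_derivative_bounded_linear)
  have 1: "frechet_derivative (\<lambda>q. fst (\<phi> q) $ j) (at p) = (\<lambda>v. fst (L v) $ j)" for j
    by (rule frechet_derivative_at[symmetric])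
       (intro bounded_linear.has_derivative[OF bounded_linear_vec_nth] has_derivative_fst d)
  have 2: "frechet_derivative (\<lambda>q. snd (\<phi> q) $ j) (at p) = (\<lambda>v. snd (L v) $ j)" for j
    by (rule frechet_derivative_at[symmetric])
       (intro bounded_linear.has_derivative[OF bounded_linear_vec_nth] has_derivative_snd d)
  obtain x y z where p: "p = (x, y, z)" by (metis prod_cases3)
  have X: "L (X_vec j p) = L (axis j 1, 0, 0) + (2 * (y $ j)) *\<^sub>R L (0, 0, 1)" for j
    unfolding L.scaleR[symmetric] L.add[symmetric] by (simp add: X_vec_def p)
  have Y: "L (Y_vec j p) = L (0, axis j 1, 0) - (2 * (x $ j)) *\<^sub>R L (0, 0, 1)" for j
    unfolding L.scaleR[symmetric] L.diff[symmetric] by (simp add: Y_vec_def p)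
  show ?thesis
    unfolding horizontal_div_def hdiv_lin_def X Y
    unfolding X_field_def Y_field_def p prod.case
    unfolding p[symmetric] 1 2 by simp
qed

lemma bounded_linear_hdiv_lin: "bounded_linear (\<lambda>L. hdiv_lin p (blinfun_apply L))"
  unfolding hdiv_lin_def
  by (intro bounded_linear_sum bounded_linear_add
      bounded_linear_compose[OF bounded_linear_vec_nth]
      bounded_linear_compose[OF bounded_linear_fst] bounded_linear_compose[OF bounded_linear_snd]
      blinfun.bounded_linear_left)

lemma continuous_on_X_vec [continuous_intros]: "continuous_on S f \<Longrightarrow> continuous_on S (\<lambda>x. X_vec j (f x))"
  unfolding X_vec_def by (intro continuous_intros)

lemma continuous_on_Y_vec [continuous_intros]: "continuous_on S f \<Longrightarrow> continuous_on S (\<lambda>x. Y_vec j (f x))"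
  unfolding Y_vec_def by (intro continuous_intros)

lemma continuous_on_hdiv_lin:
  "continuous_on UNIV B \<Longrightarrow> continuous_on UNIV (\<lambda>p. hdiv_lin p (blinfun_apply (B p)))"
  unfolding hdiv_lin_def by (intro continuous_intros)

section \<open>Derivative and divergence of the kernel\<close>

definition fs_d_deriv :: "real \<Rightarrow> 'n::finite heis \<Rightarrow> 'n heis \<Rightarrow> real" where
  "fs_d_deriv \<epsilon> p v = 4 * fs_a \<epsilon> p * (fst p \<bullet> fst v + fst (snd p) \<bullet> fst (snd v)) + 2 * heis_z p * heis_z v"

lemma fs_a_has_derivative:
  "(fs_a \<epsilon> has_derivative (\<lambda>v. 2 * (fst p \<bullet> fst v + fst (snd p) \<bullet> fst (snd v)))) (at p)"
  unfolding fs_a_def by (auto intro!: derivative_eq_intros simp: inner_commute)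

lemma fs_d_has_derivative: "(fs_d \<epsilon> has_derivative fs_d_deriv \<epsilon> p) (at p)"
  unfolding fs_d_def fs_d_deriv_def
  by (auto intro!: derivative_eq_intros fs_a_has_derivative)

text \<open>A quarter of the horizontal gradient of \<open>fs_d \<epsilon>\<close>, as
  \<open>fs_d_deriv_X_vec\<close> and \<open>fs_d_deriv_Y_vec\<close> show.\<close>

definition fs_vec :: "real \<Rightarrow> 'n::finite heis \<Rightarrow> (real^'n) \<times> (real^'n)" where
  "fs_vec \<epsilon> p = (fs_a \<epsilon> p *\<^sub>R fst p + heis_z p *\<^sub>R fst (snd p), fs_a \<epsilon> p *\<^sub>R fst (snd p) - heis_z p *\<^sub>R fst p)"

definition fs_vec_deriv :: "real \<Rightarrow> 'n::finite heis \<Rightarrow> 'n heis \<Rightarrow> (real^'n) \<times> (real^'n)" where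
  "fs_vec_deriv \<epsilon> p v = (let a' = 2 * (fst p \<bullet> fst v + fst (snd p) \<bullet> fst (snd v)) in
     (a' *\<^sub>R fst p + fs_a \<epsilon> p *\<^sub>R fst v + heis_z v *\<^sub>R fst (snd p) + heis_z p *\<^sub>R fst (snd v),
      a' *\<^sub>R fst (snd p) + fs_a \<epsilon> p *\<^sub>R fst (snd v) - heis_z v *\<^sub>R fst p - heis_z p *\<^sub>R fst v))"

lemma fs_vec_has_derivative: "(fs_vec \<epsilon> has_derivative fs_vec_deriv \<epsilon> p) (at p)"
  unfolding fs_vec_def fs_vec_deriv_def Let_def
  by (auto intro!: derivative_eq_intros fs_a_has_derivative simp: algebra_simps)

definition fs_kernel_deriv :: "real \<Rightarrow> 'n::finite heis \<Rightarrow> 'n heis \<Rightarrow> (real^'n) \<times> (real^'n)" where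
  "fs_kernel_deriv \<epsilon> p v = (let c = - (real CARD('n) / 2 + 1) in
     (c * fs_d \<epsilon> p powr (c - 1) * fs_d_deriv \<epsilon> p v) *\<^sub>R fs_vec \<epsilon> p + fs_d \<epsilon> p powr c *\<^sub>R fs_vec_deriv \<epsilon> p v)"

lemma fs_kernel_has_derivative:
  fixes p :: "'n::finite heis"
  assumes \<epsilon>: "\<epsilon> > 0"
  shows "(fs_kernel \<epsilon> has_derivative fs_kernel_deriv \<epsilon> p) (at p)"
proof -
  let ?c = "- (real CARD('n) / 2 + 1)"
  have "((\<lambda>p. fs_d \<epsilon> p powr ?c) has_derivative (\<lambda>v. fs_d_deriv \<epsilon> p v * (?c * fs_d \<epsilon> p powr (?c - 1)))) (at p)"
    by (rule DERIV_compose_FDERIV[OF has_real_derivative_powr[OF fs_d_pos[OF \<epsilon>]] fs_d_has_derivative])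
  from has_derivative_scaleR[OF this fs_vec_has_derivative]
  have "((\<lambda>p. fs_d \<epsilon> p powr ?c *\<^sub>R fs_vec \<epsilon> p) has_derivative fs_kernel_deriv \<epsilon> p) (at p)"
    by (rule has_derivative_eq_rhs) (simp add: fs_kernel_deriv_def Let_def fun_eq_iff mult_ac add.commute)
  then show ?thesis
    by (simp only: fs_kernel_def[abs_def] fs_vec_def)
qed

lemma continuous_on_fs_kernel_deriv [continuous_intros]:
  assumes "\<epsilon> > 0" "continuous_on S f" "continuous_on S g"
  shows "continuous_on S (\<lambda>x. fs_kernel_deriv \<epsilon> (f x) (g x))"
  unfolding fs_kernel_deriv_def fs_vec_deriv_def fs_d_deriv_def fs_vec_def Let_def
  using assms by (intro continuous_intros)

lemma inner_axis_heis: "x \<bullet> axis j (1::real) = x $ j"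
  by (simp add: inner_axis)

lemma fs_d_deriv_X_vec: "fs_d_deriv \<epsilon> p (X_vec j p) = 4 * fst (fs_vec \<epsilon> p) $ j"
  by (simp add: fs_d_deriv_def X_vec_def fs_vec_def inner_axis_heis algebra_simps)

lemma fs_d_deriv_Y_vec: "fs_d_deriv \<epsilon> p (Y_vec j p) = 4 * snd (fs_vec \<epsilon> p) $ j"
  by (simp add: fs_d_deriv_def Y_vec_def fs_vec_def inner_axis_heis algebra_simps)

lemma inner_prod_vec_eq_sum:
  fixes u v :: "(real^'n::finite) \<times> (real^'n)"
  shows "u \<bullet> v = (\<Sum>j\<in>UNIV. fst u $ j * fst v $ j + snd u $ j * snd v $ j)"
  by (cases u, cases v) (simp add: inner_vec_def sum.distrib)

text \<open>In complex notation \<open>fs_vec\<close> is (a - i z) times x + i y, and |a - i z|^2 =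
  d. The identity serves the divergence of the kernel for \<epsilon> > 0 and, at \<epsilon> = 0, the
  gradient of the cutoff.\<close>

lemma fs_vec_inner: "fs_vec \<epsilon> p \<bullet> fs_vec \<epsilon> p = fs_d \<epsilon> p * (norm (heis_horiz p))\<^sup>2"
proof -
  obtain x y z where p: "p = (x, y, z)" by (metis prod_cases3)
  have "(a *\<^sub>R x + z *\<^sub>R y) \<bullet> (a *\<^sub>R x + z *\<^sub>R y) + (a *\<^sub>R y - z *\<^sub>R x) \<bullet> (a *\<^sub>R y - z *\<^sub>R x)
      = (a\<^sup>2 + z\<^sup>2) * (x \<bullet> x + y \<bullet> y)" for a :: real
    by (simp add: inner_add_left inner_add_right inner_diff inner_commute)
       (simp add: power2_eq_square algebra_simps)
  then show ?thesis
    by (simp add: fs_vec_def fs_d_def p power2_norm_eq_inner)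
qed

text \<open>The exponent c = -(n/2 + 1) is the one for which the terms in r = |\<zeta>|^2 cancel: 4
  c r + 2 n (r + \<epsilon>^2) + 4 r = 2 n \<epsilon>^2. In the singular case this is harmonicity of
  Folland's solution off the origin; the regularisation spreads the point mass into a positive
  density.\<close>

lemma hdiv_lin_fs_kernel:
  fixes p :: "'n::finite heis"
  assumes \<epsilon>: "\<epsilon> > 0"
  shows "hdiv_lin p (fs_kernel_deriv \<epsilon> p) = 2 * real CARD('n) * \<epsilon>\<^sup>2 * fs_d \<epsilon> p powr (- (real CARD('n) / 2 + 1))"
proof -
  let ?c = "- (real CARD('n) / 2 + 1)" and ?d = "fs_d \<epsilon> p" and ?W = "fs_vec \<epsilon> p"
  let ?a = "fs_a \<epsilon> p" and ?r = "(norm (heis_horiz p))\<^sup>2"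
  have d: "?d > 0" by (rule fs_d_pos[OF \<epsilon>])
  obtain x y z where p: "p = (x, y, z)" by (metis prod_cases3)
  have r: "?r = x \<bullet> x + y \<bullet> y" by (simp add: p power2_norm_eq_inner)
  have V: "(\<Sum>j\<in>UNIV. fst (fs_vec_deriv \<epsilon> p (X_vec j p)) $ j + snd (fs_vec_deriv \<epsilon> p (Y_vec j p)) $ j)
      = 2 * real CARD('n) * ?a + 4 * ?r"
  proof -
    have "fst (fs_vec_deriv \<epsilon> p (X_vec j p)) $ j + snd (fs_vec_deriv \<epsilon> p (Y_vec j p)) $ j
      = 2 * ?a + 4 * (x $ j * x $ j + y $ j * y $ j)" for j
      by (simp add: fs_vec_deriv_def Let_def p X_vec_def Y_vec_def inner_axis_heis algebra_simps)
    then show ?thesis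
      by (simp add: r inner_vec_def sum.distrib sum_distrib_left)
  qed
  have "hdiv_lin p (fs_kernel_deriv \<epsilon> p)
     = (\<Sum>j\<in>UNIV. 4 * ?c * ?d powr (?c - 1) * (fst ?W $ j * fst ?W $ j + snd ?W $ j * snd ?W $ j)
        + ?d powr ?c * (fst (fs_vec_deriv \<epsilon> p (X_vec j p)) $ j + snd (fs_vec_deriv \<epsilon> p (Y_vec j p)) $ j))"
    unfolding hdiv_lin_def fs_kernel_deriv_def Let_def fs_d_deriv_X_vec fs_d_deriv_Y_vec
    by (intro sum.cong refl) (simp add: algebra_simps)
  also have "\<dots> = 4 * ?c * ?d powr (?c - 1) * (?d * ?r) + ?d powr ?c * (2 * real CARD('n) * ?a + 4 * ?r)"
    unfolding sum.distrib[of _ "\<lambda>j. ?d powr ?c * _ j"] sum_distrib_left[symmetric] V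
      inner_prod_vec_eq_sum[symmetric] fs_vec_inner ..
  also have "\<dots> = 4 * ?c * (?d powr (?c - 1) * ?d powr 1) * ?r + ?d powr ?c * (2 * real CARD('n) * ?a + 4 * ?r)"
    using d by (simp only: powr_one_gt_zero_iff[THEN iffD2] mult.assoc)
  also have "?d powr (?c - 1) * ?d powr 1 = ?d powr ?c"
    unfolding powr_add[symmetric] diff_add_cancel ..
  also have "4 * ?c * ?d powr ?c * ?r + ?d powr ?c * (2 * real CARD('n) * ?a + 4 * ?r)
     = (4 * ?c * ?r + (2 * real CARD('n) * ?a + 4 * ?r)) * ?d powr ?c"
  proof -
    have "4 * c * P * r + P * k = (4 * c * r + k) * P" for c P r k :: real
      by (simp add: algebra_simps)
    then show ?thesis .
  qed
  also have "4 * ?c * ?r + (2 * real CARD('n) * ?a + 4 * ?r) = 2 * real CARD('n) * \<epsilon>\<^sup>2"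
    by (simp add: fs_a_eq algebra_simps)
  finally show ?thesis .
qed

section \<open>Left invariance and convolution with the kernel\<close>

definition heis_diff_lin :: "'n::finite heis \<Rightarrow> 'n heis \<Rightarrow> 'n heis" where
  "heis_diff_lin p v = (fst v, fst (snd v), heis_z v + 2 * (fst p \<bullet> fst (snd v) - fst (snd p) \<bullet> fst v))"

lemma heis_diff_has_derivative: "(heis_diff p has_derivative heis_diff_lin p) (at q)"
  unfolding heis_diff_def heis_diff_lin_def
  by (auto intro!: derivative_eq_intros simp: algebra_simps)

text \<open>With its counterpart for \<open>Y_vec\<close> this is left invariance in infinitesimal
  form. It lets the divergence in q act directly on the kernel inside the convolution.\<close>

lemma heis_diff_lin_X_vec: "heis_diff_lin p (X_vec j q) = X_vec j (heis_diff p q)"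
  by (simp add: heis_diff_lin_def X_vec_def heis_diff_def inner_axis_heis)

lemma heis_diff_lin_Y_vec: "heis_diff_lin p (Y_vec j q) = Y_vec j (heis_diff p q)"
  by (simp add: heis_diff_lin_def Y_vec_def heis_diff_def inner_axis_heis)

text \<open>The constant \<open>C_const\<close> makes the divergence of this field the convolution of \<open>f\<close> with an
  approximate identity.\<close>

definition test_field :: "real \<Rightarrow> ('n::finite heis \<Rightarrow> real) \<Rightarrow> 'n heis \<Rightarrow> 'n heis \<Rightarrow> 'n heis \<Rightarrow> (real^'n) \<times> (real^'n)" where
  "test_field \<epsilon> f a b q = C_const CARD('n) *\<^sub>R integral (cbox a b) (\<lambda>p. f p *\<^sub>R fs_kernel \<epsilon> (heis_diff p q))"

text \<open>Over a compact box, differentiation under the integral requires only a derivative of the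
  integrand that is jointly continuous, which \<epsilon> > 0 provides by removing the singularity.
  The divergence functional then passes through the integral.\<close>

lemma test_field_C1:
  fixes f :: "'n::finite heis \<Rightarrow> real"
  assumes \<epsilon>: "\<epsilon> > 0" and f: "continuous_on UNIV f"
  obtains B where "\<And>q. (test_field \<epsilon> f a b has_derivative blinfun_apply (B q)) (at q)"
    "continuous_on UNIV B"
    "\<And>q. hdiv_lin q (blinfun_apply (B q)) = C_const CARD('n) * (2 * real CARD('n) * \<epsilon>\<^sup>2) *
        integral (cbox a b) (\<lambda>p. f p * fs_d \<epsilon> (heis_diff p q) powr (- (real CARD('n) / 2 + 1)))"
proof -
  define g where "g q p = f p *\<^sub>R fs_kernel \<epsilon> (heis_diff p q)" for q p
  define g' where "g' q p v = f p *\<^sub>R fs_kernel_deriv \<epsilon> (heis_diff p q) (heis_diff_lin p v)" for q p v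
  define G where "G q p = Blinfun (g' q p)" for q p
  have d: "(heis_diff p has_derivative heis_diff_lin p) (at q)" for p q :: "'n heis"
    by (rule heis_diff_has_derivative)
  have gd: "((\<lambda>q. g q p) has_derivative g' q p) (at q)" for p q
    unfolding g_def g'_def
    by (intro has_derivative_scaleR_right has_derivative_compose[OF d fs_kernel_has_derivative[OF \<epsilon>]])
  have Gg: "blinfun_apply (G q p) = g' q p" for q p
    unfolding G_def by (rule bounded_linear_Blinfun_apply[OF has_derivative_bounded_linear[OF gd]])
  have fc: "continuous_on S (\<lambda>x. f (h x))" if "continuous_on S h" for S :: "('n heis \<times> 'n heis) set" and h
    by (rule continuous_on_compose2[OF f that]) simp
  have lc: "continuous_on S (\<lambda>x. heis_diff_lin (h x) v)" if "continuous_on S h" for S :: "('n heis \<times> 'n heis) set" and h v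
    unfolding heis_diff_lin_def using that by (intro continuous_intros)
  \<comment> \<open>In finite dimension, continuity of the map of operators is checked on each fixed
    vector.\<close>
  have Gc: "continuous_on S (\<lambda>(q, p). G q p)" for S
    unfolding split_beta
    by (rule continuous_on_blinfun_componentwise)
       (unfold Gg g'_def, intro continuous_intros fc lc \<epsilon>)
  have gi: "g q integrable_on cbox a b" for q
  proof (rule integrable_continuous)
    show "continuous_on (cbox a b) (g q)"
      unfolding g_def using continuous_on_subset[OF f] \<epsilon> by (intro continuous_intros) auto
  qed
  define B where "B q = C_const CARD('n) *\<^sub>R integral (cbox a b) (G q)" for q
  have Gi: "G q integrable_on cbox a b" for q
  proof (rule integrable_continuous)
    have "continuous_on (cbox a b) ((\<lambda>(q, p). G q p) \<circ> Pair q)"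
      by (intro continuous_on_compose Gc continuous_intros)
    then show "continuous_on (cbox a b) (G q)" by (simp add: o_def)
  qed
  show ?thesis
  proof
    fix q
    have "((\<lambda>q. integral (cbox a b) (g q)) has_derivative integral (cbox a b) (G q)) (at q within UNIV)"
      using gd by (intro leibniz_rule gi Gc) (simp_all add: Gg)
    from has_derivative_scaleR_right[OF this, of "C_const CARD('n)"]
    show "(test_field \<epsilon> f a b has_derivative blinfun_apply (B q)) (at q)"
      unfolding test_field_def[abs_def] B_def g_def[symmetric]
      by (rule has_derivative_eq_rhs) (simp add: blinfun.scaleR_left fun_eq_iff)
    show "continuous_on UNIV B"
      unfolding B_def by (intro continuous_intros integral_continuous_on_param Gc)
    have "hdiv_lin q (blinfun_apply (B q)) = C_const CARD('n) * hdiv_lin q (blinfun_apply (integral (cbox a b) (G q)))"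
      unfolding B_def using linear_scale[OF bounded_linear.linear[OF bounded_linear_hdiv_lin[of q]]] by simp
    also have "hdiv_lin q (blinfun_apply (integral (cbox a b) (G q)))
       = integral (cbox a b) ((\<lambda>L. hdiv_lin q (blinfun_apply L)) \<circ> G q)"
      by (rule integral_linear[OF Gi bounded_linear_hdiv_lin, symmetric])
    also have "(\<lambda>L. hdiv_lin q (blinfun_apply L)) \<circ> G q
       = (\<lambda>p. 2 * real CARD('n) * \<epsilon>\<^sup>2 * (f p * fs_d \<epsilon> (heis_diff p q) powr (- (real CARD('n) / 2 + 1))))"
    proof
      fix p
      have "hdiv_lin q (g' q p) = f p * hdiv_lin (heis_diff p q) (fs_kernel_deriv \<epsilon> (heis_diff p q))"
        unfolding hdiv_lin_def g'_def heis_diff_lin_X_vec heis_diff_lin_Y_vec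
        by (simp add: sum_distrib_left distrib_left)
      then show "((\<lambda>L. hdiv_lin q (blinfun_apply L)) \<circ> G q) p
        = 2 * real CARD('n) * \<epsilon>\<^sup>2 * (f p * fs_d \<epsilon> (heis_diff p q) powr (- (real CARD('n) / 2 + 1)))"
        by (simp only: o_def Gg hdiv_lin_fs_kernel[OF \<epsilon>] mult_ac)
    qed
    also have "integral (cbox a b) \<dots> = 2 * real CARD('n) * \<epsilon>\<^sup>2 *
        integral (cbox a b) (\<lambda>p. f p * fs_d \<epsilon> (heis_diff p q) powr (- (real CARD('n) / 2 + 1)))"
      by (rule integral_mult_right)
    finally show "hdiv_lin q (blinfun_apply (B q)) = C_const CARD('n) * (2 * real CARD('n) * \<epsilon>\<^sup>2) *
        integral (cbox a b) (\<lambda>p. f p * fs_d \<epsilon> (heis_diff p q) powr (- (real CARD('n) / 2 + 1)))"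
      by (simp only: mult.assoc)
  qed
qed

text \<open>On functions supported in a box the Henstock-Kurzweil integral over the box, needed for
  the Leibniz rule, is the Lebesgue integral.\<close>

lemma integral_cbox_eq_lborel:
  fixes g :: "'a::euclidean_space \<Rightarrow> real"
  assumes g: "continuous_on UNIV g" and supp: "\<And>x. x \<notin> cbox a b \<Longrightarrow> g x = 0"
  shows "integrable lborel g" "integral (cbox a b) g = (\<integral>x. g x \<partial>lborel)"
proof -
  have eq: "(\<lambda>x. indicator (cbox a b) x *\<^sub>R g x) = g"
    using supp by (auto simp: indicator_def fun_eq_iff)
  have "set_integrable lborel (cbox a b) g"
    unfolding set_integrable_def
    using g by (intro borel_integrable_compact compact_cbox continuous_on_subset[OF g]) auto
  from set_borel_integral_eq_integral(2)[OF this] this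
  show "integrable lborel g" "integral (cbox a b) g = (\<integral>x. g x \<partial>lborel)"
    by (simp_all only: set_integrable_def set_lebesgue_integral_def eq)
qed

text \<open>A vector attains its norm against the unit vector \<open>e\<close> in its own direction,
  so the scalar bathtub bound applies. That bound is the same for all \<open>e\<close>, and
  therefore \<open>e\<close> may depend on \<open>q\<close>.\<close>

lemma norm_test_field_le:
  fixes f :: "'n::finite heis \<Rightarrow> real"
  assumes \<epsilon>: "\<epsilon> > 0" and f: "continuous_on UNIV f" "\<And>p. 0 \<le> f p" "\<And>p. f p \<le> 1"
    and supp: "\<And>p. p \<notin> cbox a b \<Longrightarrow> f p = 0"
    and v: "v = (\<integral>p. f p \<partial>lborel)" "v > 0"
  shows "norm (test_field \<epsilon> f a b q) \<le> C_const CARD('n) * C'_const CARD('n) * v powr (1 / hom_dim CARD('n))"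
proof (cases "test_field \<epsilon> f a b q = 0")
  case True
  then show ?thesis using C_const_pos[of "CARD('n)"] C'_const_pos[of "CARD('n)"] by simp
next
  case False
  let ?F = "test_field \<epsilon> f a b q" and ?C = "C_const CARD('n)"
  define e where "e = ?F /\<^sub>R norm ?F"
  have e: "norm e = 1" using False by (simp add: e_def)
  let ?g = "\<lambda>p. f p * (e \<bullet> fs_kernel \<epsilon> (heis_diff p q))"
  have gc: "continuous_on UNIV ?g" using f \<epsilon> by (intro continuous_intros)
  have g0: "?g p = 0" if "p \<notin> cbox a b" for p using supp[OF that] by simp
  have Gi: "(\<lambda>p. f p *\<^sub>R fs_kernel \<epsilon> (heis_diff p q)) integrable_on cbox a b"
    using continuous_on_subset[OF f(1)] \<epsilon> by (intro integrable_continuous continuous_intros) auto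
  have "norm ?F = e \<bullet> ?F"
    using False by (simp add: e_def dot_square_norm power2_eq_square)
  also have "\<dots> = ?C * integral (cbox a b) ((\<lambda>u. e \<bullet> u) \<circ> (\<lambda>p. f p *\<^sub>R fs_kernel \<epsilon> (heis_diff p q)))"
    unfolding test_field_def integral_linear[OF Gi bounded_linear_inner_right] by simp
  also have "(\<lambda>u. e \<bullet> u) \<circ> (\<lambda>p. f p *\<^sub>R fs_kernel \<epsilon> (heis_diff p q)) = ?g"
    by (simp add: o_def)
  also have "integral (cbox a b) ?g = (\<integral>p. ?g p \<partial>lborel)"
    by (rule integral_cbox_eq_lborel(2)[OF gc g0])
  also have "\<dots> \<le> C'_const CARD('n) * v powr (1 / hom_dim CARD('n))"
    using f v integral_cbox_eq_lborel(1)[OF gc g0] integral_cbox_eq_lborel(1)[OF f(1) supp]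
    by (intro integral_fs_kernel_le \<epsilon> e)
  finally show ?thesis
    using C_const_pos[of "CARD('n)"] by (simp add: mult_left_mono mult.assoc)
qed

section \<open>Cutoff\<close>

text \<open>\<open>fs_d 0\<close> is the fourth power of the homogeneous norm. The square of the
  positive part is a C^1 function that needs no smooth bump.\<close>

definition cutoff :: "real \<Rightarrow> 'n::finite heis \<Rightarrow> real" where
  "cutoff R p = (max 0 (1 - fs_d 0 p / R ^ 4))\<^sup>2"

definition cutoff_deriv :: "real \<Rightarrow> 'n::finite heis \<Rightarrow> 'n heis \<Rightarrow> real" where
  "cutoff_deriv R p v = - (fs_d_deriv 0 p v / R ^ 4) * (2 * max 0 (1 - fs_d 0 p / R ^ 4))"

lemma DERIV_max_0_square: "DERIV (\<lambda>t::real. (max 0 t)\<^sup>2) t :> 2 * max 0 t"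
proof (cases t "0 :: real" rule: linorder_cases)
  case less
  have "DERIV (\<lambda>t::real. 0) t :> 2 * max 0 t" using less by simp
  then show ?thesis
    by (rule has_field_derivative_transform_within_open[where S="{..<0}"]) (use less in auto)
next
  case equal
  have "(\<lambda>h::real. (max 0 h)\<^sup>2 / h) = max 0"
    by (auto simp: fun_eq_iff max_def power2_eq_square)
  moreover have "(max 0 \<longlongrightarrow> max 0 (0::real)) (at 0)"
    by (intro tendsto_intros)
  ultimately show ?thesis using equal by (simp add: DERIV_def)
next
  case greater
  have "DERIV (\<lambda>t::real. t\<^sup>2) t :> 2 * max 0 t"
    using greater by (auto intro!: derivative_eq_intros)
  then show ?thesis
    by (rule has_field_derivative_transform_within_open[where S="{0<..}"]) (use greater in auto)
qed

lemma cutoff_has_derivative: "(cutoff R has_derivative cutoff_deriv R p) (at p)"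
proof -
  have "((\<lambda>p. 1 - fs_d 0 p / R ^ 4) has_derivative (\<lambda>v. - (fs_d_deriv 0 p v / R ^ 4))) (at p)"
    by (auto intro!: derivative_eq_intros fs_d_has_derivative simp: divide_inverse)
  from DERIV_compose_FDERIV[OF DERIV_max_0_square this]
  show ?thesis unfolding cutoff_def[abs_def] cutoff_deriv_def[abs_def] .
qed

lemma continuous_on_cutoff [continuous_intros]:
  "continuous_on S f \<Longrightarrow> continuous_on S (\<lambda>x. cutoff R (f x))"
  unfolding cutoff_def divide_inverse by (intro continuous_intros)

lemma fs_d_0_nonneg: "0 \<le> fs_d 0 p"
  by (simp add: fs_d_def)

lemma cutoff_nonneg: "0 \<le> cutoff R p"
  by (simp add: cutoff_def)

lemma cutoff_le_1: "R > 0 \<Longrightarrow> cutoff R p \<le> 1"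
  unfolding cutoff_def using fs_d_0_nonneg[of p] by (intro power_le_one) auto

lemma cutoff_tendsto_1: "(\<lambda>k. cutoff (real (Suc k)) p) \<longlonglongrightarrow> 1"
proof -
  have "(\<lambda>k. (max 0 (1 - fs_d 0 p * inverse (real (Suc k)) ^ 4))\<^sup>2) \<longlonglongrightarrow> (max 0 (1 - fs_d 0 p * 0 ^ 4))\<^sup>2"
    by (intro tendsto_intros LIMSEQ_inverse_real_of_nat)
  then show ?thesis
    by (simp add: cutoff_def divide_inverse power_inverse)
qed

lemma norm_heis_horiz_power4_le: "norm (heis_horiz p) ^ 4 \<le> fs_d 0 p"
  by (simp add: fs_d_def fs_a_eq)

lemma bounded_cutoff_support:
  assumes R: "R > 0"
  shows "bounded {p :: 'n::finite heis. cutoff R p \<noteq> 0}"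
proof (rule boundedI)
  fix p :: "'n heis" assume "p \<in> {p. cutoff R p \<noteq> 0}"
  then have "fs_d 0 p / R ^ 4 < 1"
    by (intro not_le_imp_less notI) (auto simp: cutoff_def)
  then have d: "fs_d 0 p < R ^ 4" using R by (simp add: field_simps)
  have "norm (heis_horiz p) ^ 4 \<le> R ^ 4" using norm_heis_horiz_power4_le[of p] d by linarith
  then have 1: "norm (heis_horiz p) \<le> R" using R by (subst (asm) power_mono_iff) auto
  have "(heis_z p)\<^sup>2 \<le> fs_d 0 p" by (simp add: fs_d_def)
  then have "\<bar>heis_z p\<bar>\<^sup>2 \<le> (R\<^sup>2)\<^sup>2" using d by simp
  then have 2: "\<bar>heis_z p\<bar> \<le> R\<^sup>2" by (rule power2_le_imp_le) simp
  have "norm p = norm (heis_horiz p, heis_z p)"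
    by (cases p) (simp add: norm_Pair)
  also have "\<dots> \<le> norm (heis_horiz p) + norm (heis_z p)"
    by (rule norm_Pair_le)
  finally show "norm p \<le> R + R\<^sup>2" using 1 2 by simp
qed

text \<open>The cutoff is built from the homogeneous norm so that its horizontal gradient is of order
  \<open>1 / R\<close>; bounded divergence and finite volume then suffice, no decay of the field is needed.\<close>

lemma horizontal_perimeter_ge_bounded_field:
  fixes F :: "'n::finite heis \<Rightarrow> (real^'n) \<times> (real^'n)" and E :: "'n heis set"
  assumes F: "\<And>q. (F has_derivative blinfun_apply (B q)) (at q)" and B: "continuous_on UNIV B"
    and M: "M > 0" "\<And>q. norm (F q) \<le> M" and K: "\<And>q. \<bar>hdiv_lin q (blinfun_apply (B q))\<bar> \<le> K"
    and E: "E \<in> lmeasurable"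
  shows "ereal ((LINT p:E|lebesgue. hdiv_lin p (blinfun_apply (B p))) / M) \<le> horizontal_perimeter E"
proof -
  define D where "D p = hdiv_lin p (blinfun_apply (B p))" for p
  define R where "R k = real (Suc k)" for k
  have R: "R k > 0" for k by (simp add: R_def)
  define \<phi> where "\<phi> k q = (cutoff (R k) q / M) *\<^sub>R F q" for k q
  define L where "L k q v = (cutoff (R k) q / M) *\<^sub>R blinfun_apply (B q) v + (cutoff_deriv (R k) q v / M) *\<^sub>R F q" for k q v
  have Fc: "continuous_on UNIV F"
    using F by (auto intro!: continuous_at_imp_continuous_on has_derivative_continuous)
  have d: "(\<phi> k has_derivative L k q) (at q)" for k q
  proof -
    have "((\<lambda>q. cutoff (R k) q / M) has_derivative (\<lambda>v. cutoff_deriv (R k) q v / M)) (at q)"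
      unfolding divide_inverse by (rule has_derivative_mult_left[OF cutoff_has_derivative])
    from has_derivative_scaleR[OF this F[of q]] show ?thesis
      unfolding \<phi>_def[abs_def] L_def[abs_def] .
  qed
  \<comment> \<open>Product rule. The horizontal gradient of the cutoff is a multiple of
    \<open>fs_vec 0\<close>; the factor 8 is 2 from the square times 4 from
    \<open>fs_d_deriv_X_vec\<close>.\<close>
  have hL: "horizontal_div (\<phi> k) q = (cutoff (R k) q * D q
      - 8 * max 0 (1 - fs_d 0 q / R k ^ 4) / R k ^ 4 * (fs_vec 0 q \<bullet> F q)) / M" for k q
  proof -
    let ?m = "- 8 * max 0 (1 - fs_d 0 q / R k ^ 4) / R k ^ 4"
    have "horizontal_div (\<phi> k) q = (\<Sum>j\<in>UNIV. cutoff (R k) q / M *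
          (fst (blinfun_apply (B q) (X_vec j q)) $ j + snd (blinfun_apply (B q) (Y_vec j q)) $ j)
        + ?m / M * (fst (fs_vec 0 q) $ j * fst (F q) $ j + snd (fs_vec 0 q) $ j * snd (F q) $ j))"
      unfolding horizontal_div_eq[OF d] hdiv_lin_def L_def cutoff_deriv_def fs_d_deriv_X_vec fs_d_deriv_Y_vec
      by (intro sum.cong refl) (simp add: algebra_simps add_divide_distrib)
    also have "\<dots> = cutoff (R k) q / M * D q + ?m / M * (fs_vec 0 q \<bullet> F q)"
      unfolding sum.distrib[of "\<lambda>j. cutoff (R k) q / M * _ j"] sum_distrib_left[symmetric]
        inner_prod_vec_eq_sum[symmetric] D_def hdiv_lin_def ..
    finally show ?thesis using M by (simp add: field_simps)
  qed
  have err: "\<bar>8 * max 0 (1 - fs_d 0 q / R k ^ 4) / R k ^ 4 * (fs_vec 0 q \<bullet> F q)\<bar> \<le> 8 * M / R k" for k q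
  proof -
    let ?m = "max 0 (1 - fs_d 0 q / R k ^ 4)"
    have m01: "0 \<le> ?m" "?m \<le> 1" using R[of k] fs_d_0_nonneg[of q] by auto
    \<comment> \<open>Where the cutoff is nonzero, d < R^4 and |\<zeta>| <= R, so
      \<open>fs_vec_inner\<close> gives |fs_vec| <= R^3. Against the denominator R^4 this leaves the
      order 1 / R.\<close>
    have mW: "?m * norm (fs_vec 0 q) \<le> R k ^ 3"
    proof (cases "fs_d 0 q < R k ^ 4")
      case True
      have "norm (heis_horiz q) ^ 4 \<le> R k ^ 4" using norm_heis_horiz_power4_le[of q] True by linarith
      then have "norm (heis_horiz q) \<le> R k" using R[of k] by (subst (asm) power_mono_iff) auto
      then have r: "(norm (heis_horiz q))\<^sup>2 \<le> (R k)\<^sup>2" by (intro power_mono) auto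
      have "fs_d 0 q * (norm (heis_horiz q))\<^sup>2 \<le> R k ^ 4 * (R k)\<^sup>2"
        using True fs_d_0_nonneg[of q] R[of k] r by (intro mult_mono) auto
      also have "R k ^ 4 * (R k)\<^sup>2 = (R k ^ 3)\<^sup>2"
        unfolding power_mult[symmetric] power_add[symmetric] by simp
      finally have "(norm (fs_vec 0 q))\<^sup>2 \<le> (R k ^ 3)\<^sup>2"
        by (simp only: power2_norm_eq_inner[of "fs_vec 0 q"] fs_vec_inner)
      then have "norm (fs_vec 0 q) \<le> R k ^ 3"
        by (rule power2_le_imp_le) (use R[of k] in simp)
      then have "?m * norm (fs_vec 0 q) \<le> 1 * R k ^ 3"
        using m01 by (intro mult_mono) auto
      then show ?thesis by simp
    next
      case False
      then have "1 \<le> fs_d 0 q / R k ^ 4" using R[of k] by (simp add: field_simps)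
      then show ?thesis using R[of k] by (simp add: max_def)
    qed
    have "\<bar>8 * ?m / R k ^ 4 * (fs_vec 0 q \<bullet> F q)\<bar> = 8 / R k ^ 4 * (?m * \<bar>fs_vec 0 q \<bullet> F q\<bar>)"
      using m01 R[of k] by (simp add: abs_mult)
    also have "\<dots> \<le> 8 / R k ^ 4 * (?m * (norm (fs_vec 0 q) * M))"
      using m01 R[of k] M(2)[of q]
      by (intro mult_left_mono order_trans[OF Cauchy_Schwarz_ineq2]) auto
    also have "\<dots> \<le> 8 / R k ^ 4 * (R k ^ 3 * M)"
      using mult_right_mono[OF mW, of M] M(1) R[of k] by (intro mult_left_mono) (auto simp: mult.assoc)
    also have "\<dots> = 8 * M / R k"
      using R[of k] by (simp add: power_numeral_reduce)
    finally show ?thesis .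
  qed
  have supp: "compact (closure {p. \<phi> k p \<noteq> 0})" for k
  proof -
    have "{p. \<phi> k p \<noteq> 0} \<subseteq> {p. cutoff (R k) p \<noteq> 0}" by (auto simp: \<phi>_def)
    then have "bounded {p. \<phi> k p \<noteq> 0}"
      using bounded_cutoff_support[OF R] bounded_subset by blast
    then show ?thesis by simp
  qed
  have C1: "C1_compact_support (\<phi> k)" for k
    unfolding C1_compact_support_def
  proof (intro conjI exI[of _ "\<lambda>q. Blinfun (L k q)"] allI supp)
    have bl: "blinfun_apply (Blinfun (L k q)) = L k q" for q
      by (rule bounded_linear_Blinfun_apply[OF has_derivative_bounded_linear[OF d]])
    show "(\<phi> k has_derivative blinfun_apply (Blinfun (L k q))) (at q)" for q
      unfolding bl by (rule d)
    show "continuous_on UNIV (\<lambda>q. Blinfun (L k q))"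
      by (rule continuous_on_blinfun_componentwise)
         (unfold bl L_def cutoff_deriv_def fs_d_deriv_def divide_inverse, intro continuous_intros B Fc)
  qed
  have n1: "norm (\<phi> k p) \<le> 1" for k p
  proof -
    have "norm (\<phi> k p) = cutoff (R k) p * norm (F p) / M"
      using M(1) by (simp add: \<phi>_def cutoff_nonneg)
    also have "\<dots> \<le> 1 * M / M"
      using M(1) M(2)[of p] cutoff_le_1[OF R[of k], of p] cutoff_nonneg[of "R k" p] by (intro divide_right_mono mult_mono) auto
    finally show ?thesis using M(1) by simp
  qed
  have le: "ereal (LINT p:E|lebesgue. horizontal_div (\<phi> k) p) \<le> horizontal_perimeter E" for k
    unfolding horizontal_perimeter_def using C1 n1 by (intro SUP_upper) auto
  have Dc: "continuous_on UNIV D" unfolding D_def by (rule continuous_on_hdiv_lin[OF B])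
  have E': "E \<in> sets lebesgue" using E by auto
  have "(\<lambda>k. LINT p:E|lebesgue. horizontal_div (\<phi> k) p) \<longlonglongrightarrow> (LINT p:E|lebesgue. D p / M)"
    unfolding set_lebesgue_integral_def
  \<comment> \<open>The error 8 M / R k is at most 8 M because \<open>R k = Suc k\<close> is at
    least 1, and a constant is an integrable majorant on a set of finite measure.\<close>
  proof (rule integral_dominated_convergence[where w="\<lambda>p. indicator E p *\<^sub>R ((K + 8 * M) / M)"])
    show "(\<lambda>p. indicator E p *\<^sub>R (D p / M)) \<in> borel_measurable lebesgue"
      using E' Dc by (intro borel_measurable_scaleR borel_measurable_indicator measurable_completion
         borel_measurable_divide) (auto intro: borel_measurable_continuous_onI)
    show "(\<lambda>p. indicator E p *\<^sub>R horizontal_div (\<phi> k) p) \<in> borel_measurable lebesgue" for k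
    proof -
      have "continuous_on UNIV (horizontal_div (\<phi> k))"
        unfolding hL[abs_def] fs_vec_def divide_inverse by (intro continuous_intros Dc Fc)
      then have "horizontal_div (\<phi> k) \<in> borel_measurable lebesgue"
        by (intro measurable_completion) (auto intro: borel_measurable_continuous_onI)
      then show ?thesis using E' by (intro borel_measurable_scaleR borel_measurable_indicator)
    qed
    show "integrable lebesgue (\<lambda>p. indicator E p *\<^sub>R ((K + 8 * M) / M))"
      using lmeasurable_iff_integrable[THEN iffD1, OF E] by (rule integrable_scaleR_left)
    show "AE p in lebesgue. (\<lambda>k. indicator E p *\<^sub>R horizontal_div (\<phi> k) p) \<longlonglongrightarrow> indicator E p *\<^sub>R (D p / M)"
    proof (rule AE_I2)
      fix p
      have "(\<lambda>k. 8 * max 0 (1 - fs_d 0 p / R k ^ 4) / R k ^ 4 * (fs_vec 0 p \<bullet> F p)) \<longlonglongrightarrow> 0"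
      proof (rule Lim_null_comparison)
        show "\<forall>\<^sub>F k in sequentially. norm (8 * max 0 (1 - fs_d 0 p / R k ^ 4) / R k ^ 4 * (fs_vec 0 p \<bullet> F p)) \<le> 8 * M * inverse (R k)"
          using err[of p] by (simp add: divide_inverse)
        have "(\<lambda>k. 8 * M * inverse (R k)) \<longlonglongrightarrow> 8 * M * 0"
          unfolding R_def by (intro tendsto_intros LIMSEQ_inverse_real_of_nat)
        then show "(\<lambda>k. 8 * M * inverse (R k)) \<longlonglongrightarrow> 0" by simp
      qed
      then have "(\<lambda>k. horizontal_div (\<phi> k) p) \<longlonglongrightarrow> (1 * D p - 0) / M"
        unfolding hL using M(1) cutoff_tendsto_1[of p] by (intro tendsto_intros) (auto simp: R_def)
      then show "(\<lambda>k. indicator E p *\<^sub>R horizontal_div (\<phi> k) p) \<longlonglongrightarrow> indicator E p *\<^sub>R (D p / M)"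
        by (intro tendsto_intros) simp
    qed
    show "AE p in lebesgue. norm (indicator E p *\<^sub>R horizontal_div (\<phi> k) p) \<le> indicator E p *\<^sub>R ((K + 8 * M) / M)" for k
    proof (rule AE_I2)
      fix p
      have "\<bar>cutoff (R k) p * D p\<bar> \<le> 1 * K"
        unfolding abs_mult using K[of p] cutoff_le_1[OF R[of k], of p] cutoff_nonneg[of "R k" p]
        by (intro mult_mono) (auto simp: D_def)
      moreover have "8 * M / R k \<le> 8 * M"
        using M(1) by (simp add: R_def field_simps)
      ultimately have "\<bar>cutoff (R k) p * D p - 8 * max 0 (1 - fs_d 0 p / R k ^ 4) / R k ^ 4 * (fs_vec 0 p \<bullet> F p)\<bar> \<le> K + 8 * M"
        using err[where q=p and k=k] by linarith
      then have "\<bar>horizontal_div (\<phi> k) p\<bar> \<le> (K + 8 * M) / M"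
        unfolding hL using M(1) by (simp add: divide_right_mono)
      then show "norm (indicator E p *\<^sub>R horizontal_div (\<phi> k) p) \<le> indicator E p *\<^sub>R ((K + 8 * M) / M)"
        by (simp add: indicator_def)
    qed
  qed
  then have "(\<lambda>k. ereal (LINT p:E|lebesgue. horizontal_div (\<phi> k) p)) \<longlonglongrightarrow> ereal (LINT p:E|lebesgue. D p / M)"
    by simp
  then have "ereal (LINT p:E|lebesgue. D p / M) \<le> horizontal_perimeter E"
    by (rule LIMSEQ_le_const2) (use le in blast)
  then show ?thesis by (simp add: D_def)
qed

section \<open>Mollification\<close>

definition mollify :: "real \<Rightarrow> ('n::finite heis \<Rightarrow> real) \<Rightarrow> 'n heis \<Rightarrow> real" where
  "mollify \<epsilon> f q = C_const CARD('n) * (2 * real CARD('n) * \<epsilon>\<^sup>2) *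
     (\<integral>p. f p * fs_d \<epsilon> (heis_diff p q) powr (- (real CARD('n) / 2 + 1)) \<partial>lborel)"

lemma fs_d_dil: "fs_d \<epsilon> (heis_dil \<epsilon> p) = \<epsilon> ^ 4 * fs_d 1 p"
  by (simp add: fs_d_def fs_a_def heis_dil_def power2_eq_square power4_eq_xxxx algebra_simps)

text \<open>The substitution p = q (\<open>heis_dil \<epsilon> u\<close>)^(-1) moves \<epsilon> from
  the kernel into the argument of \<open>f\<close>. The Jacobian \<epsilon>^(2n+2), the prefactor
  \<epsilon>^2 and the factor \<epsilon>^(-2n-4) from the kernel cancel, so one fixed kernel serves
  as weight for every \<epsilon>.\<close>

lemma mollify_eq:
  fixes f :: "'n::finite heis \<Rightarrow> real"
  assumes \<epsilon>: "\<epsilon> > 0" and f: "continuous_on UNIV f" "\<And>p. 0 \<le> f p"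
  shows "mollify \<epsilon> f q = (\<integral>u. f (heis_shift q (heis_dil \<epsilon> u)) *
     (C_const CARD('n) * (2 * real CARD('n)) * fs_d 1 u powr (- (real CARD('n) / 2 + 1))) \<partial>lborel)"
proof -
  define n where "n = real CARD('n)"
  define c where "c = - (n / 2 + 1)"
  define k where "k = C_const CARD('n) * (2 * n * \<epsilon>\<^sup>2)"
  have k: "k \<ge> 0" using C_const_pos[of "CARD('n)"] by (simp add: k_def n_def)
  have fm[measurable]: "f \<in> borel_measurable borel" using f(1) by (rule borel_measurable_continuous_onI)
  have fs: "continuous_on UNIV (\<lambda>p. f (heis_shift q p))"
    by (rule continuous_on_compose2[OF f(1)]) (auto intro!: continuous_intros)
  have fsd: "continuous_on UNIV (\<lambda>p. f (heis_shift q (heis_dil \<epsilon> p)))"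
    by (rule continuous_on_compose2[OF f(1)]) (auto intro!: continuous_intros)
  define h where "h u = k * (f (heis_shift q u) * fs_d \<epsilon> u powr c)" for u
  have hc: "continuous_on UNIV h" unfolding h_def using \<epsilon> fs by (intro continuous_intros)
  then have hm[measurable]: "h \<in> borel_measurable borel" by (rule borel_measurable_continuous_onI)
  have h0: "0 \<le> h u" for u using k f(2) by (simp add: h_def)
  have "mollify \<epsilon> f q = (\<integral>p. k * (f p * fs_d \<epsilon> (heis_diff p q) powr c) \<partial>lborel)"
    by (simp add: mollify_def k_def n_def c_def)
  also have "\<dots> = (\<integral>p. h (heis_diff p q) \<partial>lborel)"
    by (simp add: h_def)
  also have "\<dots> = (\<integral>u. h u \<partial>lborel)"
    by (rule integral_heis_diff(2)[OF hm])
  also have "\<dots> = enn2real (\<integral>\<^sup>+u. ennreal (h u) \<partial>lborel)"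
    using h0 by (intro integral_eq_nn_integral) auto
  also have "(\<integral>\<^sup>+u. ennreal (h u) \<partial>lborel)
      = ennreal (\<epsilon> ^ (2 * CARD('n) + 2)) * (\<integral>\<^sup>+u. ennreal (h (heis_dil \<epsilon> u)) \<partial>lborel)"
    using \<epsilon> by (intro nn_integral_heis_dil) auto
  also have "\<dots> = (\<integral>\<^sup>+u. ennreal (\<epsilon> ^ (2 * CARD('n) + 2)) * ennreal (h (heis_dil \<epsilon> u)) \<partial>lborel)"
    by (rule nn_integral_cmult[symmetric]) measurable
  also have "\<dots> = (\<integral>\<^sup>+u. ennreal (f (heis_shift q (heis_dil \<epsilon> u)) * (C_const CARD('n) * (2 * n) * fs_d 1 u powr c)) \<partial>lborel)"
  proof (rule nn_integral_cong)
    fix u :: "'n heis"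
    have "\<epsilon> ^ (2 * CARD('n) + 2) = \<epsilon> powr (2 * n + 2)"
      using \<epsilon> powr_realpow[of \<epsilon> "2 * CARD('n) + 2"] by (simp add: n_def add.commute)
    moreover have "\<epsilon>\<^sup>2 = \<epsilon> powr 2" using \<epsilon> by simp
    moreover have "(\<epsilon> ^ 4 * fs_d 1 u) powr c = \<epsilon> powr (4 * c) * fs_d 1 u powr c"
      using \<epsilon> by (simp add: powr_mult powr_powr flip: powr_numeral)
    moreover have "\<epsilon> powr (2 * n + 2) * \<epsilon> powr 2 * \<epsilon> powr (4 * c) = 1"
      unfolding powr_add[symmetric] using \<epsilon> by (simp add: c_def)
    ultimately have *: "\<epsilon> ^ (2 * CARD('n) + 2) * \<epsilon>\<^sup>2 * (\<epsilon> ^ 4 * fs_d 1 u) powr c = fs_d 1 u powr c"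
      by (metis mult.assoc mult_1)
    have "\<epsilon> ^ (2 * CARD('n) + 2) * h (heis_dil \<epsilon> u)
      = f (heis_shift q (heis_dil \<epsilon> u)) * (C_const CARD('n) * (2 * n) * fs_d 1 u powr c)"
    proof -
      have "X * (C * (2 * n * Y) * (F * Z)) = F * (C * (2 * n) * (X * Y * Z))" for X Y Z C F :: real
        by (simp only: mult_ac)
      with * show ?thesis unfolding h_def fs_d_dil k_def by presburger
    qed
    then show "ennreal (\<epsilon> ^ (2 * CARD('n) + 2)) * ennreal (h (heis_dil \<epsilon> u))
      = ennreal (f (heis_shift q (heis_dil \<epsilon> u)) * (C_const CARD('n) * (2 * n) * fs_d 1 u powr c))"
      by (subst ennreal_mult''[OF h0, symmetric]) (rule arg_cong[where f=ennreal])
  qed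
  also have "enn2real \<dots> = (\<integral>u. f (heis_shift q (heis_dil \<epsilon> u)) * (C_const CARD('n) * (2 * n) * fs_d 1 u powr c) \<partial>lborel)"
  proof (rule integral_eq_nn_integral[symmetric])
    have "continuous_on UNIV (\<lambda>u. f (heis_shift q (heis_dil \<epsilon> u)) * (C_const CARD('n) * (2 * n) * fs_d 1 u powr c))"
      by (intro continuous_intros fsd) simp
    then show "(\<lambda>u. f (heis_shift q (heis_dil \<epsilon> u)) * (C_const CARD('n) * (2 * n) * fs_d 1 u powr c)) \<in> borel_measurable lborel"
      by (simp add: borel_measurable_continuous_onI)
    show "AE u in lborel. 0 \<le> f (heis_shift q (heis_dil \<epsilon> u)) * (C_const CARD('n) * (2 * n) * fs_d 1 u powr c)"
      using f(2) C_const_pos[of "CARD('n)"] by (intro AE_I2 mult_nonneg_nonneg) (auto simp: n_def)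
  qed
  finally show ?thesis by (simp add: n_def c_def)
qed

lemma mollifier_kernel:
  shows "integrable lborel (\<lambda>u :: 'n::finite heis. C_const CARD('n) * (2 * real CARD('n)) * fs_d 1 u powr (- (real CARD('n) / 2 + 1)))"
    and "(\<integral>u. C_const CARD('n) * (2 * real CARD('n)) * fs_d 1 (u :: 'n heis) powr (- (real CARD('n) / 2 + 1)) \<partial>lborel) = 1"
proof -
  let ?c = "C_const CARD('n) * (2 * real CARD('n))" and ?f = "\<lambda>u :: 'n heis. fs_d 1 u powr (- (real CARD('n) / 2 + 1))"
  have c: "?c > 0" using C_const_pos[of "CARD('n)"] by simp
  have m: "?f \<in> borel_measurable lborel"
    by (simp, intro borel_measurable_continuous_onI continuous_intros) simp
  have nn: "(\<integral>\<^sup>+u. ennreal (?f u) \<partial>lborel) = ennreal (1 / ?c)"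
    using nn_integral_fs_d[of 1, where 'n='n] by simp
  have i: "integrable lborel ?f"
  proof (rule integrableI_nonneg[OF m])
    show "(\<integral>\<^sup>+u. ennreal (?f u) \<partial>lborel) < \<infinity>" unfolding nn by simp
  qed simp
  then show "integrable lborel (\<lambda>u. ?c * ?f u)" by simp
  have "(\<integral>u. ?f u \<partial>lborel) = enn2real (ennreal (1 / ?c))"
    unfolding nn[symmetric] by (rule integral_eq_nn_integral[OF m]) simp
  also have "\<dots> = 1 / ?c" using c by simp
  finally have "(\<integral>u. ?f u \<partial>lborel) = 1 / ?c" .
  moreover have "C_const CARD('n) \<noteq> 0"
    using C_const_pos[of "CARD('n)"] by (metis less_irrefl zero_less_card_finite)
  ultimately show "(\<integral>u. ?c * ?f u \<partial>lborel) = 1" by simp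
qed

lemma mollify_nonneg_le_1_tendsto:
  fixes f :: "'n::finite heis \<Rightarrow> real"
  assumes f: "continuous_on UNIV f" "\<And>p. 0 \<le> f p" "\<And>p. f p \<le> 1"
  shows "\<epsilon> > 0 \<Longrightarrow> 0 \<le> mollify \<epsilon> f q" "\<epsilon> > 0 \<Longrightarrow> mollify \<epsilon> f q \<le> 1"
    and "(\<lambda>k. mollify (inverse (real (Suc k))) f q) \<longlonglongrightarrow> f q"
proof -
  define \<psi> where "\<psi> u = C_const CARD('n) * (2 * real CARD('n)) * fs_d 1 u powr (- (real CARD('n) / 2 + 1))" for u :: "'n heis"
  have \<psi>: "integrable lborel \<psi>" "(\<integral>u. \<psi> u \<partial>lborel) = 1"
    unfolding \<psi>_def by (rule mollifier_kernel)+
  have \<psi>0: "0 \<le> \<psi> u" for u using C_const_pos[of "CARD('n)"] by (simp add: \<psi>_def)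
  have \<psi>c: "continuous_on UNIV \<psi>" unfolding \<psi>_def by (intro continuous_intros) simp
  have eq: "mollify \<epsilon> f q = (\<integral>u. f (heis_shift q (heis_dil \<epsilon> u)) * \<psi> u \<partial>lborel)" if "\<epsilon> > 0" for \<epsilon>
    unfolding \<psi>_def by (rule mollify_eq[OF that f(1,2)])
  have m: "(\<lambda>u. f (heis_shift q (heis_dil \<epsilon> u)) * \<psi> u) \<in> borel_measurable lborel" for \<epsilon>
  proof -
    have "continuous_on UNIV (\<lambda>u. f (heis_shift q (heis_dil \<epsilon> u)) * \<psi> u)"
      by (intro continuous_intros \<psi>c continuous_on_compose2[OF f(1)]) auto
    then show ?thesis by (simp add: borel_measurable_continuous_onI)
  qed
  have le: "f p * \<psi> u \<le> \<psi> u" for p u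
    using mult_right_mono[OF f(3)[of p] \<psi>0[of u]] by simp
  have i: "integrable lborel (\<lambda>u. f (heis_shift q (heis_dil \<epsilon> u)) * \<psi> u)" for \<epsilon>
    by (rule Bochner_Integration.integrable_bound[OF \<psi>(1) m]) (use le f(2) \<psi>0 in \<open>auto simp: abs_mult\<close>)
  show "0 \<le> mollify \<epsilon> f q" if "\<epsilon> > 0"
    unfolding eq[OF that] using f(2) \<psi>0 by (intro Bochner_Integration.integral_nonneg mult_nonneg_nonneg)
  show "mollify \<epsilon> f q \<le> 1" if "\<epsilon> > 0"
    unfolding eq[OF that] \<psi>(2)[symmetric] by (rule integral_mono[OF i \<psi>(1)]) (rule le)
  have "(\<lambda>k. \<integral>u. f (heis_shift q (heis_dil (inverse (real (Suc k))) u)) * \<psi> u \<partial>lborel) \<longlonglongrightarrow> (\<integral>u. f q * \<psi> u \<partial>lborel)"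
  proof (rule integral_dominated_convergence[where w=\<psi>])
    show "(\<lambda>u. f q * \<psi> u) \<in> borel_measurable lborel" using \<psi>(1) by auto
    show "AE u in lborel. (\<lambda>k. f (heis_shift q (heis_dil (inverse (real (Suc k))) u)) * \<psi> u) \<longlonglongrightarrow> f q * \<psi> u"
    proof (rule AE_I2)
      fix u :: "'n heis"
      \<comment> \<open>The dilation extends continuously to r = 0, where it collapses every point
        to the group identity.\<close>
      have "continuous_on UNIV (\<lambda>r. f (heis_shift q (heis_dil r u)))"
        by (intro continuous_intros continuous_on_compose2[OF f(1)]) auto
      then have "isCont (\<lambda>r. f (heis_shift q (heis_dil r u))) 0"
        by (simp add: continuous_on_eq_continuous_at)
      from isCont_tendsto_compose[OF this LIMSEQ_inverse_real_of_nat]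
      have "(\<lambda>k. f (heis_shift q (heis_dil (inverse (real (Suc k))) u))) \<longlonglongrightarrow> f (heis_shift q (heis_dil 0 u))" .
      also have "heis_shift q (heis_dil 0 u) = q"
        by (cases q) (simp add: heis_shift_def heis_dil_def)
      finally show "(\<lambda>k. f (heis_shift q (heis_dil (inverse (real (Suc k))) u)) * \<psi> u) \<longlonglongrightarrow> f q * \<psi> u"
        by (intro tendsto_intros)
    qed
    show "AE u in lborel. norm (f (heis_shift q (heis_dil (inverse (real (Suc k))) u)) * \<psi> u) \<le> \<psi> u" for k
      using le f(2) \<psi>0 by (auto simp: abs_mult)
  qed (use m \<psi>(1) in auto)
  then show "(\<lambda>k. mollify (inverse (real (Suc k))) f q) \<longlonglongrightarrow> f q"
    using \<psi>(2) by (simp add: eq)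
qed

text \<open>The bound \<open>M\<close> on the field does not depend on \<epsilon>, so \<epsilon> can
  tend to 0 with the same normalisation while the divergence tends to \<open>f\<close>. Finite
  measure of \<open>E\<close> and the bound 1 on the mollifications justify the limit of the
  integrals.\<close>

lemma horizontal_perimeter_ge_bump:
  fixes f :: "'n::finite heis \<Rightarrow> real" and E :: "'n heis set"
  assumes f: "continuous_on UNIV f" "\<And>p. 0 \<le> f p" "\<And>p. f p \<le> 1"
    and supp: "\<And>p. p \<notin> cbox a b \<Longrightarrow> f p = 0"
    and v: "v = (\<integral>p. f p \<partial>lborel)" "v > 0" and E: "E \<in> lmeasurable"
  shows "ereal ((LINT p:E|lebesgue. f p) / (C_const CARD('n) * C'_const CARD('n) * v powr (1 / hom_dim CARD('n))))
    \<le> horizontal_perimeter E"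
proof -
  define M where "M = C_const CARD('n) * C'_const CARD('n) * v powr (1 / hom_dim CARD('n))"
  define \<epsilon> where "\<epsilon> k = inverse (real (Suc k))" for k
  have \<epsilon>: "\<epsilon> k > 0" for k by (simp add: \<epsilon>_def)
  have M: "M > 0"
    unfolding M_def using C_const_pos[of "CARD('n)"] C'_const_pos v(2) by (intro mult_pos_pos) auto
  have E': "E \<in> sets lebesgue" using E by auto
  have main: "mollify (\<epsilon> k) f \<in> borel_measurable borel \<and>
      ereal ((LINT p:E|lebesgue. mollify (\<epsilon> k) f p) / M) \<le> horizontal_perimeter E" for k
  proof -
    obtain B where B: "\<And>q. (test_field (\<epsilon> k) f a b has_derivative blinfun_apply (B q)) (at q)"
      "continuous_on UNIV B"
      "\<And>q. hdiv_lin q (blinfun_apply (B q)) = C_const CARD('n) * (2 * real CARD('n) * (\<epsilon> k)\<^sup>2) *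
        integral (cbox a b) (\<lambda>p. f p * fs_d (\<epsilon> k) (heis_diff p q) powr (- (real CARD('n) / 2 + 1)))"
      using test_field_C1[OF \<epsilon> f(1)] by blast
    have h: "hdiv_lin q (blinfun_apply (B q)) = mollify (\<epsilon> k) f q" for q
    proof -
      have "continuous_on UNIV (\<lambda>p. f p * fs_d (\<epsilon> k) (heis_diff p q) powr (- (real CARD('n) / 2 + 1)))"
        using f(1) \<epsilon> by (intro continuous_intros)
      then show ?thesis
        unfolding B(3) mollify_def by (subst integral_cbox_eq_lborel(2)) (auto simp: supp)
    qed
    have "\<bar>mollify (\<epsilon> k) f q\<bar> \<le> 1" for q
      using mollify_nonneg_le_1_tendsto(1,2)[OF f \<epsilon>[of k], of q] by simp
    then have "ereal ((LINT p:E|lebesgue. hdiv_lin p (blinfun_apply (B p))) / M) \<le> horizontal_perimeter E"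
      using norm_test_field_le[OF \<epsilon> f supp v]
      by (intro horizontal_perimeter_ge_bounded_field[OF B(1,2) M _ _ E, where K=1]) (auto simp: h M_def)
    moreover have "mollify (\<epsilon> k) f \<in> borel_measurable borel"
      using borel_measurable_continuous_onI[OF continuous_on_hdiv_lin[OF B(2)]] by (simp add: h)
    ultimately show ?thesis by (simp add: h)
  qed
  have "(\<lambda>k. LINT p:E|lebesgue. mollify (\<epsilon> k) f p) \<longlonglongrightarrow> (LINT p:E|lebesgue. f p)"
    unfolding set_lebesgue_integral_def
  proof (rule integral_dominated_convergence[where w="indicator E"])
    show "integrable lebesgue (indicator E :: 'n heis \<Rightarrow> real)"
      using E by (rule lmeasurable_iff_integrable[THEN iffD1])
    show "(\<lambda>p. indicator E p *\<^sub>R f p) \<in> borel_measurable lebesgue"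
      using E' f(1) by (intro borel_measurable_scaleR borel_measurable_indicator measurable_completion)
        (auto intro: borel_measurable_continuous_onI)
    show "(\<lambda>p. indicator E p *\<^sub>R mollify (\<epsilon> k) f p) \<in> borel_measurable lebesgue" for k
      using E' main[of k] by (intro borel_measurable_scaleR borel_measurable_indicator measurable_completion) auto
    show "AE p in lebesgue. (\<lambda>k. indicator E p *\<^sub>R mollify (\<epsilon> k) f p) \<longlonglongrightarrow> indicator E p *\<^sub>R f p"
      unfolding \<epsilon>_def by (intro AE_I2 tendsto_intros mollify_nonneg_le_1_tendsto(3)[OF f])
    show "AE p in lebesgue. norm (indicator E p *\<^sub>R mollify (\<epsilon> k) f p) \<le> indicator E p" for k
      using mollify_nonneg_le_1_tendsto(1,2)[OF f \<epsilon>[of k]] by (intro AE_I2) (auto simp: indicator_def)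
  qed
  then have "(\<lambda>k. ereal ((LINT p:E|lebesgue. mollify (\<epsilon> k) f p) / M)) \<longlonglongrightarrow> ereal ((LINT p:E|lebesgue. f p) / M)"
    using M by (simp add: tendsto_divide)
  then have "ereal ((LINT p:E|lebesgue. f p) / M) \<le> horizontal_perimeter E"
    by (rule LIMSEQ_le_const2) (use main in blast)
  then show ?thesis by (simp only: M_def)
qed

section \<open>The isoperimetric inequality\<close>

text \<open>Cleared of its denominator, the estimate also covers functions of integral 0, for which
  the left side is at most 0.\<close>

lemma perimeter_volume_bound_bump:
  fixes f :: "'n::finite heis \<Rightarrow> real" and E :: "'n heis set"
  assumes f: "continuous_on UNIV f" "\<And>p. 0 \<le> f p" "\<And>p. f p \<le> 1"
    and supp: "bounded {p. f p \<noteq> 0}" and E: "E \<in> lmeasurable"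
    and P: "horizontal_perimeter E = ereal P"
  shows "(LINT p:E|lebesgue. f p) \<le> P * (C_const CARD('n) * C'_const CARD('n) * (\<integral>p. f p \<partial>lborel) powr (1 / hom_dim CARD('n)))"
proof -
  obtain a where a: "{p. f p \<noteq> 0} \<subseteq> cbox (- a) a"
    using bounded_subset_cbox_symmetric[OF supp] by blast
  then have s: "f p = 0" if "p \<notin> cbox (- a) a" for p using that by auto
  define v where "v = (\<integral>p. f p \<partial>lborel)"
  have fi: "integrable lborel f" by (rule integral_cbox_eq_lborel(1)[OF f(1) s])
  have P0: "P \<ge> 0" using horizontal_perimeter_nonneg[of E] P by simp
  have v0: "v \<ge> 0" unfolding v_def using f(2) by (rule Bochner_Integration.integral_nonneg)
  have KM: "C_const CARD('n) > 0" "C'_const CARD('n) > 0"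
    using C_const_pos[of "CARD('n)"] C'_const_pos by auto
  have E': "E \<in> sets lebesgue" using E by auto
  have fl: "integrable lebesgue f" "(\<integral>p. f p \<partial>lebesgue) = v"
    using fi integrable_completion[of f lborel] integral_completion[of f lborel] by (auto simp: v_def)
  show ?thesis
  proof (cases "v = 0")
    case True
    have "(LINT p:E|lebesgue. f p) \<le> (\<integral>p. f p \<partial>lebesgue)"
      unfolding set_lebesgue_integral_def
    proof (rule integral_mono[OF _ fl(1)])
      show "integrable lebesgue (\<lambda>p. indicator E p *\<^sub>R f p)"
        by (rule integrable_mult_indicator[OF E' fl(1)])
      show "indicator E p *\<^sub>R f p \<le> f p" for p using f(2)[of p] by (simp add: indicator_def)
    qed
    then show ?thesis using fl(2) True P0 by (simp add: v_def)
  next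
    case False
    then have v: "v > 0" using v0 by simp
    let ?M = "C_const CARD('n) * C'_const CARD('n) * v powr (1 / hom_dim CARD('n))"
    have M: "?M > 0" using KM v by (intro mult_pos_pos) auto
    have "ereal ((LINT p:E|lebesgue. f p) / ?M) \<le> ereal P"
      unfolding P[symmetric] by (rule horizontal_perimeter_ge_bump[OF f s v_def v E])
    then have "(LINT p:E|lebesgue. f p) / ?M \<le> P" by simp
    then show ?thesis using M unfolding v_def[symmetric] by (simp only: pos_divide_le_eq)
  qed
qed

text \<open>\<open>E\<close> is squeezed between a closed \<open>T\<close> and an open
  \<open>U\<close> up to volume \<open>d\<close>. A Urysohn function between them has integral at
  least |E| - d over \<open>E\<close>, and total integral at most |E| + d, which is what enters the
  bound on the field.\<close>

lemma perimeter_volume_bound_approx: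
  fixes E :: "'n::finite heis set"
  assumes E: "E \<in> lmeasurable" and P: "horizontal_perimeter E = ereal P" and d: "d > 0"
  shows "measure lebesgue E - d
    \<le> P * (C_const CARD('n) * C'_const CARD('n) * (measure lebesgue E + d) powr (1 / hom_dim CARD('n)))"
proof -
  define K where "K = C_const CARD('n) * C'_const CARD('n)"
  have E': "E \<in> sets lebesgue" using E by auto
  have P0: "P \<ge> 0" using horizontal_perimeter_nonneg[of E] P by simp
  have K0: "K \<ge> 0"
    using C_const_pos[of "CARD('n)"] C'_const_pos[of "CARD('n)"] by (simp add: K_def)
  obtain T where T: "closed T" "T \<subseteq> E" "E - T \<in> lmeasurable" "emeasure lebesgue (E - T) < ennreal d"
    using sets_lebesgue_inner_closed[OF E' d] by blast
  obtain U where U: "open U" "E \<subseteq> U" "U - E \<in> lmeasurable" "emeasure lebesgue (U - E) < ennreal d"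
    using sets_lebesgue_outer_open[OF E' d] by blast
  have mT: "measure lebesgue (E - T) \<le> d" and mU: "measure lebesgue (U - E) \<le> d"
    using T(4) U(4) d by (auto simp: measure_def intro!: enn2real_leI)
  have Ul: "U \<in> lmeasurable"
    using fmeasurable.Un[OF E U(3)] U(2) by (simp add: Un_absorb1)
  have "measure lebesgue U \<le> measure lebesgue E + measure lebesgue (U - E)"
    using measure_Un_le[of E lebesgue "U - E"] E' U(2,3) by (simp add: fmeasurableD Un_absorb1)
  then have mU': "measure lebesgue U \<le> measure lebesgue E + d" using mU by simp
  have Tl: "T \<in> lmeasurable"
    using fmeasurable_Diff[OF E, of "E - T"] T(2,3) by (simp add: fmeasurableD double_diff)
  have "measure lebesgue E \<le> measure lebesgue T + measure lebesgue (E - T)"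
    using measure_Un_le[of T lebesgue "E - T"] T(2,3) Tl by (simp add: fmeasurableD Un_absorb1)
  then have mT': "measure lebesgue E - d \<le> measure lebesgue T" using mT by simp
  obtain g :: "'n heis \<Rightarrow> real" where g: "continuous_on UNIV g" "\<And>x. g x \<in> closed_segment 1 0"
      "\<And>x. x \<in> T \<Longrightarrow> g x = 1" "\<And>x. x \<in> - U \<Longrightarrow> g x = 0"
  proof (rule Urysohn[of T "- U" "1::real" 0])
    show "T \<inter> - U = {}" using T(2) U(2) by auto
  qed (use T(1) U(1) in auto)
  have g01: "0 \<le> g x" "g x \<le> 1" for x
    using g(2)[of x] by (auto simp: closed_segment_eq_real_ivl)
  have gm: "g \<in> borel_measurable lebesgue"
    using borel_measurable_continuous_onI[OF g(1)] by (intro measurable_completion) simp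
  have Ei: "integrable lebesgue (indicator E :: 'n heis \<Rightarrow> real)"
    using E by (rule lmeasurable_iff_integrable[THEN iffD1])
  \<comment> \<open>\<open>U\<close> has finite measure but may be unbounded, so the Urysohn
    function is cut off before the bound for functions of bounded support applies.\<close>
  define f where "f k x = cutoff (real (Suc k)) x * g x" for k x
  have fc: "continuous_on UNIV (f k)" for k unfolding f_def by (intro continuous_intros g(1))
  have cu: "0 \<le> cutoff (real (Suc k)) x" "cutoff (real (Suc k)) x \<le> 1" for k and x :: "'n heis"
    by (auto intro: cutoff_nonneg cutoff_le_1)
  have f01: "0 \<le> f k x" "f k x \<le> 1" for k x
    unfolding f_def using cu[of k x] g01[of x] by (auto intro: mult_le_one)
  have fsupp: "bounded {p. f k p \<noteq> 0}" for k
    by (rule bounded_subset[OF bounded_cutoff_support[of "real (Suc k)"]]) (auto simp: f_def)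
  have fint: "(\<integral>p. f k p \<partial>lborel) \<le> measure lebesgue E + d" for k
  proof -
    obtain a where "{p. f k p \<noteq> 0} \<subseteq> cbox (- a) a"
      using bounded_subset_cbox_symmetric[OF fsupp] by blast
    then have s: "f k p = 0" if "p \<notin> cbox (- a) a" for p using that by auto
    have fi: "integrable lborel (f k)" by (rule integral_cbox_eq_lborel(1)[OF fc s])
    have "(\<integral>p. f k p \<partial>lborel) = (\<integral>p. f k p \<partial>lebesgue)"
      using fi by (intro integral_completion[symmetric]) auto
    also have "\<dots> \<le> (\<integral>p. indicator U p \<partial>lebesgue)"
    proof (rule integral_mono)
      show "integrable lebesgue (f k)" using fi integrable_completion[of "f k" lborel] by auto
      show "integrable lebesgue (indicator U :: 'n heis \<Rightarrow> real)"
        using Ul by (rule lmeasurable_iff_integrable[THEN iffD1])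
      show "f k p \<le> indicator U p" for p
        using f01(2)[of k p] g(4)[of p] by (auto simp: indicator_def f_def)
    qed
    also have "\<dots> = measure lebesgue U" by simp
    finally show ?thesis using mU' by simp
  qed
  have bound: "(LINT p:E|lebesgue. f k p) \<le> P * (K * (measure lebesgue E + d) powr (1 / hom_dim CARD('n)))" for k
  proof -
    have "(LINT p:E|lebesgue. f k p) \<le> P * (K * (\<integral>p. f k p \<partial>lborel) powr (1 / hom_dim CARD('n)))"
      unfolding K_def by (rule perimeter_volume_bound_bump[OF fc f01 fsupp E P])
    also have "\<dots> \<le> P * (K * (measure lebesgue E + d) powr (1 / hom_dim CARD('n)))"
    proof -
      have "0 \<le> (\<integral>p. f k p \<partial>lborel)" using f01(1) by (rule Bochner_Integration.integral_nonneg)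
      then show ?thesis
        using fint[of k] P0 K0 hom_dim_gt[of "CARD('n)"]
        by (intro mult_left_mono powr_mono2) auto
    qed
    finally show ?thesis .
  qed
  have "(\<lambda>k. LINT p:E|lebesgue. f k p) \<longlonglongrightarrow> (LINT p:E|lebesgue. g p)"
    unfolding set_lebesgue_integral_def
  proof (rule integral_dominated_convergence[where w="indicator E"])
    show "(\<lambda>p. indicator E p *\<^sub>R g p) \<in> borel_measurable lebesgue"
      using E' gm by (intro borel_measurable_scaleR borel_measurable_indicator)
    show "(\<lambda>p. indicator E p *\<^sub>R f k p) \<in> borel_measurable lebesgue" for k
      using E' borel_measurable_continuous_onI[OF fc[of k]]
      by (intro borel_measurable_scaleR borel_measurable_indicator measurable_completion) auto
    show "AE p in lebesgue. (\<lambda>k. indicator E p *\<^sub>R f k p) \<longlonglongrightarrow> indicator E p *\<^sub>R g p"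
    proof (rule AE_I2)
      fix p
      have "(\<lambda>k. f k p) \<longlonglongrightarrow> 1 * g p"
        unfolding f_def by (intro tendsto_intros cutoff_tendsto_1)
      then show "(\<lambda>k. indicator E p *\<^sub>R f k p) \<longlonglongrightarrow> indicator E p *\<^sub>R g p"
        by (intro tendsto_intros) simp
    qed
    show "AE p in lebesgue. norm (indicator E p *\<^sub>R f k p) \<le> indicator E p" for k
    proof (rule AE_I2)
      fix p show "norm (indicator E p *\<^sub>R f k p) \<le> indicator E p"
        using f01[of k p] by (simp add: indicator_def)
    qed
  qed (rule Ei)
  then have gb: "(LINT p:E|lebesgue. g p) \<le> P * (K * (measure lebesgue E + d) powr (1 / hom_dim CARD('n)))"
    by (rule LIMSEQ_le_const2) (use bound in blast)
  have "measure lebesgue T = (\<integral>p. indicator T p \<partial>lebesgue)" by simp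
  also have "\<dots> \<le> (LINT p:E|lebesgue. g p)"
    unfolding set_lebesgue_integral_def
  proof (rule integral_mono)
    show "integrable lebesgue (indicator T :: 'n heis \<Rightarrow> real)"
      using Tl by (rule lmeasurable_iff_integrable[THEN iffD1])
    show "integrable lebesgue (\<lambda>p. indicator E p *\<^sub>R g p)"
    proof (rule Bochner_Integration.integrable_bound[OF Ei])
      show "(\<lambda>p. indicator E p *\<^sub>R g p) \<in> borel_measurable lebesgue"
        using E' gm by (intro borel_measurable_scaleR borel_measurable_indicator)
      show "AE p in lebesgue. norm (indicator E p *\<^sub>R g p) \<le> norm (indicator E p :: real)"
      proof (rule AE_I2)
        fix p show "norm (indicator E p *\<^sub>R g p) \<le> norm (indicator E p :: real)"
          using g01[of p] by (simp add: indicator_def)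
      qed
    qed
    show "indicator T p \<le> indicator E p *\<^sub>R g p" for p
      using g(3)[of p] g01(1)[of p] T(2) by (auto simp: indicator_def)
  qed
  finally show ?thesis using gb mT' by (simp add: K_def)
qed

text \<open>By maximality of the isoperimetric constant it suffices to verify the bound for each
  set. Letting \<open>d\<close> tend to 0 gives m <= P K m^(1/Q), and division by m^(1/Q) produces
  the required exponent. An infinite perimeter leaves nothing to show.\<close>

theorem theorem11p3:
  shows "isoperimetric_constant TYPE('n::finite)
    \<ge> ereal (inverse (C_const CARD('n)) * inverse (C'_const CARD('n)))"
proof (rule isoperimetric_constant_greatest(2))
  define Q where "Q = hom_dim CARD('n)"
  define K where "K = C_const CARD('n) * C'_const CARD('n)"
  have Q2: "Q \<ge> 2" unfolding Q_def by (rule hom_dim_gt)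
  have K0: "K > 0"
    using C_const_pos[of "CARD('n)"] C'_const_pos[of "CARD('n)"] by (simp add: K_def)
  show "isoperimetric_bound TYPE('n) (ereal (inverse (C_const CARD('n)) * inverse (C'_const CARD('n))))"
    unfolding isoperimetric_bound_def
  proof (intro allI impI)
    fix E :: "'n heis set" assume E: "E \<in> lmeasurable"
    define m where "m = measure lebesgue E"
    have ex: "(2 * real CARD('n) + 1) / (2 * real CARD('n) + 2) = 1 - 1 / Q"
      by (simp add: Q_def hom_dim_def field_simps)
    have "ereal (inverse K * m powr (1 - 1 / Q)) \<le> horizontal_perimeter E"
    proof (cases "horizontal_perimeter E" rule: ereal_cases)
      case (real P)
      have P0: "P \<ge> 0" using horizontal_perimeter_nonneg[of E] real by simp
      show ?thesis
      proof (cases "m = 0")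
        \<comment> \<open>Here the power of m is 0, so nonnegativity of the perimeter suffices; the
          other case divides by m^(1/Q).\<close>
        case True
        then show ?thesis using real P0 by simp
      next
        case False
        then have m: "m > 0" unfolding m_def by (simp add: zero_less_measure_iff)
        have le: "m - inverse (real (Suc k)) \<le> P * (K * (m + inverse (real (Suc k))) powr (1 / Q))" for k
          unfolding m_def K_def Q_def by (rule perimeter_volume_bound_approx[OF E real]) simp
        have "(\<lambda>k. m - inverse (real (Suc k))) \<longlonglongrightarrow> m - 0"
          by (intro tendsto_intros LIMSEQ_inverse_real_of_nat)
        moreover have "(\<lambda>k. P * (K * (m + inverse (real (Suc k))) powr (1 / Q))) \<longlonglongrightarrow> P * (K * (m + 0) powr (1 / Q))"
          using m by (intro tendsto_intros LIMSEQ_inverse_real_of_nat) auto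
        ultimately have "m - 0 \<le> P * (K * (m + 0) powr (1 / Q))"
          by (rule LIMSEQ_le) (use le in blast)
        then have "m / m powr (1 / Q) \<le> P * K"
          using m by (simp add: pos_divide_le_eq mult.assoc)
        moreover have "m powr (1 - 1 / Q) = m / m powr (1 / Q)"
          using m by (subst powr_diff) simp
        ultimately have "inverse K * m powr (1 - 1 / Q) \<le> P"
          using K0 pos_divide_le_eq[OF K0, of "m powr (1 - 1 / Q)" P] by (simp add: divide_inverse mult.commute)
        then show ?thesis using real by simp
      qed
    qed (use horizontal_perimeter_nonneg[of E] in auto)
    then show "ereal (inverse (C_const CARD('n)) * inverse (C'_const CARD('n))) *
        ereal (measure lebesgue E powr ((2 * real CARD('n) + 1) / (2 * real CARD('n) + 2)))
        \<le> horizontal_perimeter E"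
      unfolding ex by (simp add: K_def m_def)
  qed
qed

end
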